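(* Let $A\in\mathbb{R}^{n\times n}$, $B\in\mathbb{R}^{n\times m}$, $Q\in\mathbb{R}^{n\times n}$, $S\in\mathbb{R}^{n\times m}$, $R\in\mathbb{R}^{m\times m}$ be such that the matrix $\Pi=\begin{bmatrix} Q & S\\ S^\top & R\end{bmatrix}$ is symmetric and positive semidefinite ($R$ is allowed to be singular). Consider the problem of minimizing $$J_\infty(x_0,u)=\int_0^\infty \begin{bmatrix} x^\top(t) & u^\top(t)\end{bmatrix}\begin{bmatrix} Q & S\\ S^\top & R\end{bmatrix}\begin{bmatrix} x(t)\\ u(t)\end{bmatrix}dt$$ over control inputs $u$, subject to $\dot x(t)=A\,x(t)+B\,u(t)$, $x(0)=x_0\in\mathbb{R}^n$. Then the following four statements are equivalent: (A) For every initial state $x_0\in\mathbb{R}^n$, the minimization problem admits a regular solution. (B) There exists a symmetric positive semidefinite matrix $X\in\mathbb{R}^{n\times n}$ satisfying both $$XA+A^\top X-(S+XB)\,R^\dagger\,(S^\top+B^\top X)+Q=0\qquad\text{and}\qquad \ker R\subseteq\ker(S+XB).$$ (C) There exists a symmetric matrix $X\in\mathbb{R}^{n\times n}$ (not necessarily semidefinite) satisfying both $$XA+A^\top X-(S+XB)\,R^\dagger\,(S^\top+B^\top X)+Q=0\qquad\text{and}\qquad \ker R\subseteq\ker(S+XB),$$ and for each initial state $x_0\in\mathbb{R}^n$ there exists a control $u_0$ such that $J_\infty(x_0,u_0)$ is finite. (D) For any factorization $\Pi=\begin{bmatrix} C^\top\\ D^\top\end{bmatrix}\begin{bmatrix}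 C & D\end{bmatrix}$ with $C\in\mathbb{R}^{p\times n}$ and $D\in\mathbb{R}^{p\times m}$, the subspaces $\mathcal{S}^\star$ and $\mathcal{R}^\star$ of the quadruple $(A,B,C,D)$ coincide, and for each initial state $x_0\in\mathbb{R}^n$ there exists a control $u_0$ such that $J_\infty(x_0,u_0)$ is finite.
   Context: $M^\top$ and $M^\dagger$ denote the transpose and the Moore-Penrose pseudo-inverse of $M$. The equation $XA+A^\top X-(S+XB)R^\dagger(S^\top+B^\top X)+Q=0$ together with the condition $\ker R\subseteq\ker(S+XB)$ is called the constrained generalized continuous algebraic Riccati equation, CGCARE. Controls. The class of allowable controls includes distributions: a control is an impulsive-smooth distribution $u=\sum_{i=0}^{k} a_i\,\delta^{(i)}+u_{\rm reg}$, where $a_i\in\mathbb{R}^m$, $\delta^{(i)}$ is the $i$-th derivative of the Dirac delta at $0$, and $u_{\rm reg}$ vanishes for $t<0$ and coincides on $[0,\infty)$ with a function in $C^\infty([0,\infty),\mathbb{R}^m)$. The corresponding state is the unique distribution $x$ supported on $[0,\infty)$ solving $\dot x=Ax+Bu+x_0\delta$, which is again impulsive-smooth. Writing $\Pi=[C\;\,D]^\top[C\;\,D]$ and $y=Cx+Du$, one has $J_\infty(x_0,u)=\int_0^\infty \|y(t)\|^2dt\in[0,\infty]$ if $y$ has no impulsive part, and $J_\infty(x_0,u)=+\infty$ otherwise (this does not depend on the factorization chosen). For $u$ a smooth function on $[0,\infty)$ this is the usual integral. Solutions. A control $u^\ast$ is a solution of the minimization problem for $x_0$ if $J_\infty(x_0,u^\ast)$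 is finite and $J_\infty(x_0,u^\ast)\le J_\infty(x_0,u)$ for all controls $u$. A solution $u^\ast$ is regular if $u^\ast\in C^\infty[0,\infty)$, i.e. it has no impulsive part. Subspaces. For a quadruple $(A,B,C,D)$, associated with the system $\dot x=Ax+Bu$, $y=Cx+Du$: - $\mathcal{S}^\star$ is the smallest input-containing subspace, i.e. the smallest subspace $\mathcal{S}\subseteq\mathbb{R}^n$ for which there exists $L\in\mathbb{R}^{n\times p}$ with $(A+LC)\mathcal{S}\subseteq\mathcal{S}$ and $\operatorname{im}(B+LD)\subseteq\mathcal{S}$. - $\mathcal{R}^\star$ is the largest reachability output-nulling subspace, i.e. the set of states $x_1\in\mathbb{R}^n$ for which there exist $T>0$ and a smooth input $u$ on $[0,T]$ such that the solution with $x(0)=0$ satisfies $x(T)=x_1$ and $y(t)=0$ for all $t\in[0,T]$. *)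

theory Defs
  imports "HOL-Analysis.Analysis"
begin

section \<open>Matrices\<close>

definition pos_semidef :: "real^'a^'a \<Rightarrow> bool" where
  "pos_semidef M \<longleftrightarrow> transpose M = M \<and> (\<forall>v. 0 \<le> v \<bullet> (M *v v))"

text \<open>The Moore-Penrose inverse, as the unique solution of the four Penrose equations.\<close>

definition pseudo_inv :: "real^'a^'b \<Rightarrow> real^'b^'a" where
  "pseudo_inv M = (THE G. M ** G ** M = M \<and> G ** M ** G = G \<and>
     transpose (M ** G) = M ** G \<and> transpose (G ** M) = G ** M)"

definition mat_ker :: "real^'a^'b \<Rightarrow> (real^'a) set" where
  "mat_ker M = {v. M *v v = 0}"

definition join_vec :: "real^'n \<Rightarrow> real^'m \<Rightarrow> real^('n + 'm)" where
  "join_vec x u = (\<chi> i. case i of Inl a \<Rightarrow> x $ a | Inr b \<Rightarrow> u $ b)"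

definition popov_matrix ::
  "real^'n^'n \<Rightarrow> real^'m^'n \<Rightarrow> real^'m^'m \<Rightarrow> real^('n + 'm)^('n + 'm)" where
  "popov_matrix Q S R = (\<chi> i. case i of
      Inl a \<Rightarrow> join_vec (Q $ a) (S $ a)
    | Inr b \<Rightarrow> join_vec (transpose S $ b) (R $ b))"

definition cgcare :: "real^'n^'n \<Rightarrow> real^'m^'n \<Rightarrow> real^'n^'n \<Rightarrow> real^'m^'n \<Rightarrow> real^'m^'m \<Rightarrow>
    real^'n^'n \<Rightarrow> bool" where
  "cgcare A B Q S R X \<longleftrightarrow>
     X ** A + transpose A ** X
       - (S + X ** B) ** pseudo_inv R ** (transpose S + transpose B ** X) + Q = 0 \<and>
     mat_ker R \<subseteq> mat_ker (S + X ** B)"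

text \<open>
  The number \<open>p\<close> of outputs is quantified inside the statement, so it cannot be a type. A matrix
  with \<open>p\<close> rows is therefore given by its rows \<open>C 0, \<dots>, C (p - 1)\<close>; rows with index \<open>\<ge> p\<close> are
  never used. Thus \<open>C i \<bullet> x\<close> is the \<open>i\<close>-th entry of \<open>C x\<close>, and the following says that the Popov
  matrix is \<open>M\<^sup>T M\<close> for the matrix \<open>M = [C D]\<close> with \<open>p\<close> rows.
\<close>

definition factorization :: "real^'n^'n \<Rightarrow> real^'m^'n \<Rightarrow> real^'m^'m \<Rightarrow>
    nat \<Rightarrow> (nat \<Rightarrow> real^'n) \<Rightarrow> (nat \<Rightarrow> real^'m) \<Rightarrow> bool" where
  "factorization Q S R p C D \<longleftrightarrow>
     popov_matrix Q S R =
       (\<chi> i j. \<Sum>k<p. join_vec (C k) (D k) $ i * join_vec (C k) (D k) $ j)"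


section \<open>Smooth functions and distributions on the real line\<close>

text \<open>
  \<open>C\<^sup>\<infinity>\<close> on an interval \<open>I\<close>, with one-sided derivatives at those endpoints that belong to \<open>I\<close>:
  \<open>g k\<close> is the \<open>k\<close>-th derivative.
\<close>

definition smooth_fun_on :: "real set \<Rightarrow> (real \<Rightarrow> 'a::real_normed_vector) \<Rightarrow> bool" where
  "smooth_fun_on I f \<longleftrightarrow> (\<exists>g :: nat \<Rightarrow> real \<Rightarrow> 'a.
     (\<forall>t\<in>I. g 0 t = f t) \<and>
     (\<forall>k. \<forall>t\<in>I. (g k has_vector_derivative g (Suc k) t) (at t within I)))"

definition supp :: "(real \<Rightarrow> real) \<Rightarrow> real set" where
  "supp \<phi> = closure {t. \<phi> t \<noteq> 0}"

definition test_funs :: "(real \<Rightarrow> real) set" where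
  "test_funs = {\<phi>. smooth_fun_on UNIV \<phi> \<and> compact (supp \<phi>)}"

text \<open>
  Vector-valued distributions are functionals on scalar test functions. They are represented by
  total functions whose values outside \<^const>\<open>test_funs\<close> are irrelevant: every definition below
  only depends on the values on test functions, and equality of distributions means equality on
  \<^const>\<open>test_funs\<close>. Continuity is the usual seminorm estimate on each compact set.
\<close>

type_synonym 'a functional = "(real \<Rightarrow> real) \<Rightarrow> 'a"

definition distribution :: "'a::real_normed_vector functional \<Rightarrow> bool" where
  "distribution T \<longleftrightarrow>
     (\<forall>\<phi>\<in>test_funs. \<forall>\<psi>\<in>test_funs. T (\<lambda>t. \<phi> t + \<psi> t) = T \<phi> + T \<psi>) \<and>
     (\<forall>c. \<forall>\<phi>\<in>test_funs. T (\<lambda>t. c * \<phi> t) = c *\<^sub>R T \<phi>) \<and>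
     (\<forall>K. compact K \<longrightarrow> (\<exists>M N. \<forall>\<phi>\<in>test_funs. supp \<phi> \<subseteq> K \<longrightarrow>
        (\<forall>b. (\<forall>k\<le>N. \<forall>t. \<bar>(deriv ^^ k) \<phi> t\<bar> \<le> b) \<longrightarrow> norm (T \<phi>) \<le> M * b)))"

definition supported_nonneg :: "'a::real_normed_vector functional \<Rightarrow> bool" where
  "supported_nonneg T \<longleftrightarrow> (\<forall>\<phi>\<in>test_funs. supp \<phi> \<subseteq> {..<0} \<longrightarrow> T \<phi> = 0)"

text \<open>The \<open>i\<close>-th derivative of the Dirac distribution at \<open>0\<close>.\<close>

definition dirac_deriv :: "nat \<Rightarrow> real functional" where
  "dirac_deriv i \<phi> = (- 1) ^ i * (deriv ^^ i) \<phi> 0"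

text \<open>The distribution given by the function that is \<open>f\<close> on \<open>[0, \<infinity>)\<close> and vanishes for \<open>t < 0\<close>.\<close>

definition regular_distr ::
    "(real \<Rightarrow> 'a) \<Rightarrow> 'a::{banach, second_countable_topology} functional" where
  "regular_distr f \<phi> = (LBINT t:{0..}. \<phi> t *\<^sub>R f t)"

definition impulsive_smooth :: "(real^'m) functional \<Rightarrow> bool" where
  "impulsive_smooth u \<longleftrightarrow> (\<exists>k a f. smooth_fun_on {0..} f \<and>
     (\<forall>\<phi>\<in>test_funs. u \<phi> = (\<Sum>i\<le>k. dirac_deriv i \<phi> *\<^sub>R a i) + regular_distr f \<phi>))"

definition no_impulsive_part :: "(real^'m) functional \<Rightarrow> bool" where
  "no_impulsive_part u \<longleftrightarrow> (\<exists>f. smooth_fun_on {0..} f \<and>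
     (\<forall>\<phi>\<in>test_funs. u \<phi> = regular_distr f \<phi>))"


section \<open>The optimal control problem\<close>

text \<open>
  The equation \<open>x' = A x + B u + x0 \<delta>\<close> in the sense of distributions; the derivative of \<open>x\<close> is
  \<open>\<phi> \<mapsto> - x \<phi>'\<close>.
\<close>

definition state_distr :: "real^'n^'n \<Rightarrow> real^'m^'n \<Rightarrow> real^'n \<Rightarrow>
    (real^'m) functional \<Rightarrow> (real^'n) functional \<Rightarrow> bool" where
  "state_distr A B x0 u x \<longleftrightarrow> distribution x \<and> supported_nonneg x \<and>
     (\<forall>\<phi>\<in>test_funs. - x (deriv \<phi>) = A *v x \<phi> + B *v u \<phi> + dirac_deriv 0 \<phi> *\<^sub>R x0)"

text \<open>The output \<open>C x + D u\<close> has no impulsive part and is given by the smooth functions \<open>y i\<close>.\<close>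

definition smooth_output :: "real^'n^'n \<Rightarrow> real^'m^'n \<Rightarrow>
    nat \<Rightarrow> (nat \<Rightarrow> real^'n) \<Rightarrow> (nat \<Rightarrow> real^'m) \<Rightarrow>
    real^'n \<Rightarrow> (real^'m) functional \<Rightarrow> (nat \<Rightarrow> real \<Rightarrow> real) \<Rightarrow> bool" where
  "smooth_output A B p C D x0 u y \<longleftrightarrow> (\<exists>x. state_distr A B x0 u x \<and>
     (\<forall>i<p. smooth_fun_on {0..} (y i) \<and>
        (\<forall>\<phi>\<in>test_funs. C i \<bullet> x \<phi> + D i \<bullet> u \<phi> = regular_distr (y i) \<phi>)))"

text \<open>
  The choice of \<open>y\<close> is immaterial, since \<open>y i\<close> is determined on \<open>[0, \<infinity>)\<close> for \<open>i < p\<close>.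
\<close>

definition output_energy :: "real^'n^'n \<Rightarrow> real^'m^'n \<Rightarrow>
    nat \<Rightarrow> (nat \<Rightarrow> real^'n) \<Rightarrow> (nat \<Rightarrow> real^'m) \<Rightarrow>
    real^'n \<Rightarrow> (real^'m) functional \<Rightarrow> ennreal" where
  "output_energy A B p C D x0 u =
     (if \<exists>y. smooth_output A B p C D x0 u y
      then let y = (SOME y. smooth_output A B p C D x0 u y)
           in \<integral>\<^sup>+ t\<in>{0..}. ennreal (\<Sum>i<p. (y i t)\<^sup>2) \<partial>lborel
      else \<infinity>)"

text \<open>
  The cost is the energy of the output for some factorization of the Popov matrix; it does not
  depend on the factorization. One exists whenever the Popov matrix is positive semidefinite.
\<close>

definition cost :: "real^'n^'n \<Rightarrow> real^'m^'n \<Rightarrow> real^'n^'n \<Rightarrow> real^'m^'n \<Rightarrow> real^'m^'m \<Rightarrow>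
    real^'n \<Rightarrow> (real^'m) functional \<Rightarrow> ennreal" where
  "cost A B Q S R x0 u =
     (case (SOME (p, C, D). factorization Q S R p C D) of
        (p, C, D) \<Rightarrow> output_energy A B p C D x0 u)"

definition is_solution :: "real^'n^'n \<Rightarrow> real^'m^'n \<Rightarrow> real^'n^'n \<Rightarrow> real^'m^'n \<Rightarrow> real^'m^'m \<Rightarrow>
    real^'n \<Rightarrow> (real^'m) functional \<Rightarrow> bool" where
  "is_solution A B Q S R x0 u \<longleftrightarrow> impulsive_smooth u \<and> cost A B Q S R x0 u < \<infinity> \<and>
     (\<forall>v. impulsive_smooth v \<longrightarrow> cost A B Q S R x0 u \<le> cost A B Q S R x0 v)"

definition is_regular_solution ::
    "real^'n^'n \<Rightarrow> real^'m^'n \<Rightarrow> real^'n^'n \<Rightarrow> real^'m^'n \<Rightarrow> real^'m^'m \<Rightarrow>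
    real^'n \<Rightarrow> (real^'m) functional \<Rightarrow> bool" where
  "is_regular_solution A B Q S R x0 u \<longleftrightarrow>
     is_solution A B Q S R x0 u \<and> no_impulsive_part u"


section \<open>Subspaces of a quadruple\<close>

text \<open>
  The matrix \<open>L\<close> with \<open>p\<close> columns is given by its columns \<open>L 0, \<dots>, L (p - 1)\<close>.
\<close>

definition input_containing :: "real^'n^'n \<Rightarrow> real^'m^'n \<Rightarrow>
    nat \<Rightarrow> (nat \<Rightarrow> real^'n) \<Rightarrow> (nat \<Rightarrow> real^'m) \<Rightarrow> (real^'n) set \<Rightarrow> bool" where
  "input_containing A B p C D V \<longleftrightarrow> subspace V \<and>
     (\<exists>L :: nat \<Rightarrow> real^'n.
        (\<forall>x\<in>V. A *v x + (\<Sum>i<p. (C i \<bullet> x) *\<^sub>R L i) \<in> V) \<and>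
        (\<forall>w. B *v w + (\<Sum>i<p. (D i \<bullet> w) *\<^sub>R L i) \<in> V))"

definition S_star :: "real^'n^'n \<Rightarrow> real^'m^'n \<Rightarrow>
    nat \<Rightarrow> (nat \<Rightarrow> real^'n) \<Rightarrow> (nat \<Rightarrow> real^'m) \<Rightarrow> (real^'n) set" where
  "S_star A B p C D = (LEAST V. input_containing A B p C D V)"

definition R_star :: "real^'n^'n \<Rightarrow> real^'m^'n \<Rightarrow>
    nat \<Rightarrow> (nat \<Rightarrow> real^'n) \<Rightarrow> (nat \<Rightarrow> real^'m) \<Rightarrow> (real^'n) set" where
  "R_star A B p C D = {x1. \<exists>T>0. \<exists>u x. smooth_fun_on {0..T} u \<and>
     (\<forall>t\<in>{0..T}. (x has_vector_derivative A *v x t + B *v u t) (at t within {0..T})) \<and>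
     x 0 = 0 \<and> x T = x1 \<and>
     (\<forall>t\<in>{0..T}. \<forall>i<p. C i \<bullet> x t + D i \<bullet> u t = 0)}"

end

theory Submission
  imports Defs
begin

text \<open>
  Fix a factorization \<open>[C D]\<^sup>T [C D]\<close> of the Popov matrix and put \<open>v = u + R\<^sup>\<dagger> S\<^sup>T x\<close>. The system becomes
  \<open>x' = A0 x + B v\<close> and the running cost \<open>x \<bullet> Q0 x + v \<bullet> R v\<close>. Name the four statements (A), (B), (C), (D)
  in the order in which they occur in the theorem. They are proved equivalent along the cycle
  (B), (C), (D), (A), (B).

  (B) implies (C): completing the square (\<open>dissipation\<close>) shows that the feedback belonging to a positive
  semidefinite solution \<open>X\<close> costs at most \<open>x0 \<bullet> X x0\<close>.

  (C) implies (D): let \<open>W\<close> be the space reachable under \<open>A0\<close> through inputs in \<open>ker R\<close>. Any symmetric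
  solution \<open>X\<close> vanishes on \<open>W\<close>, and so does \<open>Q0\<close>. Hence \<open>W\<close> is input-containing and all its states are
  reached with zero output. Since zero-output trajectories from \<open>0\<close> stay in every input-containing
  subspace, \<open>W\<close> is both \<open>S_star\<close> and \<open>R_star\<close> (\<open>S_star_eq_R_star\<close>).

  (D) implies (A): let \<open>W\<close> be the common subspace. It contains \<open>B (ker R)\<close>, because it is \<open>S_star\<close>, and it
  can be kept invariant at zero cost, because it is \<open>R_star\<close> (\<open>friend_of_R_star\<close>). Modulo \<open>W\<close> the problem is
  regular: for any control of finite cost the projected state has no impulses, starts at the projection
  of \<open>x0\<close> and is driven by the output alone (\<open>reduced_trajectory\<close>). For the regular problem, values for
  finite horizons come from the Hamiltonian flow; bounded by the finite costs of (D), they increase to a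
  matrix \<open>P\<close> that solves the Riccati equation because its graph is invariant under the flow
  (\<open>value_matrix\<close>). So \<open>x0 \<bullet> P x0\<close> bounds the cost of all controls from below, and the smooth feedback
  belonging to \<open>P\<close> attains it.

  (A) implies (B): the optimal cost is a quadratic form \<open>P\<close>, since by the first-order conditions optimal
  trajectories form a linear space (\<open>optimal_cost_matrix\<close>). Comparison with rapidly decaying exponential
  trajectories, which approximate impulses, gives \<open>P B u = 0\<close> for \<open>u\<close> in \<open>ker R\<close> (\<open>cost_matrix_kernel\<close>).
  Comparison with tails of optimal trajectories and with the feedback belonging to \<open>P\<close> gives the Riccati
  equation (\<open>riccati_solution_from_optima\<close>).

  Impulses enter only through the fact that a linear differential equation has at most one solution among
  the distributions supported on the half-line (\<open>homogeneous_distribution_zero\<close>).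
\<close>

declare transpose_matrix_vector [simp del]



section \<open>Symmetric matrices\<close>

lemma inner_matrix_vector: "x \<bullet> (M *v y) = (transpose M *v x) \<bullet> (y::real^'n)"
  by (metis dot_lmul_matrix transpose_matrix_vector)

lemma matrix_eq_inner: "(M::real^'n^'m) = N \<longleftrightarrow> (\<forall>x y. x \<bullet> (M *v y) = x \<bullet> (N *v y))"
  by (metis matrix_eq vector_eq_ldot)

lemma symmetric_iff_inner:
  "transpose (M::real^'n^'n) = M \<longleftrightarrow> (\<forall>x y. x \<bullet> (M *v y) = (M *v x) \<bullet> y)"
  unfolding matrix_eq_inner[of "transpose M"]
  by (metis inner_commute inner_matrix_vector transpose_transpose)

text \<open>First-order condition for a minimum at \<open>s = 0\<close>.\<close>

lemma linear_term_vanishes: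
  fixes a b :: real
  assumes "\<And>s. 0 \<le> a * s + b * s^2"
  shows "a = 0"
proof (rule ccontr)
  assume a: "a \<noteq> 0"
  (* at s = - t the linear term outweighs the quadratic one *)
  define t where "t = a / (\<bar>b\<bar> + 1)"
  have t: "a = t * (\<bar>b\<bar> + 1)" "t \<noteq> 0" using a by (auto simp: t_def)
  have "a * (- t) + b * (- t)^2 = t^2 * (b - \<bar>b\<bar> - 1)"
    unfolding t(1) by (simp add: algebra_simps power2_eq_square)
  moreover have "t^2 * (b - \<bar>b\<bar> - 1) < 0"
    using t(2) by (intro mult_pos_neg) auto
  ultimately show False using assms[of "- t"] by linarith
qed

text \<open>The form is minimal at \<open>v\<close>, so its derivative at \<open>v\<close> in the direction \<open>M v\<close>, which is
  \<open>2 \<bar>M v\<bar>\<^sup>2\<close>, vanishes.\<close>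

lemma pos_semidef_kernel:
  fixes M :: "real^'n^'n"
  assumes "pos_semidef M" and "v \<bullet> (M *v v) = 0"
  shows "M *v v = 0"
proof -
  have sym: "transpose M = M" and pos: "\<And>v. 0 \<le> v \<bullet> (M *v v)"
    using assms(1) by (auto simp: pos_semidef_def)
  let ?w = "M *v v"
  have "0 \<le> (2 * (?w \<bullet> ?w)) * s + (?w \<bullet> (M *v ?w)) * s^2" for s
  proof -
    have "v \<bullet> (M *v ?w) = ?w \<bullet> ?w"
      by (simp add: inner_matrix_vector sym)
    with pos[of "v + s *\<^sub>R ?w"] assms(2) show ?thesis
      by (simp add: matrix_vector_right_distrib matrix_vector_mult_scaleR inner_add
          inner_commute algebra_simps power2_eq_square)
  qed
  from linear_term_vanishes[OF this] show ?thesis by simp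
qed

lemma exists_orthogonal_projector:
  fixes W :: "(real^'n) set"
  assumes "subspace W"
  obtains Z :: "real^'n^'n" where "transpose Z = Z" "\<And>v. Z *v v \<in> W" "\<And>v. v \<in> W \<Longrightarrow> Z *v v = v"
proof -
  have "\<forall>v. \<exists>y\<in>W. \<forall>w\<in>W. (v - y) \<bullet> w = 0"
  proof
    fix v
    obtain y z where "y \<in> span W" "\<And>w. w \<in> span W \<Longrightarrow> orthogonal z w" "v = y + z"
      using orthogonal_subspace_decomp_exists[of W v] by blast
    then show "\<exists>y\<in>W. \<forall>w\<in>W. (v - y) \<bullet> w = 0"
      using assms by (intro bexI[of _ y]) (auto simp: span_eq_iff[THEN iffD2] orthogonal_def)
  qed
  then obtain P where P: "\<And>v. P v \<in> W" "\<And>v w. w \<in> W \<Longrightarrow> (v - P v) \<bullet> w = 0" by metis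
  have uniq: "y = P v" if "y \<in> W" "\<And>w. w \<in> W \<Longrightarrow> (v - y) \<bullet> w = 0" for v y
  proof -
    have d: "P v - y \<in> W" using assms that(1) P(1) by (simp add: subspace_diff)
    have "(P v - y) \<bullet> (P v - y) = (v - y) \<bullet> (P v - y) - (v - P v) \<bullet> (P v - y)"
      by (simp add: algebra_simps)
    also have "\<dots> = 0" using that(2)[OF d] P(2)[OF d] by simp
    finally show ?thesis by simp
  qed
  have "linear P"
  proof (rule linearI)
    fix x y and c :: real
    show "P (x + y) = P x + P y"
    proof (rule uniq[symmetric])
      show "P x + P y \<in> W" using P assms by (simp add: subspace_add)
      fix w assume "w \<in> W"
      then show "(x + y - (P x + P y)) \<bullet> w = 0"
        using P(2)[of w x] P(2)[of w y] by (simp add: inner_add_left inner_diff_left)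
    qed
    show "P (c *\<^sub>R x) = c *\<^sub>R P x"
    proof (rule uniq[symmetric])
      show "c *\<^sub>R P x \<in> W" using P assms by (simp add: subspace_scale)
      fix w assume "w \<in> W"
      then show "(c *\<^sub>R x - c *\<^sub>R P x) \<bullet> w = 0"
        using P(2)[of w x] by (simp add: inner_diff_left)
    qed
  qed
  then have mP: "matrix P *v v = P v" for v by (simp add: matrix_works)
  have "x \<bullet> P y = P x \<bullet> y" for x y
  proof -
    have "x \<bullet> P y = P x \<bullet> P y" "y \<bullet> P x = P y \<bullet> P x"
      using P(2)[OF P(1)[of y], of x] P(2)[OF P(1)[of x], of y] by (simp_all add: inner_diff_left)
    then show ?thesis by (metis inner_commute)
  qed
  then have "transpose (matrix P) = matrix P" by (simp add: symmetric_iff_inner mP)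
  moreover have "P v = v" if "v \<in> W" for v using that by (intro uniq[symmetric]) auto
  ultimately show thesis using that[of "matrix P"] P(1) by (simp add: mP)
qed


section \<open>The Moore-Penrose inverse of a symmetric matrix\<close>

lemma penrose_equations_unique:
  fixes M :: "real^'a^'b" and G H :: "real^'b^'a"
  assumes G: "M ** G ** M = M" "G ** M ** G = G"
      "transpose (M ** G) = M ** G" "transpose (G ** M) = G ** M"
    and H: "M ** H ** M = M" "H ** M ** H = H"
      "transpose (M ** H) = M ** H" "transpose (H ** M) = H ** M"
  shows "G = H"
proof -
  have "M ** G = transpose ((M ** H) ** (M ** G))"
    by (metis G(3) H(1) matrix_mul_assoc)
  also have "\<dots> = (M ** G) ** (M ** H)"
    by (simp only: matrix_transpose_mul[of "M ** H"] G(3) H(3))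
  also have "\<dots> = M ** H" by (metis G(1) matrix_mul_assoc)
  finally have MG: "M ** G = M ** H" .
  have "G ** M = transpose ((G ** M) ** (H ** M))"
    by (metis G(4) H(1) matrix_mul_assoc)
  also have "\<dots> = (H ** M) ** (G ** M)"
    by (simp only: matrix_transpose_mul[of "G ** M"] G(4) H(4))
  also have "\<dots> = H ** M" by (metis G(1) matrix_mul_assoc)
  finally have GM: "G ** M = H ** M" .
  have "G = G ** (M ** G)" by (metis G(2) matrix_mul_assoc)
  also have "\<dots> = (G ** M) ** H" by (simp only: MG matrix_mul_assoc)
  also have "\<dots> = H" by (simp only: GM H(2))
  finally show ?thesis .
qed

text \<open>If \<open>Z\<close> is the orthogonal projector onto the kernel of \<open>R\<close>, then \<open>R + Z\<close> is invertible, and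
  subtracting \<open>Z\<close> from its inverse leaves the inverse of \<open>R\<close> on the range of \<open>R\<close>.\<close>

lemma exists_symmetric_penrose_inverse:
  fixes R :: "real^'m^'m"
  assumes sym: "transpose R = R"
  shows "\<exists>G. R ** G ** R = R \<and> G ** R ** G = G \<and> transpose G = G \<and> G ** R = R ** G"
proof -
  have "subspace (mat_ker R)"
    by (auto simp: subspace_def mat_ker_def matrix_vector_right_distrib matrix_vector_mult_scaleR)
  then obtain Z where Zs: "transpose Z = Z" and Zk: "\<And>v. Z *v v \<in> mat_ker R"
    and Zi: "\<And>v. v \<in> mat_ker R \<Longrightarrow> Z *v v = v"
    by (rule exists_orthogonal_projector) blast
  have matrix_add_rdistrib: "(X + Y) ** V = X ** V + Y ** V" for X Y V :: "real^'m^'m"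
    by (simp add: matrix_eq matrix_vector_mul_assoc[symmetric] matrix_vector_mult_add_rdistrib)
  have RZ: "R ** Z = 0"
    using Zk by (simp add: matrix_eq matrix_vector_mul_assoc[symmetric] mat_ker_def)
  have ZR: "Z ** R = 0"
    using arg_cong[OF RZ, of transpose] 
    by (simp add: matrix_transpose_mul sym Zs) (simp add: transpose_def vec_eq_iff)
  have ZZ: "Z ** Z = Z"
    using Zi[OF Zk] by (simp add: matrix_eq matrix_vector_mul_assoc[symmetric])
  have "v = 0" if "(R + Z) *v v = 0" for v
  proof -
    have e: "R *v v + Z *v v = 0" using that by (simp add: matrix_vector_mult_add_rdistrib)
    then have "Z *v (R *v v) + Z *v (Z *v v) = 0"
      by (metis matrix_vector_right_distrib matrix_vector_mult_0_right)
    then have "Z *v v = 0" using ZR ZZ by (simp add: matrix_vector_mul_assoc)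
    then have "v \<in> mat_ker R" using e by (simp add: mat_ker_def)
    then show ?thesis using Zi \<open>Z *v v = 0\<close> by metis
  qed
  then obtain M where "M ** (R + Z) = mat 1"
    using matrix_left_invertible_ker[of "R + Z"] by blast
  then have M: "M ** (R + Z) = mat 1" "(R + Z) ** M = mat 1"
    by (auto simp: matrix_left_right_inverse)
  have MZ: "M ** Z = Z"
  proof -
    have "(R + Z) ** Z = Z" by (simp add: matrix_add_rdistrib RZ ZZ)
    then show ?thesis by (metis M(1) matrix_mul_assoc matrix_mul_lid)
  qed
  have ZM: "Z ** M = Z"
  proof -
    have "Z ** (R + Z) = Z" by (simp add: matrix_add_ldistrib ZR ZZ)
    then show ?thesis by (metis M(2) matrix_mul_assoc matrix_mul_rid)
  qed
  have MR: "M ** R = mat 1 - Z"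
    using M(1) MZ by (simp add: matrix_add_ldistrib algebra_simps)
  have RM: "R ** M = mat 1 - Z"
    using M(2) ZM by (simp add: matrix_add_rdistrib algebra_simps)
  have Ms: "transpose M = M"
  proof -
    have "transpose M ** (R + Z) = mat 1"
    proof -
      have "transpose (R + Z) = R + Z" using sym Zs by (simp add: transpose_def vec_eq_iff)
      then show ?thesis by (metis M(2) matrix_transpose_mul transpose_mat)
    qed
    then show ?thesis by (metis M(2) matrix_mul_assoc matrix_mul_lid matrix_mul_rid)
  qed
  have sub: "(X - Y) ** V = X ** V - Y ** V" "V ** (X - Y) = V ** X - V ** Y" for X Y V :: "real^'m^'m"
    by (simp_all add: matrix_eq matrix_vector_mul_assoc[symmetric] matrix_vector_mult_diff_rdistrib
        matrix_vector_mult_diff_distrib)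
  have ts: "transpose (X - Y) = transpose X - transpose Y" for X Y :: "real^'m^'m"
    by (simp add: transpose_def vec_eq_iff)
  show ?thesis
    by (intro exI[of _ "M - Z"])
      (simp add: sub MR RM RZ ZR MZ ZM ZZ ts Ms Zs matrix_mul_assoc[symmetric])
qed

lemma pseudo_inv_symmetric:
  fixes R :: "real^'m^'m"
  assumes sym: "transpose R = R"
  shows "R ** pseudo_inv R ** R = R" "pseudo_inv R ** R ** pseudo_inv R = pseudo_inv R"
    "transpose (pseudo_inv R) = pseudo_inv R" "pseudo_inv R ** R = R ** pseudo_inv R"
proof -
  obtain G where G: "R ** G ** R = R" "G ** R ** G = G" "transpose G = G" "G ** R = R ** G"
    using exists_symmetric_penrose_inverse[OF sym] by blast
  have "pseudo_inv R = G"
    unfolding pseudo_inv_def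
  proof (rule the_equality)
    show "R ** G ** R = R \<and> G ** R ** G = G \<and> transpose (R ** G) = R ** G \<and> transpose (G ** R) = G ** R"
      using G by (simp add: matrix_transpose_mul sym)
    then show "H = G" if "R ** H ** R = R \<and> H ** R ** H = H \<and>
        transpose (R ** H) = R ** H \<and> transpose (H ** R) = H ** R" for H
      using penrose_equations_unique that by blast
  qed
  with G show "R ** pseudo_inv R ** R = R" "pseudo_inv R ** R ** pseudo_inv R = pseudo_inv R"
    "transpose (pseudo_inv R) = pseudo_inv R" "pseudo_inv R ** R = R ** pseudo_inv R" by simp_all
qed


section \<open>Factorization of a positive semidefinite matrix\<close>

text \<open>Subtracting from \<open>M\<close> the dyad of \<open>M v / sqrt (v \<bullet> M v)\<close> keeps it positive semidefinite by
  the Cauchy-Schwarz inequality and adds \<open>v\<close> to its kernel, so that finitely many steps end at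
  \<open>0\<close>.\<close>

lemma pos_semidef_gram:
  fixes M :: "real^'a^'a"
  assumes "pos_semidef M"
  shows "\<exists>p (w :: nat \<Rightarrow> real^'a). \<forall>x. M *v x = (\<Sum>k<p. (w k \<bullet> x) *\<^sub>R w k)"
  using assms
proof (induction "CARD('a) - dim (mat_ker M)" arbitrary: M rule: less_induct)
  case (less M)
  have sym: "\<And>x y. x \<bullet> (M *v y) = (M *v x) \<bullet> y" and pos: "\<And>v. 0 \<le> v \<bullet> (M *v v)"
    using less.prems by (auto simp: pos_semidef_def symmetric_iff_inner)
  have sub: "subspace (mat_ker N)" for N :: "real^'a^'a"
    by (auto simp: subspace_def mat_ker_def matrix_vector_right_distrib matrix_vector_mult_scaleR)
  show ?case
  proof (cases "\<forall>v. M *v v = 0")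
    case True
    then show ?thesis by (intro exI[of _ 0]) simp
  next
    case False
    then obtain v where v: "M *v v \<noteq> 0" by blast
    define c where "c = v \<bullet> (M *v v)"
    have c: "c > 0" using v pos_semidef_kernel[OF less.prems, of v] pos[of v] by (auto simp: c_def order_less_le)
    define f where "f x = M *v x - ((v \<bullet> (M *v x)) / c) *\<^sub>R (M *v v)" for x
    have "linear f"
      by (rule linearI) (simp_all add: f_def matrix_vector_right_distrib matrix_vector_mult_scaleR
          inner_add add_divide_distrib algebra_simps)
    then have N: "matrix f *v x = f x" for x by (simp add: matrix_works)
    have ps: "pos_semidef (matrix f)"
      unfolding pos_semidef_def symmetric_iff_inner N
    proof safe
      fix x y
      have "(M *v v) \<bullet> x = (M *v x) \<bullet> v" by (metis sym inner_commute)
      then show "x \<bullet> f y = f x \<bullet> y"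
        by (simp add: f_def inner_diff_left inner_diff_right sym[of x] sym[of v])
    next
      fix x
      define b where "b = v \<bullet> (M *v x)"
      have b: "v \<bullet> (M *v x) = b" "x \<bullet> (M *v v) = b" "v \<bullet> (M *v v) = c"
        by (simp_all add: b_def c_def) (metis sym inner_commute)
      have "0 \<le> (x - (b/c) *\<^sub>R v) \<bullet> (M *v (x - (b/c) *\<^sub>R v))" by (rule pos)
      also have "\<dots> = x \<bullet> (M *v x) - 2 * (b/c) * b + (b/c)^2 * c"
        by (simp add: matrix_vector_mult_diff_distrib matrix_vector_mult_scaleR
            inner_diff_left inner_diff_right b power2_eq_square)
      also have "\<dots> = x \<bullet> (M *v x) - b * b / c" using c by (simp add: field_simps power2_eq_square)
      also have "\<dots> = x \<bullet> f x" by (simp add: f_def inner_diff_right b)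
      finally show "0 \<le> x \<bullet> f x" .
    qed
    have "mat_ker M \<subset> mat_ker (matrix f)"
    proof
      show "mat_ker M \<subseteq> mat_ker (matrix f)" by (auto simp: mat_ker_def N f_def)
      have "v \<in> mat_ker (matrix f)" using c by (simp add: mat_ker_def N f_def c_def)
      then show "mat_ker M \<noteq> mat_ker (matrix f)" using v by (auto simp: mat_ker_def)
    qed
    then have "dim (mat_ker M) < dim (mat_ker (matrix f))"
      by (intro dim_psubset) (simp add: span_eq_iff[THEN iffD2, OF sub])
    moreover have "dim (mat_ker (matrix f)) \<le> CARD('a)"
      using dim_subset_UNIV[of "mat_ker (matrix f)"] by simp
    ultimately have "CARD('a) - dim (mat_ker (matrix f)) < CARD('a) - dim (mat_ker M)" by linarith
    from less.hyps[OF this ps] obtain p and w :: "nat \<Rightarrow> real^'a"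
      where pw: "\<And>x. f x = (\<Sum>k<p. (w k \<bullet> x) *\<^sub>R w k)"
      unfolding N by blast
    define w' where "w' k = (if k < p then w k else (1 / sqrt c) *\<^sub>R (M *v v))" for k
    have "M *v x = (\<Sum>k<Suc p. (w' k \<bullet> x) *\<^sub>R w' k)" for x
    proof -
      have "M *v x = f x + ((v \<bullet> (M *v x)) / c) *\<^sub>R (M *v v)" by (simp add: f_def)
      then show ?thesis using c by (simp add: pw w'_def sym[of v])
    qed
    then show ?thesis by blast
  qed
qed

lemma exists_factorization:
  assumes "pos_semidef (popov_matrix Q S R)"
  shows "\<exists>p C D. factorization Q S R p C D"
proof -
  obtain p and w :: "nat \<Rightarrow> real^('a + 'b)"
    where pw: "\<And>x. popov_matrix Q S R *v x = (\<Sum>k<p. (w k \<bullet> x) *\<^sub>R w k)"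
    using pos_semidef_gram[OF assms] by blast
  have j: "join_vec (\<chi> a. w k $ Inl a) (\<chi> b. w k $ Inr b) = w k" for k
    by (auto simp: join_vec_def vec_eq_iff split: sum.split)
  have "popov_matrix Q S R $ i $ j = (\<Sum>k<p. w k $ i * w k $ j)" for i j
  proof -
    have "popov_matrix Q S R $ i $ j = (popov_matrix Q S R *v axis j 1) $ i"
      by (simp add: matrix_vector_mul_component inner_axis)
    also have "\<dots> = (\<Sum>k<p. w k $ i * w k $ j)"
      by (simp add: pw inner_axis mult.commute)
    finally show ?thesis .
  qed
  then have "factorization Q S R p (\<lambda>k. \<chi> a. w k $ Inl a) (\<lambda>k. \<chi> b. w k $ Inr b)"
    by (simp add: factorization_def vec_eq_iff j)
  then show ?thesis by blast
qed


section \<open>Input-containing subspaces\<close>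

text \<open>Modulo \<open>V\<close> the map \<open>g\<close> factors through the functionals whose common kernel it sends into
  \<open>V\<close>. In the induction, the vectors for the first functionals are taken from the kernel of the
  last one, and the last vector corrects the relation at one point where the last functional is
  \<open>1\<close>.\<close>

lemma functionals_factor:
  fixes f :: "nat \<Rightarrow> 'v::real_vector \<Rightarrow> real" and g :: "'v \<Rightarrow> 'w::real_vector"
  assumes "subspace E" "subspace V" "linear g" "\<And>i. i < p \<Longrightarrow> linear (f i)"
    and "\<And>e. e \<in> E \<Longrightarrow> (\<forall>i<p. f i e = 0) \<Longrightarrow> g e \<in> V"
  shows "\<exists>L. \<forall>e\<in>E. g e + (\<Sum>i<p. f i e *\<^sub>R L i) \<in> V"
  using assms
proof (induction p arbitrary: E)
  case 0
  then show ?case by simp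
next
  case (Suc p)
  interpret fp: linear "f p" by (rule Suc.prems) simp
  define E' where "E' = {e \<in> E. f p e = 0}"
  have "subspace E'" using Suc.prems(1)
    by (auto simp: E'_def subspace_def fp.add fp.scaleR fp.zero)
  moreover have "g e \<in> V" if "e \<in> E'" "\<forall>i<p. f i e = 0" for e
    using Suc.prems(5)[of e] that by (auto simp: E'_def less_Suc_eq)
  ultimately have "\<exists>L. \<forall>e\<in>E'. g e + (\<Sum>i<p. f i e *\<^sub>R L i) \<in> V"
    using Suc.prems(2-4) by (intro Suc.IH) auto
  then obtain L where L: "\<And>e. e \<in> E' \<Longrightarrow> g e + (\<Sum>i<p. f i e *\<^sub>R L i) \<in> V" by blast
  show ?case
  proof (cases "\<exists>e\<in>E. f p e \<noteq> 0")
    case False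
    then have "e \<in> E'" "f p e = 0" if "e \<in> E" for e using that by (auto simp: E'_def)
    then show ?thesis using L by (intro exI[of _ L]) simp
  next
    case True
    then obtain e1 where e1: "e1 \<in> E" "f p e1 \<noteq> 0" by blast
    define e0 where "e0 = (1 / f p e1) *\<^sub>R e1"
    have e0: "e0 \<in> E" "f p e0 = 1" using e1 Suc.prems(1) by (auto simp: e0_def subspace_scale fp.scaleR)
    define l where "l = - (g e0 + (\<Sum>i<p. f i e0 *\<^sub>R L i))"
    have "g e + (\<Sum>i<Suc p. f i e *\<^sub>R (L(p := l)) i) \<in> V" if "e \<in> E" for e
    proof -
      have "e - f p e *\<^sub>R e0 \<in> E'"
        using that e0 Suc.prems(1) by (simp add: E'_def fp.diff fp.scaleR subspace_diff subspace_scale)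
      from L[OF this] have "g (e - f p e *\<^sub>R e0) + (\<Sum>i<p. f i (e - f p e *\<^sub>R e0) *\<^sub>R L i) \<in> V" .
      moreover have "g (e - f p e *\<^sub>R e0) = g e - f p e *\<^sub>R g e0"
        using Suc.prems(3) by (simp add: linear_diff linear_scale)
      moreover have "(\<Sum>i<p. f i (e - f p e *\<^sub>R e0) *\<^sub>R L i)
          = (\<Sum>i<p. f i e *\<^sub>R L i) - f p e *\<^sub>R (\<Sum>i<p. f i e0 *\<^sub>R L i)"
        using Suc.prems(4)
        by (simp add: linear_diff linear_scale scaleR_diff_left sum_subtractf scaleR_sum_right)
      ultimately show ?thesis by (simp add: l_def algebra_simps)
    qed
    then show ?thesis by blast
  qed
qed

text \<open>This description does not mention an output injection, so it is visibly inherited by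
  intersections, which gives a smallest input-containing subspace.\<close>

lemma input_containing_iff:
  "input_containing A B p C D V \<longleftrightarrow> subspace V \<and>
     (\<forall>x\<in>V. \<forall>u. (\<forall>i<p. C i \<bullet> x + D i \<bullet> u = 0) \<longrightarrow> A *v x + B *v u \<in> V)" (is "?l \<longleftrightarrow> ?r")
proof
  assume ?l
  then obtain L where V: "subspace V"
    and L: "\<And>x. x \<in> V \<Longrightarrow> A *v x + (\<Sum>i<p. (C i \<bullet> x) *\<^sub>R L i) \<in> V"
      "\<And>w. B *v w + (\<Sum>i<p. (D i \<bullet> w) *\<^sub>R L i) \<in> V"
    by (auto simp: input_containing_def)
  have "A *v x + B *v u \<in> V" if "x \<in> V" "\<forall>i<p. C i \<bullet> x + D i \<bullet> u = 0" for x u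
  proof -
    have "(\<Sum>i<p. (C i \<bullet> x) *\<^sub>R L i) + (\<Sum>i<p. (D i \<bullet> u) *\<^sub>R L i) = 0"
      using that(2) by (simp add: sum.distrib[symmetric] scaleR_add_left[symmetric])
    moreover have "(A *v x + (\<Sum>i<p. (C i \<bullet> x) *\<^sub>R L i)) + (B *v u + (\<Sum>i<p. (D i \<bullet> u) *\<^sub>R L i)) \<in> V"
      using subspace_add[OF V L(1)[OF that(1)] L(2)] .
    moreover have "(a + s) + (b + t) = a + b + (s + t)" for a b s t :: "real^'a"
      by (simp add: algebra_simps)
    ultimately show ?thesis by (metis add.right_neutral)
  qed
  with V show ?r by blast
next
  assume r: ?r
  define f where "f i e = C i \<bullet> fst e + D i \<bullet> snd e" for i and e :: "(real^'a) \<times> (real^'b)"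
  define g where "g e = A *v fst e + B *v snd e" for e :: "(real^'a) \<times> (real^'b)"
  have "linear (f i)" for i
    by (rule linearI) (auto simp: f_def inner_add algebra_simps)
  moreover have "linear g"
    by (rule linearI) (auto simp: g_def matrix_vector_right_distrib matrix_vector_mult_scaleR algebra_simps)
  moreover have "subspace (V \<times> (UNIV::(real^'b) set))"
    using r by (intro subspace_Times) auto
  moreover have "g e \<in> V" if "e \<in> V \<times> UNIV" "\<forall>i<p. f i e = 0" for e
    using that r by (auto simp: f_def g_def)
  ultimately obtain L where L: "\<forall>e\<in>V \<times> UNIV. g e + (\<Sum>i<p. f i e *\<^sub>R L i) \<in> V"
    using functionals_factor[of "V \<times> UNIV" V g p f] r by blast
  have "A *v x + (\<Sum>i<p. (C i \<bullet> x) *\<^sub>R L i) \<in> V" if "x \<in> V" for x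
    using bspec[OF L, of "(x, 0)"] that by (auto simp: f_def g_def)
  moreover have "B *v w + (\<Sum>i<p. (D i \<bullet> w) *\<^sub>R L i) \<in> V" for w
    using bspec[OF L, of "(0, w)"] subspace_0[of V] r by (auto simp: f_def g_def)
  ultimately show ?l using r by (auto simp: input_containing_def)
qed

lemma S_star_eqI:
  assumes "input_containing A B p C D W" "\<And>V. input_containing A B p C D V \<Longrightarrow> W \<subseteq> V"
  shows "S_star A B p C D = W"
  unfolding S_star_def using assms by (intro Least_equality) auto

lemma input_containing_S_star: "input_containing A B p C D (S_star A B p C D)"
proof -
  define W where "W = \<Inter>{V. input_containing A B p C D V}"
  have "subspace W"
    unfolding W_def by (intro subspace_Inter) (auto simp: input_containing_def)
  then have "input_containing A B p C D W"
    by (auto simp: input_containing_iff W_def)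
  moreover from this have "S_star A B p C D = W" by (rule S_star_eqI) (auto simp: W_def)
  ultimately show ?thesis by simp
qed


section \<open>Linear differential equations\<close>

lemma has_vector_derivative_componentwise:
  fixes f :: "real \<Rightarrow> 'a::euclidean_space"
  shows "(f has_vector_derivative D) (at t within S) \<longleftrightarrow>
    (\<forall>i\<in>Basis. ((\<lambda>t. f t \<bullet> i) has_real_derivative (D \<bullet> i)) (at t within S))"
  unfolding has_vector_derivative_def has_field_derivative_def
  by (subst has_derivative_componentwise_within) (simp add: mult_commute_abs)

lemma constant_on_if_derivative_zero:
  fixes f :: "real \<Rightarrow> 'a::real_normed_vector"
  assumes "convex S" "\<And>t. t \<in> S \<Longrightarrow> (f has_vector_derivative 0) (at t within S)" "s \<in> S" "t \<in> S"
  shows "f t = f s"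
  using has_vector_derivative_zero_constant[OF assms(1,2)] assms(3,4) by metis

text \<open>The exponential of \<open>t f\<close>, applied to \<open>x\<close>.\<close>

definition flow :: "('a::euclidean_space \<Rightarrow> 'a) \<Rightarrow> real \<Rightarrow> 'a \<Rightarrow> 'a" where
  "flow f t x = (\<Sum>n. (t ^ n / fact n) *\<^sub>R (f ^^ n) x)"

context
  fixes f :: "'a::euclidean_space \<Rightarrow> 'a"
  assumes lin: "linear f"
begin

lemma summable_flow: "summable (\<lambda>n. (t ^ n / fact n) *\<^sub>R (f ^^ n) x)"
proof -
  obtain K where K: "\<And>x. norm (f x) \<le> norm x * K" "K > 0"
    using lin linear_linear bounded_linear.pos_bounded by blast
  have b: "norm ((f ^^ n) x) \<le> K ^ n * norm x" for n
  proof (induction n)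
    case (Suc n)
    have "norm (f ((f ^^ n) x)) \<le> norm ((f ^^ n) x) * K" by (rule K)
    also have "\<dots> \<le> (K ^ n * norm x) * K" using Suc K(2) by (intro mult_right_mono) auto
    finally show ?case by (simp add: algebra_simps)
  qed simp
  have "summable (\<lambda>n. norm x * (inverse (fact n) * (\<bar>t\<bar> * K) ^ n))"
    by (intro summable_mult summable_exp)
  moreover have "norm ((t ^ n / fact n) *\<^sub>R (f ^^ n) x) \<le> norm x * (inverse (fact n) * (\<bar>t\<bar> * K) ^ n)" for n
  proof -
    have "norm ((t ^ n / fact n) *\<^sub>R (f ^^ n) x) = (\<bar>t\<bar> ^ n / fact n) * norm ((f ^^ n) x)"
      by (simp add: power_abs)
    also have "\<dots> \<le> (\<bar>t\<bar> ^ n / fact n) * (K ^ n * norm x)" by (intro mult_left_mono b) auto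
    finally show ?thesis by (simp add: field_simps power_mult_distrib)
  qed
  ultimately show ?thesis by (rule summable_comparison_test'[where N = 0])
qed

lemma funpow_linear: "linear (f ^^ n)"
  by (induction n) (auto intro: linear_compose[OF _ lin] linear_id[unfolded id_def] simp: linear_id simp del: o_apply)

lemma linear_flow: "linear (flow f t)"
proof (rule linearI)
  fix x y and c :: real
  show "flow f t (x + y) = flow f t x + flow f t y"
    unfolding flow_def suminf_add[OF summable_flow summable_flow]
    by (simp add: linear_add[OF funpow_linear] scaleR_add_right)
  show "flow f t (c *\<^sub>R x) = c *\<^sub>R flow f t x"
    unfolding flow_def suminf_scaleR_right[OF summable_flow]
    by (simp add: linear_scale[OF funpow_linear] mult.commute)
qed

lemma flow_at_0: "flow f 0 x = x"
proof -
  have "flow f 0 x = (\<Sum>n\<in>{0}. ((0::real) ^ n / fact n) *\<^sub>R (f ^^ n) x)"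
    unfolding flow_def by (rule suminf_finite) auto
  then show ?thesis by simp
qed

lemma flow_commute: "flow f t (f x) = f (flow f t x)"
proof -
  have "f (flow f t x) = (\<Sum>n. f ((t ^ n / fact n) *\<^sub>R (f ^^ n) x))"
    unfolding flow_def using lin by (intro bounded_linear.suminf summable_flow) (simp add: linear_linear)
  then show ?thesis by (simp add: flow_def linear_scale[OF lin] funpow_swap1)
qed

text \<open>Each component is a real power series in \<open>t\<close>, which may be differentiated termwise.\<close>

lemma flow_has_derivative:
  "((\<lambda>t. flow f t x) has_vector_derivative f (flow f t x)) (at t within S)"
  unfolding has_vector_derivative_componentwise
proof
  fix i :: 'a
  define c where "c y n = ((f ^^ n) y \<bullet> i) / fact n" for y n
  have fl: "flow f t y \<bullet> i = (\<Sum>n. c y n * t ^ n)" and sm: "summable (\<lambda>n. c y n * t ^ n)" for y t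
  proof -
    have e: "(\<lambda>n. ((t ^ n / fact n) *\<^sub>R (f ^^ n) y) \<bullet> i) = (\<lambda>n. c y n * t ^ n)"
      by (auto simp: c_def)
    show "flow f t y \<bullet> i = (\<Sum>n. c y n * t ^ n)"
      unfolding flow_def e[symmetric]
      by (rule bounded_linear.suminf[OF bounded_linear_inner_left summable_flow])
    show "summable (\<lambda>n. c y n * t ^ n)"
      unfolding e[symmetric] by (rule bounded_linear.summable[OF bounded_linear_inner_left summable_flow])
  qed
  have "diffs (c x) n = c (f x) n" for n
    by (simp add: diffs_def c_def funpow_swap1 field_simps del: of_nat_Suc)
  then have "((\<lambda>t. \<Sum>n. c x n * t ^ n) has_field_derivative (\<Sum>n. c (f x) n * t ^ n)) (at t)"
    using termdiffs_strong_converges_everywhere[OF sm, of x t] by simp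
  then show "((\<lambda>t. flow f t x \<bullet> i) has_real_derivative f (flow f t x) \<bullet> i) (at t within S)"
    by (simp add: fl flow_commute[symmetric] has_field_derivative_at_within)
qed

lemma flow_euclidean: "flow f t w = (\<Sum>i\<in>Basis. (w \<bullet> i) *\<^sub>R flow f t i)"
  by (subst (1) euclidean_representation[of w, symmetric])
    (simp add: linear_sum[OF linear_flow] linear_scale[OF linear_flow])

lemma flow_moving_has_derivative:
  assumes w: "(w has_vector_derivative w') (at t within S)"
  shows "((\<lambda>t. flow f t (w t)) has_vector_derivative flow f t w' + f (flow f t (w t))) (at t within S)"
proof -
  have "((\<lambda>t. \<Sum>i\<in>Basis. (w t \<bullet> i) *\<^sub>R flow f t i) has_vector_derivative
      (\<Sum>i\<in>Basis. (w t \<bullet> i) *\<^sub>R f (flow f t i) + (w' \<bullet> i) *\<^sub>R flow f t i)) (at t within S)"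
    using w by (intro has_vector_derivative_sum has_vector_derivative_scaleR flow_has_derivative)
      (simp add: has_vector_derivative_componentwise)
  moreover have "(\<Sum>i\<in>Basis. (w t \<bullet> i) *\<^sub>R f (flow f t i) + (w' \<bullet> i) *\<^sub>R flow f t i)
      = flow f t w' + f (flow f t (w t))"
    unfolding flow_euclidean[of t w'] flow_euclidean[of t "w t"]
    by (simp add: sum.distrib linear_sum[OF lin] linear_scale[OF lin] add.commute)
  ultimately show ?thesis by (simp add: flow_euclidean[symmetric])
qed

lemma flow_uminus_moving_has_derivative:
  assumes w: "(w has_vector_derivative w') (at t within S)"
  shows "((\<lambda>t. flow f (- t) (w t)) has_vector_derivative flow f (- t) (w' - f (w t))) (at t within S)"
proof -
  have "((\<lambda>t. flow f (- t) i) has_vector_derivative (- f (flow f (- t) i))) (at t within S)" for i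
  proof -
    have "((\<lambda>t. flow f t i) \<circ> uminus has_vector_derivative (-1) *\<^sub>R f (flow f (- t) i)) (at t within S)"
      by (intro vector_diff_chain_within flow_has_derivative)
        (auto intro!: derivative_eq_intros)
    then show ?thesis by (simp add: o_def)
  qed
  then have "((\<lambda>t. \<Sum>i\<in>Basis. (w t \<bullet> i) *\<^sub>R flow f (- t) i) has_vector_derivative
      (\<Sum>i\<in>Basis. (w t \<bullet> i) *\<^sub>R (- f (flow f (- t) i)) + (w' \<bullet> i) *\<^sub>R flow f (- t) i)) (at t within S)"
    using w by (intro has_vector_derivative_sum has_vector_derivative_scaleR)
      (simp_all add: has_vector_derivative_componentwise)
  moreover have "(\<Sum>i\<in>Basis. (w t \<bullet> i) *\<^sub>R (- f (flow f (- t) i)) + (w' \<bullet> i) *\<^sub>R flow f (- t) i)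
      = flow f (- t) (w' - f (w t))"
    unfolding linear_diff[OF linear_flow] flow_commute flow_euclidean[of "-t" w'] flow_euclidean[of "-t" "w t"]
    by (simp add: sum.distrib linear_sum[OF lin] linear_scale[OF lin] sum_subtractf)
  ultimately show ?thesis by (simp add: flow_euclidean[symmetric])
qed

lemma flow_inverse: "flow f t (flow f (- t) x) = x"
proof -
  have "((\<lambda>t. flow f t (flow f (- t) x)) has_vector_derivative 0) (at t)" for t
    using flow_moving_has_derivative[OF flow_uminus_moving_has_derivative[OF has_vector_derivative_const], of x t UNIV]
    by (simp add: linear_neg[OF linear_flow] flow_commute)
  from constant_on_if_derivative_zero[of UNIV, OF _ this, of 0 t] show ?thesis by (simp add: flow_at_0)
qed

text \<open>Undoing the flow turns a solution into a constant.\<close>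

lemma linear_ode_zero:
  assumes S: "convex S" "s \<in> S" "t \<in> S"
    and x: "\<And>t. t \<in> S \<Longrightarrow> (x has_vector_derivative f (x t)) (at t within S)" and "x s = 0"
  shows "x t = 0"
proof -
  have "((\<lambda>t. flow f (- t) (x t)) has_vector_derivative 0) (at t within S)" if "t \<in> S" for t
    using flow_uminus_moving_has_derivative[OF x[OF that]] by (simp add: linear_0[OF linear_flow])
  then have "flow f (- t) (x t) = flow f (- s) (x s)"
    using S by (intro constant_on_if_derivative_zero) auto
  then have "flow f (- t) (x t) = 0" using assms(5) by (simp add: linear_0[OF linear_flow])
  then have "flow f (- (- t)) (flow f (- t) (x t)) = 0" by (simp add: linear_0[OF linear_flow])
  then show ?thesis using flow_inverse[of t "x t"] by (metis flow_inverse minus_minus linear_0[OF linear_flow])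
qed

lemma flow_add: "flow f (s + t) x = flow f s (flow f t x)"
proof -
  let ?d = "\<lambda>s. flow f (s + t) x - flow f s (flow f t x)"
  have "((\<lambda>s. flow f (s + t) x) has_vector_derivative f (flow f (s + t) x)) (at s)" for s
  proof -
    have "((\<lambda>u. flow f u x) \<circ> (\<lambda>s. s + t) has_vector_derivative 1 *\<^sub>R f (flow f (s + t) x)) (at s)"
      by (intro vector_diff_chain_at flow_has_derivative) (auto intro!: derivative_eq_intros)
    then show ?thesis by (simp add: o_def)
  qed
  then have "(?d has_vector_derivative f (?d s)) (at s)" for s
    unfolding linear_diff[OF lin] by (intro has_vector_derivative_diff flow_has_derivative)
  then have "?d s = 0" by (intro linear_ode_zero[of UNIV 0 s ?d]) (auto simp: flow_at_0)
  then show ?thesis by simp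
qed

end

text \<open>Modulo \<open>W\<close> the equation is homogeneous and starts at \<open>0\<close>.\<close>

lemma ode_stays_in_subspace:
  fixes x :: "real \<Rightarrow> real^'n"
  assumes W: "subspace W" and M: "linear M" "\<And>w. w \<in> W \<Longrightarrow> M w \<in> W" and b: "\<And>t. t \<in> I \<Longrightarrow> b t \<in> W"
    and I: "convex I" "s \<in> I" "t \<in> I" and "x s \<in> W"
    and x: "\<And>t. t \<in> I \<Longrightarrow> (x has_vector_derivative M (x t) + b t) (at t within I)"
  shows "x t \<in> W"
proof -
  obtain Z where "transpose Z = Z" and Z: "\<And>y. Z *v y \<in> W" "\<And>w. w \<in> W \<Longrightarrow> Z *v w = w"
    by (rule exists_orthogonal_projector[OF W]) (rule that)
  define E where "E y = y - Z *v y" for y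
  have lE: "linear E" unfolding E_def by (intro linear_compose_sub linear_ident matrix_vector_mul_linear)
  have EW: "E w = 0" if "w \<in> W" for w using Z(2)[OF that] by (simp add: E_def)
  have "((\<lambda>t. E (x t)) has_vector_derivative (E \<circ> M) (E (x t))) (at t within I)" if t: "t \<in> I" for t
  proof -
    have "E (M (Z *v x t)) = 0" by (intro EW M Z)
    then have "E (M (x t) + b t) = (E \<circ> M) (E (x t))"
      using linear_diff[OF lE] linear_diff[OF M(1)] by (simp add: E_def[of "x t"] linear_add[OF lE] EW[OF b[OF t]])
    then show ?thesis
      using bounded_linear.has_vector_derivative[of E x, OF _ x[OF t]] lE by (simp add: linear_linear)
  qed
  then have "E (x t) = 0"
    by (rule linear_ode_zero[OF linear_compose[OF M(1) lE] I]) (simp_all add: EW[OF \<open>x s \<in> W\<close>])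
  then show ?thesis using Z(1)[of "x t"] by (simp add: E_def)
qed

lemma exists_antiderivative:
  fixes h :: "real \<Rightarrow> 'a::banach"
  assumes "continuous_on UNIV h"
  shows "\<exists>H. H t0 = c \<and> (\<forall>t. (H has_vector_derivative h t) (at t))"
proof -
  (* G n is an antiderivative only on [- n, n]; on overlaps these functions agree *)
  define G where "G n t = integral {- n..t} h - integral {- n..0} h" for n t
  define H where "H t = G (\<bar>t\<bar> + 1) t" for t
  have cont: "continuous_on S h" for S using assms continuous_on_subset by blast
  have int: "h integrable_on {a..b}" for a b by (intro integrable_continuous_real cont)
  have G: "G m t = G n t" if "\<bar>t\<bar> \<le> m" "m \<le> n" for m n t
  proof -
    have "integral {- n..- m} h + integral {- m..s} h = integral {- n..s} h" if "- m \<le> s" for s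
      using that \<open>m \<le> n\<close> by (intro Henstock_Kurzweil_Integration.integral_combine int) auto
    moreover have "- m \<le> t" "- m \<le> 0" using that by auto
    ultimately have "integral {- n..- m} h + integral {- m..t} h = integral {- n..t} h"
      "integral {- n..- m} h + integral {- m..0} h = integral {- n..0} h" by blast+
    then show ?thesis unfolding G_def by (metis add_diff_cancel_left)
  qed
  have "(H has_vector_derivative h t) (at t)" for t
  proof -
    define n where "n = \<bar>t\<bar> + 2"
    have "((\<lambda>u. integral {- n..u} h) has_vector_derivative h t) (at t within {- n..n})"
      by (intro integral_has_vector_derivative cont) (auto simp: n_def)
    then have "((\<lambda>u. integral {- n..u} h) has_vector_derivative h t) (at t)"
      by (subst (asm) at_within_interior) (auto simp: n_def)
    then have "(G n has_vector_derivative h t) (at t)"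
      unfolding G_def by (auto intro!: derivative_eq_intros)
    then show ?thesis
    proof (rule has_vector_derivative_transform_within_open[of _ _ _ "{t - 1<..<t + 1}"])
      fix u assume "u \<in> {t - 1<..<t + 1}"
      then show "G n u = H u" unfolding H_def by (intro G[symmetric]) (auto simp: n_def)
    qed auto
  qed
  then have "((\<lambda>t. H t - H t0 + c) has_vector_derivative h t) (at t)" for t
    by (auto intro!: derivative_eq_intros)
  then show ?thesis by (intro exI[of _ "\<lambda>t. H t - H t0 + c"]) auto
qed

text \<open>Variation of constants.\<close>

lemma forced_ode_exists:
  fixes f :: "'a::euclidean_space \<Rightarrow> 'a"
  assumes lin: "linear f" and b: "continuous_on UNIV b"
  shows "\<exists>z. z t0 = z0 \<and> (\<forall>t. (z has_vector_derivative f (z t) + b t) (at t))"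
proof -
  have fc: "continuous_on UNIV (\<lambda>t. flow f (- t) i)" for i
    by (rule differentiable_imp_continuous_on)
      (metis differentiable_on_def flow_uminus_moving_has_derivative[OF lin has_vector_derivative_const]
        differentiableI_vector)
  have "continuous_on UNIV (\<lambda>t. \<Sum>i\<in>Basis. (b t \<bullet> i) *\<^sub>R flow f (- t) i)"
    by (intro continuous_intros b fc)
  then have "continuous_on UNIV (\<lambda>t. flow f (- t) (b t))"
    by (simp add: flow_euclidean[OF lin, symmetric])
  then obtain w where w: "w t0 = flow f (- t0) z0"
      "\<And>t. (w has_vector_derivative flow f (- t) (b t)) (at t)"
    using exists_antiderivative[of "\<lambda>t. flow f (- t) (b t)" t0 "flow f (- t0) z0"] by blast
  show ?thesis
  proof (intro exI[of _ "\<lambda>t. flow f t (w t)"] conjI allI)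
    show "flow f t0 (w t0) = z0" by (simp add: w flow_inverse[OF lin])
    fix t
    show "((\<lambda>t. flow f t (w t)) has_vector_derivative f (flow f t (w t)) + b t) (at t)"
      using flow_moving_has_derivative[OF lin w(2)[of t]] by (simp add: flow_inverse[OF lin] add.commute)
  qed
qed

lemma forced_ode_exists_nonneg:
  fixes f :: "'a::euclidean_space \<Rightarrow> 'a"
  assumes lin: "linear f" and b: "continuous_on {0..} b"
  shows "\<exists>z. z 0 = z0 \<and> (\<forall>t\<ge>0. (z has_vector_derivative f (z t) + b t) (at t within {0..}))"
proof -
  have "continuous_on UNIV (\<lambda>t. b (max 0 t))"
    by (rule continuous_on_compose2[OF b]) (auto intro!: continuous_intros)
  from forced_ode_exists[OF lin this, of 0 z0] obtain z where
    "z 0 = z0" "\<And>t. (z has_vector_derivative f (z t) + b (max 0 t)) (at t)" by blast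
  then show ?thesis by (metis has_vector_derivative_at_within max.absorb2)
qed


section \<open>Smooth functions\<close>

text \<open>Smoothness is a greatest fixed point: a class of functions that contains a derivative of
  each of its members consists of smooth functions. Closure properties follow by naming such a
  class.\<close>

lemma smooth_fun_on_coinduct:
  assumes "P f" and step: "\<And>f. P f \<Longrightarrow> \<exists>f'. (\<forall>t\<in>I. (f has_vector_derivative f' t) (at t within I)) \<and> P f'"
  shows "smooth_fun_on I f"
proof -
  have "\<exists>g. \<forall>n. (P (g n) \<and> (n = 0 \<longrightarrow> g n = f)) \<and>
      (\<forall>t\<in>I. (g n has_vector_derivative g (Suc n) t) (at t within I))"
    by (rule dependent_nat_choice) (use assms in auto)
  then obtain g where "\<And>n. P (g n) \<and> (n = 0 \<longrightarrow> g n = f)"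
      "\<And>n. \<forall>t\<in>I. (g n has_vector_derivative g (Suc n) t) (at t within I)" by blast
  then show ?thesis unfolding smooth_fun_on_def by (intro exI[of _ g]) auto
qed

lemma smooth_fun_on_derivative:
  assumes "smooth_fun_on I f"
  obtains f' where "smooth_fun_on I f'" "\<And>t. t \<in> I \<Longrightarrow> (f has_vector_derivative f' t) (at t within I)"
proof -
  obtain g where g: "\<forall>t\<in>I. g 0 t = f t"
    "\<And>k t. t \<in> I \<Longrightarrow> (g k has_vector_derivative g (Suc k) t) (at t within I)"
    using assms by (auto simp: smooth_fun_on_def)
  show thesis
  proof
    show "smooth_fun_on I (g 1)"
      unfolding smooth_fun_on_def using g(2) by (intro exI[of _ "\<lambda>k. g (Suc k)"]) auto
    fix t assume "t \<in> I"
    then show "(f has_vector_derivative g 1 t) (at t within I)"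
      using g(1) g(2)[of t 0] by (intro has_vector_derivative_transform[of t I f "g 0"]) simp_all
  qed
qed

lemma smooth_fun_on_continuous: "smooth_fun_on I f \<Longrightarrow> continuous_on I f"
  by (erule smooth_fun_on_derivative) (auto intro: continuous_on_vector_derivative)

lemma smooth_fun_on_linear:
  assumes "bounded_linear L" "smooth_fun_on I f"
  shows "smooth_fun_on I (\<lambda>t. L (f t))"
proof (rule smooth_fun_on_coinduct[where P = "\<lambda>h. \<exists>f. smooth_fun_on I f \<and> h = (\<lambda>t. L (f t))"])
  fix h :: "real \<Rightarrow> 'b"
  assume "\<exists>f. smooth_fun_on I f \<and> h = (\<lambda>t. L (f t))"
  then obtain f where f: "smooth_fun_on I f" "h = (\<lambda>t. L (f t))" by blast
  obtain f' where f': "smooth_fun_on I f'" "\<And>t. t \<in> I \<Longrightarrow> (f has_vector_derivative f' t) (at t within I)"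
    by (rule smooth_fun_on_derivative[OF f(1)]) blast
  then show "\<exists>h'. (\<forall>t\<in>I. (h has_vector_derivative h' t) (at t within I)) \<and>
      (\<exists>f. smooth_fun_on I f \<and> h' = (\<lambda>t. L (f t)))"
    unfolding f(2) using bounded_linear.has_vector_derivative[OF assms(1)]
    by (intro exI[of _ "\<lambda>t. L (f' t)"] conjI ballI exI[of _ f']) auto
qed (use assms in blast)

lemma smooth_fun_on_const: "smooth_fun_on I (\<lambda>t. c)"
  by (rule smooth_fun_on_coinduct[where P = "\<lambda>h. \<exists>c. h = (\<lambda>t. c)"]) (auto intro!: exI[of _ "\<lambda>t. 0"])

lemma smooth_fun_on_add:
  assumes "smooth_fun_on I f" "smooth_fun_on I g"
  shows "smooth_fun_on I (\<lambda>t. f t + g t)"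
proof (rule smooth_fun_on_coinduct[where P = "\<lambda>h. \<exists>f g. smooth_fun_on I f \<and> smooth_fun_on I g \<and> h = (\<lambda>t. f t + g t)"])
  fix h :: "real \<Rightarrow> 'a"
  assume "\<exists>f g. smooth_fun_on I f \<and> smooth_fun_on I g \<and> h = (\<lambda>t. f t + g t)"
  then obtain f g where h: "smooth_fun_on I f" "smooth_fun_on I g" "h = (\<lambda>t. f t + g t)" by blast
  from h obtain f' g' where "smooth_fun_on I f'" "smooth_fun_on I g'"
      "\<And>t. t \<in> I \<Longrightarrow> (f has_vector_derivative f' t) (at t within I)"
      "\<And>t. t \<in> I \<Longrightarrow> (g has_vector_derivative g' t) (at t within I)"
    by (meson smooth_fun_on_derivative)
  then show "\<exists>h'. (\<forall>t\<in>I. (h has_vector_derivative h' t) (at t within I)) \<and>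
      (\<exists>f g. smooth_fun_on I f \<and> smooth_fun_on I g \<and> h' = (\<lambda>t. f t + g t))"
    unfolding h(3) by (intro exI[of _ "\<lambda>t. f' t + g' t"]) (auto intro: has_vector_derivative_add)
qed (use assms in blast)

lemma smooth_fun_on_matrix: "smooth_fun_on I f \<Longrightarrow> smooth_fun_on I (\<lambda>t. M *v f t :: real^'n)"
  by (rule smooth_fun_on_linear) (simp_all add: matrix_vector_mul_bounded_linear)

lemma smooth_fun_on_scaleR_const: "smooth_fun_on I f \<Longrightarrow> smooth_fun_on I (\<lambda>t. c *\<^sub>R f t)"
  by (rule smooth_fun_on_linear) (simp_all add: bounded_linear_scaleR_right)

lemma smooth_fun_on_uminus: "smooth_fun_on I f \<Longrightarrow> smooth_fun_on I (\<lambda>t. - f t)"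
  using smooth_fun_on_scaleR_const[of I f "-1"] by simp

lemma smooth_fun_on_diff:
  "smooth_fun_on I f \<Longrightarrow> smooth_fun_on I g \<Longrightarrow> smooth_fun_on I (\<lambda>t. f t - g t)"
  using smooth_fun_on_add[OF _ smooth_fun_on_uminus] by fastforce

text \<open>Products of smooth functions do not form a class closed under differentiation, but by the
  Leibniz rule their finite sums do.\<close>

inductive sum_of_products :: "real set \<Rightarrow> (real \<Rightarrow> 'a::real_normed_vector) \<Rightarrow> bool" for I where
  product: "smooth_fun_on I a \<Longrightarrow> smooth_fun_on I b \<Longrightarrow> sum_of_products I (\<lambda>t. a t *\<^sub>R b t)"
| plus: "sum_of_products I f \<Longrightarrow> sum_of_products I g \<Longrightarrow> sum_of_products I (\<lambda>t. f t + g t)"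

lemma smooth_fun_on_scaleR:
  assumes "smooth_fun_on I a" "smooth_fun_on I b"
  shows "smooth_fun_on I (\<lambda>t. a t *\<^sub>R b t)"
proof (rule smooth_fun_on_coinduct[where P = "sum_of_products I"])
  fix h :: "real \<Rightarrow> 'a"
  assume "sum_of_products I h"
  then show "\<exists>h'. (\<forall>t\<in>I. (h has_vector_derivative h' t) (at t within I)) \<and> sum_of_products I h'"
  proof induction
    case (product a b)
    from product obtain a' b' where ab: "smooth_fun_on I a'" "smooth_fun_on I b'"
      "\<And>t. t \<in> I \<Longrightarrow> (a has_vector_derivative a' t) (at t within I)"
      "\<And>t. t \<in> I \<Longrightarrow> (b has_vector_derivative b' t) (at t within I)"
      by (meson smooth_fun_on_derivative)
    show ?case
    proof (intro exI[of _ "\<lambda>t. a t *\<^sub>R b' t + a' t *\<^sub>R b t"] conjI ballI)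
      show "sum_of_products I (\<lambda>t. a t *\<^sub>R b' t + a' t *\<^sub>R b t)"
        by (intro sum_of_products.intros product ab)
      fix t assume t: "t \<in> I"
      show "((\<lambda>t. a t *\<^sub>R b t) has_vector_derivative a t *\<^sub>R b' t + a' t *\<^sub>R b t) (at t within I)"
        using ab(3)[OF t] ab(4)[OF t]
        by (intro has_vector_derivative_scaleR) (simp add: has_real_derivative_iff_has_vector_derivative)
    qed
  next
    case (plus f g)
    then obtain f' g' where "\<forall>t\<in>I. (f has_vector_derivative f' t) (at t within I)" "sum_of_products I f'"
      "\<forall>t\<in>I. (g has_vector_derivative g' t) (at t within I)" "sum_of_products I g'" by blast
    then show ?case
      by (intro exI[of _ "\<lambda>t. f' t + g' t"]) (auto intro: has_vector_derivative_add sum_of_products.plus)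
  qed
qed (intro sum_of_products.product assms)

lemma smooth_fun_on_mult:
  "smooth_fun_on I a \<Longrightarrow> smooth_fun_on I b \<Longrightarrow> smooth_fun_on I (\<lambda>t. a t * b t :: real)"
  using smooth_fun_on_scaleR[of I a b] by simp

lemma smooth_fun_on_ode:
  assumes L: "bounded_linear L" and "smooth_fun_on I b"
    and "\<And>t. t \<in> I \<Longrightarrow> (x has_vector_derivative L (x t) + b t) (at t within I)"
  shows "smooth_fun_on I x"
proof (rule smooth_fun_on_coinduct[where P = "\<lambda>x. \<exists>b. smooth_fun_on I b \<and>
      (\<forall>t\<in>I. (x has_vector_derivative L (x t) + b t) (at t within I))"])
  fix x :: "real \<Rightarrow> 'a"
  assume "\<exists>b. smooth_fun_on I b \<and> (\<forall>t\<in>I. (x has_vector_derivative L (x t) + b t) (at t within I))"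
  then obtain b where b: "smooth_fun_on I b"
    "\<And>t. t \<in> I \<Longrightarrow> (x has_vector_derivative L (x t) + b t) (at t within I)" by blast
  obtain b' where b': "smooth_fun_on I b'" "\<And>t. t \<in> I \<Longrightarrow> (b has_vector_derivative b' t) (at t within I)"
    by (rule smooth_fun_on_derivative[OF b(1)]) blast
  have "((\<lambda>t. L (x t) + b t) has_vector_derivative L (L (x t) + b t) + b' t) (at t within I)" if "t \<in> I" for t
    using that b b' bounded_linear.has_vector_derivative[OF L]
    by (intro has_vector_derivative_add) auto
  then show "\<exists>x'. (\<forall>t\<in>I. (x has_vector_derivative x' t) (at t within I)) \<and>
     (\<exists>b. smooth_fun_on I b \<and> (\<forall>t\<in>I. (x' has_vector_derivative L (x' t) + b t) (at t within I)))"
    using b b' by (intro exI[of _ "\<lambda>t. L (x t) + b t"]) auto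
qed (use assms in blast)

lemma smooth_fun_on_flow:
  assumes "linear f"
  shows "smooth_fun_on I (\<lambda>t. flow f t x)"
  using flow_has_derivative[OF assms] assms
  by (intro smooth_fun_on_ode[OF _ smooth_fun_on_const[of _ 0], of f]) (auto simp: linear_linear)

lemma smooth_fun_on_affine:
  assumes "smooth_fun_on UNIV f"
  shows "smooth_fun_on UNIV (\<lambda>t. f (c * t + d))"
proof (rule smooth_fun_on_coinduct[where P = "\<lambda>h. \<exists>f k. smooth_fun_on UNIV f \<and> h = (\<lambda>t. k *\<^sub>R f (c * t + d))"])
  fix h :: "real \<Rightarrow> 'a"
  assume "\<exists>f k. smooth_fun_on UNIV f \<and> h = (\<lambda>t. k *\<^sub>R f (c * t + d))"
  then obtain f k where f: "smooth_fun_on UNIV f" "h = (\<lambda>t. k *\<^sub>R f (c * t + d))" by blast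
  obtain f' where f': "smooth_fun_on UNIV f'" "\<And>t. (f has_vector_derivative f' t) (at t)"
    using smooth_fun_on_derivative[OF f(1)] by auto
  have "(h has_vector_derivative (k * c) *\<^sub>R f' (c * t + d)) (at t)" for t
  proof -
    have "(f \<circ> (\<lambda>t. c * t + d) has_vector_derivative c *\<^sub>R f' (c * t + d)) (at t)"
      by (intro vector_diff_chain_at f') (auto intro!: derivative_eq_intros)
    from has_vector_derivative_scaleR[OF DERIV_const[of k] this] show ?thesis
      by (simp add: f(2) o_def)
  qed
  then show "\<exists>h'. (\<forall>t\<in>UNIV. (h has_vector_derivative h' t) (at t within UNIV)) \<and>
      (\<exists>f k. smooth_fun_on UNIV f \<and> h' = (\<lambda>t. k *\<^sub>R f (c * t + d)))"
    using f'(1) by (intro exI[of _ "\<lambda>t. (k * c) *\<^sub>R f' (c * t + d)"]) auto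
qed (use assms in \<open>auto intro!: exI[of _ f] exI[of _ 1]\<close>)


section \<open>Test functions\<close>

lemma test_funs_iff:
  "\<phi> \<in> test_funs \<longleftrightarrow> smooth_fun_on UNIV \<phi> \<and> (\<exists>M\<ge>0. \<forall>t. M < \<bar>t\<bar> \<longrightarrow> \<phi> t = 0)"
proof -
  have "compact (supp \<phi>)" if "\<forall>t. M < \<bar>t\<bar> \<longrightarrow> \<phi> t = 0" for M
  proof -
    have "supp \<phi> \<subseteq> cball 0 M"
      unfolding supp_def using that by (intro closure_minimal) (auto simp: not_less)
    then show ?thesis
      by (metis bounded_cball bounded_subset closed_closure compact_eq_bounded_closed supp_def)
  qed
  moreover have "\<exists>M\<ge>0. \<forall>t. M < \<bar>t\<bar> \<longrightarrow> \<phi> t = 0" if c: "compact (supp \<phi>)"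
  proof -
    obtain M where M: "\<And>t. t \<in> supp \<phi> \<Longrightarrow> norm t \<le> M"
      using compact_imp_bounded[OF c] by (auto simp: bounded_iff)
    have "\<phi> t = 0" if "max M 0 < \<bar>t\<bar>" for t
      using M[of t] that closure_subset[of "{t. \<phi> t \<noteq> 0}"] unfolding supp_def by fastforce
    then show ?thesis by (intro exI[of _ "max M 0"]) auto
  qed
  ultimately show ?thesis by (auto simp: test_funs_def)
qed

lemma test_funsI: "smooth_fun_on UNIV \<phi> \<Longrightarrow> 0 \<le> M \<Longrightarrow> (\<And>t. M < \<bar>t\<bar> \<Longrightarrow> \<phi> t = 0) \<Longrightarrow> \<phi> \<in> test_funs"
  by (auto simp: test_funs_iff)

lemma smooth_fun_deriv:
  assumes "smooth_fun_on UNIV (\<phi> :: real \<Rightarrow> real)"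
  shows "(\<phi> has_real_derivative deriv \<phi> t) (at t)" "smooth_fun_on UNIV (deriv \<phi>)"
proof -
  obtain \<phi>' where p: "smooth_fun_on UNIV \<phi>'" "\<And>t. (\<phi> has_vector_derivative \<phi>' t) (at t)"
    by (rule smooth_fun_on_derivative[OF assms]) auto
  then have d: "(\<phi> has_real_derivative \<phi>' t) (at t)" for t
    by (simp add: has_real_derivative_iff_has_vector_derivative)
  then have "deriv \<phi> = \<phi>'" by (auto intro: DERIV_imp_deriv)
  with d p show "(\<phi> has_real_derivative deriv \<phi> t) (at t)" "smooth_fun_on UNIV (deriv \<phi>)" by auto
qed

lemma test_fun_deriv:
  assumes "\<phi> \<in> test_funs"
  shows "(\<phi> has_real_derivative deriv \<phi> t) (at t)" "deriv \<phi> \<in> test_funs"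
proof -
  obtain M where s: "smooth_fun_on UNIV \<phi>" and M: "M \<ge> 0" "\<And>t. M < \<bar>t\<bar> \<Longrightarrow> \<phi> t = 0"
    using assms by (auto simp: test_funs_iff)
  show "(\<phi> has_real_derivative deriv \<phi> t) (at t)" by (rule smooth_fun_deriv[OF s])
  have "deriv \<phi> t = 0" if "M < \<bar>t\<bar>" for t
  proof (rule DERIV_imp_deriv)
    have "open {t::real. M < \<bar>t\<bar>}" by (intro open_Collect_less continuous_intros)
    then show "(\<phi> has_real_derivative 0) (at t)"
      by (rule has_field_derivative_transform_within_open[OF DERIV_const[of 0]]) (use that M in auto)
  qed
  then show "deriv \<phi> \<in> test_funs" using M by (intro test_funsI smooth_fun_deriv[OF s]) auto
qed

lemma test_fun_add: "\<phi> \<in> test_funs \<Longrightarrow> \<psi> \<in> test_funs \<Longrightarrow> (\<lambda>t. \<phi> t + \<psi> t) \<in> test_funs"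
proof -
  assume "\<phi> \<in> test_funs" "\<psi> \<in> test_funs"
  then obtain M N where "smooth_fun_on UNIV \<phi>" "0 \<le> M" "\<And>t. M < \<bar>t\<bar> \<Longrightarrow> \<phi> t = 0"
    "smooth_fun_on UNIV \<psi>" "\<And>t. N < \<bar>t\<bar> \<Longrightarrow> \<psi> t = 0" by (auto simp: test_funs_iff)
  then show ?thesis by (intro test_funsI[of _ "max M N"] smooth_fun_on_add) auto
qed

lemma test_fun_sum: "(\<And>j. j \<in> K \<Longrightarrow> \<psi> j \<in> test_funs) \<Longrightarrow> (\<lambda>t. \<Sum>j\<in>K. \<psi> j t) \<in> test_funs"
  by (induction K rule: infinite_finite_induct)
    (auto intro: test_fun_add test_funsI[of _ 0] smooth_fun_on_const)

lemma test_fun_mult: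
  assumes "smooth_fun_on UNIV a" "\<phi> \<in> test_funs"
  shows "(\<lambda>t. a t * \<phi> t) \<in> test_funs"
proof -
  obtain M where "smooth_fun_on UNIV \<phi>" "0 \<le> M" "\<And>t. M < \<bar>t\<bar> \<Longrightarrow> \<phi> t = 0"
    using assms(2) by (auto simp: test_funs_iff)
  then show ?thesis using assms(1) by (intro test_funsI[of _ M] smooth_fun_on_mult) auto
qed

lemma test_fun_scale: "\<phi> \<in> test_funs \<Longrightarrow> (\<lambda>t. c * \<phi> t) \<in> test_funs"
  by (rule test_fun_mult[OF smooth_fun_on_const])

lemma test_fun_continuous: "\<phi> \<in> test_funs \<Longrightarrow> continuous_on S \<phi>"
  by (meson continuous_on_subset smooth_fun_on_continuous subset_UNIV test_funs_iff)

text \<open>The derivatives of \<open>exp (- 1 / t)\<close>, extended by \<open>0\<close> to \<open>t \<le> 0\<close>, all have this form.\<close>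

definition flat_exp :: "real poly \<Rightarrow> real \<Rightarrow> real" where
  "flat_exp p t = (if t > 0 then poly p (1 / t) * exp (- 1 / t) else 0)"

lemma poly_div_exp_tendsto_0: "((\<lambda>s. poly p s / exp s) \<longlongrightarrow> (0::real)) at_top"
proof -
  have "((\<lambda>s. \<Sum>i\<le>degree p. coeff p i * (s ^ i / exp s)) \<longlongrightarrow> (\<Sum>i\<le>degree p. coeff p i * 0)) at_top"
    by (intro tendsto_sum tendsto_mult tendsto_const tendsto_power_div_exp_0)
  then show ?thesis by (simp add: poly_altdef sum_divide_distrib)
qed

lemma flat_exp_has_derivative:
  "(flat_exp p has_real_derivative flat_exp ([:0, 0, 1:] * (p - pderiv p)) t) (at t)"
proof -
  consider "t > 0" | "t < 0" | "t = 0" by linarith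
  then show ?thesis
  proof cases
    case 1
    have "((\<lambda>t. poly p (1 / t) * exp (- 1 / t)) has_real_derivative
        poly (pderiv p) (1 / t) * (- 1 / t^2) * exp (- 1 / t) + poly p (1 / t) * (exp (- 1 / t) * (1 / t^2))) (at t)"
      using 1 by (auto intro!: derivative_eq_intros poly_DERIV[THEN DERIV_chain2] simp: power2_eq_square field_simps)
    moreover have "poly (pderiv p) (1 / t) * (- 1 / t^2) * exp (- 1 / t) + poly p (1 / t) * (exp (- 1 / t) * (1 / t^2))
        = flat_exp ([:0, 0, 1:] * (p - pderiv p)) t"
      using 1 by (simp add: flat_exp_def power2_eq_square field_simps)
    ultimately have "((\<lambda>t. poly p (1 / t) * exp (- 1 / t)) has_real_derivative
        flat_exp ([:0, 0, 1:] * (p - pderiv p)) t) (at t)" by simp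
    then show ?thesis
      by (rule has_field_derivative_transform_within_open[of _ _ _ "{0<..}"])
        (use 1 in \<open>auto simp: flat_exp_def\<close>)
  next
    case 2
    have "(flat_exp p has_real_derivative 0) (at t)"
      by (rule has_field_derivative_transform_within_open[OF DERIV_const[of 0], of "{..<0}"])
        (use 2 in \<open>auto simp: flat_exp_def\<close>)
    then show ?thesis using 2 by (simp add: flat_exp_def)
  next
    case 3
    have "((\<lambda>h. poly ([:0, 1:] * p) (inverse h) / exp (inverse h)) \<longlongrightarrow> 0) (at_right 0)"
      by (rule filterlim_compose[OF poly_div_exp_tendsto_0 filterlim_inverse_at_top_right])
    moreover have "\<forall>\<^sub>F h in at_right 0. poly ([:0, 1:] * p) (inverse h) / exp (inverse h)
        = (flat_exp p (0 + h) - flat_exp p 0) / h"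
      by (auto simp: eventually_at_right_field flat_exp_def field_simps exp_minus intro!: exI[of _ 1])
    ultimately have "((\<lambda>h. (flat_exp p (0 + h) - flat_exp p 0) / h) \<longlongrightarrow> 0) (at_right 0)"
      by (rule Lim_transform_eventually)
    moreover have "((\<lambda>h. (flat_exp p (0 + h) - flat_exp p 0) / h) \<longlongrightarrow> 0) (at_left 0)"
      by (rule tendsto_eventually) (auto simp: eventually_at_left_field flat_exp_def intro!: exI[of _ "-1"])
    ultimately have "(flat_exp p has_real_derivative 0) (at 0)"
      unfolding DERIV_def by (simp add: filterlim_split_at)
    then show ?thesis using 3 by (simp add: flat_exp_def)
  qed
qed

lemma smooth_fun_on_flat_exp: "smooth_fun_on UNIV (flat_exp p)"
  by (rule smooth_fun_on_coinduct[where P = "\<lambda>h. \<exists>p. h = flat_exp p"])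
    (use flat_exp_has_derivative in \<open>auto simp: has_real_derivative_iff_has_vector_derivative\<close>)

lemma exists_bump:
  fixes a b :: real
  shows "\<exists>\<rho>\<in>test_funs. (\<forall>t. (a < t \<and> t < b \<longrightarrow> 0 < \<rho> t) \<and> (\<not> (a < t \<and> t < b) \<longrightarrow> \<rho> t = 0))"
proof -
  define \<rho> where "\<rho> t = flat_exp 1 (1 * t + - a) * flat_exp 1 (- 1 * t + b)" for t
  have s: "smooth_fun_on UNIV \<rho>"
    unfolding \<rho>_def by (intro smooth_fun_on_mult smooth_fun_on_affine smooth_fun_on_flat_exp)
  have z: "\<rho> t = 0" if "\<not> (a < t \<and> t < b)" for t using that by (auto simp: \<rho>_def flat_exp_def)
  have "\<rho> \<in> test_funs" 
    by (intro test_funsI[of _ "max \<bar>a\<bar> \<bar>b\<bar>"] s z) (auto simp: abs_if split: if_splits)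
  moreover have "0 < \<rho> t" if "a < t" "t < b" for t using that by (simp add: \<rho>_def flat_exp_def)
  ultimately show ?thesis using z by (intro bexI[of _ \<rho>]) auto
qed

text \<open>The normalized antiderivative of a bump on \<open>(a, b)\<close>.\<close>

lemma exists_cutoff:
  fixes a b :: real
  assumes "a < b"
  shows "\<exists>\<kappa>. smooth_fun_on UNIV \<kappa> \<and> (\<forall>t\<le>a. \<kappa> t = 0) \<and> (\<forall>t\<ge>b. \<kappa> t = (1::real))"
proof -
  obtain \<rho> where \<rho>: "\<rho> \<in> test_funs" "\<And>t. a < t \<Longrightarrow> t < b \<Longrightarrow> 0 < \<rho> t" "\<And>t. \<not> (a < t \<and> t < b) \<Longrightarrow> \<rho> t = 0"
    using exists_bump[of a b] by blast
  obtain H where H: "H a = 0" "\<And>t. (H has_vector_derivative \<rho> t) (at t)"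
    using exists_antiderivative[OF test_fun_continuous[OF \<rho>(1)], of a 0] by blast
  have s: "smooth_fun_on UNIV H"
  proof (rule smooth_fun_on_ode)
    show "smooth_fun_on UNIV \<rho>" using \<rho>(1) by (simp add: test_funs_iff)
    show "bounded_linear (\<lambda>_::real. 0::real)" by simp
    show "(H has_vector_derivative 0 + \<rho> t) (at t)" for t using H(2) by simp
  qed
  have d: "(H has_real_derivative \<rho> t) (at t)" for t
    using H(2) by (simp add: has_real_derivative_iff_has_vector_derivative)
  have 1: "H t = H s" if "convex S" "s \<in> S" "t \<in> S" "\<And>t. t \<in> S \<Longrightarrow> \<rho> t = 0" for S s t
    using that H(2) by (intro constant_on_if_derivative_zero[of S])
      (metis has_vector_derivative_at_within)+
  have l: "H t = 0" if "t \<le> a" for t using 1[of "{..a}" a t] that \<rho>(3) H(1) by auto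
  have r: "H t = H b" if "b \<le> t" for t using 1[of "{b..}" b t] that \<rho>(3) by auto
  have "H a < H b"
    by (rule DERIV_pos_imp_increasing_open[OF assms])
      (use d \<rho>(2) in \<open>auto intro!: continuous_at_imp_continuous_on DERIV_isCont\<close>)
  then have "H b > 0" using H(1) by simp
  show ?thesis
  proof (intro exI[of _ "\<lambda>t. (1 / H b) *\<^sub>R H t"] conjI allI impI)
    show "smooth_fun_on UNIV (\<lambda>t. (1 / H b) *\<^sub>R H t)" by (rule smooth_fun_on_scaleR_const[OF s])
    show "(1 / H b) *\<^sub>R H t = 0" if "t \<le> a" for t using l[OF that] by simp
    show "(1 / H b) *\<^sub>R H t = 1" if "b \<le> t" for t using r[OF that] \<open>H b > 0\<close> by simp
  qed
qed


section \<open>Distributions given by functions\<close>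

lemma set_integrable_test_fun:
  fixes f :: "real \<Rightarrow> 'a::euclidean_space"
  assumes "continuous_on {0..} f" "\<phi> \<in> test_funs"
  shows "set_integrable lborel {0..} (\<lambda>t. \<phi> t *\<^sub>R f t)"
proof -
  obtain M where M: "M \<ge> 0" "\<And>t. M < \<bar>t\<bar> \<Longrightarrow> \<phi> t = 0"
    using assms(2) by (auto simp: test_funs_iff)
  have "set_integrable lborel {0..M} (\<lambda>t. \<phi> t *\<^sub>R f t)"
    using assms by (intro borel_integrable_atLeastAtMost' continuous_intros test_fun_continuous)
      (auto intro: continuous_on_subset)
  moreover have "(\<lambda>t. indicator {0..M} t *\<^sub>R \<phi> t *\<^sub>R f t) = (\<lambda>t. indicator {0..} t *\<^sub>R \<phi> t *\<^sub>R f t)"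
  proof
    show "indicator {0..M} t *\<^sub>R \<phi> t *\<^sub>R f t = indicator {0..} t *\<^sub>R \<phi> t *\<^sub>R f t" for t
      using M(2)[of t] by (cases "t \<le> M") (auto simp: indicator_def)
  qed
  ultimately show ?thesis by (simp add: set_integrable_def)
qed

lemma regular_distr_eq_integral:
  fixes f :: "real \<Rightarrow> 'a::euclidean_space"
  assumes "continuous_on {0..} f" "\<phi> \<in> test_funs" "\<And>t. M < t \<Longrightarrow> \<phi> t = 0"
  shows "regular_distr f \<phi> = integral {0..M} (\<lambda>t. \<phi> t *\<^sub>R f t)"
proof -
  have "regular_distr f \<phi> = integral {0..} (\<lambda>t. \<phi> t *\<^sub>R f t)"
    unfolding regular_distr_def
    by (rule set_borel_integral_eq_integral[OF set_integrable_test_fun[OF assms(1,2)]])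
  also have "\<dots> = integral {0..M} (\<lambda>t. \<phi> t *\<^sub>R f t)"
    using assms(3) by (intro integral_spike_set) (auto intro!: empty_imp_negligible simp: not_le)
  finally show ?thesis .
qed

lemma regular_distr_linear:
  fixes f :: "real \<Rightarrow> 'a::euclidean_space" and L :: "'a \<Rightarrow> 'b::euclidean_space"
  assumes "linear L" "continuous_on {0..} f" "\<phi> \<in> test_funs"
  shows "L (regular_distr f \<phi>) = regular_distr (\<lambda>t. L (f t)) \<phi>"
proof -
  have "set_lebesgue_integral lborel {0..} (\<lambda>t. L (\<phi> t *\<^sub>R f t)) = L (set_lebesgue_integral lborel {0..} (\<lambda>t. \<phi> t *\<^sub>R f t))"
    using set_integrable_test_fun[OF assms(2,3)] assms(1) unfolding set_integrable_def set_lebesgue_integral_def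
    by (subst integral_bounded_linear[of L, symmetric])
      (auto simp: linear_linear linear_scale)
  then show ?thesis by (simp add: regular_distr_def linear_scale[OF assms(1)])
qed

lemma regular_distr_add:
  fixes f g :: "real \<Rightarrow> 'a::euclidean_space"
  assumes "continuous_on {0..} f" "continuous_on {0..} g" "\<phi> \<in> test_funs"
  shows "regular_distr (\<lambda>t. f t + g t) \<phi> = regular_distr f \<phi> + regular_distr g \<phi>"
  unfolding regular_distr_def scaleR_add_right
  using assms by (intro set_integral_add set_integrable_test_fun)

lemma regular_distr_sum:
  fixes f :: "'i \<Rightarrow> real \<Rightarrow> 'a::euclidean_space"
  assumes "\<And>i. i \<in> K \<Longrightarrow> continuous_on {0..} (f i)" "\<phi> \<in> test_funs"
  shows "regular_distr (\<lambda>t. \<Sum>i\<in>K. f i t) \<phi> = (\<Sum>i\<in>K. regular_distr (f i) \<phi>)"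
  using assms(1)
proof (induction K rule: infinite_finite_induct)
  case (insert i K)
  then show ?case using assms(2) by (simp add: regular_distr_add continuous_on_sum)
qed (simp_all add: regular_distr_def set_lebesgue_integral_def)

text \<open>Integration by parts: the boundary term at \<open>0\<close> is the Dirac distribution.\<close>

lemma regular_distr_derivative:
  fixes x :: "real \<Rightarrow> 'a::euclidean_space"
  assumes x: "\<And>t. 0 \<le> t \<Longrightarrow> (x has_vector_derivative x' t) (at t within {0..})"
    and x': "continuous_on {0..} x'" and \<phi>: "\<phi> \<in> test_funs"
  shows "- regular_distr x (deriv \<phi>) = regular_distr x' \<phi> + \<phi> 0 *\<^sub>R x 0"
proof -
  obtain M where M: "M \<ge> 0" "\<And>t. M < \<bar>t\<bar> \<Longrightarrow> \<phi> t = 0" "\<And>t. M < \<bar>t\<bar> \<Longrightarrow> deriv \<phi> t = 0"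
  proof -
    obtain M N where "M \<ge> 0" "\<And>t. M < \<bar>t\<bar> \<Longrightarrow> \<phi> t = 0" "\<And>t. N < \<bar>t\<bar> \<Longrightarrow> deriv \<phi> t = 0"
      using \<phi> test_fun_deriv(2)[OF \<phi>] by (auto simp: test_funs_iff)
    then show thesis by (intro that[of "max M N"]) auto
  qed
  define T where "T = M + 1"
  have cx: "continuous_on {0..} x"
    by (rule continuous_on_vector_derivative[of _ _ x']) (use x in auto)
  have "((\<lambda>t. \<phi> t *\<^sub>R x t) has_vector_derivative \<phi> t *\<^sub>R x' t + deriv \<phi> t *\<^sub>R x t) (at t within {0..T})"
    if "t \<in> {0..T}" for t
    using that x[of t] test_fun_deriv(1)[OF \<phi>, of t]
    by (intro has_vector_derivative_scaleR)
      (auto intro: has_field_derivative_at_within has_vector_derivative_within_subset)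
  then have "((\<lambda>t. \<phi> t *\<^sub>R x' t + deriv \<phi> t *\<^sub>R x t) has_integral \<phi> T *\<^sub>R x T - \<phi> 0 *\<^sub>R x 0) {0..T}"
    using M(1) by (intro fundamental_theorem_of_calculus) (auto simp: T_def)
  moreover have "(\<lambda>t. \<phi> t *\<^sub>R x' t) integrable_on {0..T}" "(\<lambda>t. deriv \<phi> t *\<^sub>R x t) integrable_on {0..T}"
    using x' cx \<phi> test_fun_deriv(2)[OF \<phi>]
    by (auto intro!: integrable_continuous_real continuous_intros test_fun_continuous intro: continuous_on_subset)
  ultimately have "integral {0..T} (\<lambda>t. \<phi> t *\<^sub>R x' t) + integral {0..T} (\<lambda>t. deriv \<phi> t *\<^sub>R x t) = - \<phi> 0 *\<^sub>R x 0"
    using M by (simp add: integral_add[symmetric] integral_unique T_def)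
  moreover have "regular_distr x' \<phi> = integral {0..T} (\<lambda>t. \<phi> t *\<^sub>R x' t)"
    "regular_distr x (deriv \<phi>) = integral {0..T} (\<lambda>t. deriv \<phi> t *\<^sub>R x t)"
    using x' cx \<phi> test_fun_deriv(2)[OF \<phi>] M by (auto intro!: regular_distr_eq_integral simp: T_def)
  moreover have "- b = a + c" if "a + b = - c" for a b c :: 'a
    using that by (metis add.commute add_diff_cancel_left' diff_minus_eq_add minus_diff_eq)
  ultimately show ?thesis by simp
qed

lemma distribution_regular_distr:
  fixes f :: "real \<Rightarrow> 'a::euclidean_space"
  assumes f: "continuous_on {0..} f"
  shows "distribution (regular_distr f)"
  unfolding distribution_def
proof (intro conjI ballI allI impI)
  fix \<phi> \<psi> and c :: real
  assume p: "\<phi> \<in> test_funs"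
  show "regular_distr f (\<lambda>t. c * \<phi> t) = c *\<^sub>R regular_distr f \<phi>"
    using regular_distr_linear[OF linear_scale_self f p, of c]
    by (simp add: regular_distr_def mult.commute)
  assume "\<psi> \<in> test_funs"
  then show "regular_distr f (\<lambda>t. \<phi> t + \<psi> t) = regular_distr f \<phi> + regular_distr f \<psi>"
    unfolding regular_distr_def scaleR_add_left using p f by (intro set_integral_add set_integrable_test_fun)
next
  fix K :: "real set"
  assume "compact K"
  then obtain T where T: "\<And>t. t \<in> K \<Longrightarrow> norm t \<le> T" using compact_imp_bounded[of K] by (auto simp: bounded_iff)
  have cf: "continuous_on {0..T} f" using f by (rule continuous_on_subset) auto
  show "\<exists>M N. \<forall>\<phi>\<in>test_funs. supp \<phi> \<subseteq> K \<longrightarrow>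
      (\<forall>b. (\<forall>k\<le>N. \<forall>t. \<bar>(deriv ^^ k) \<phi> t\<bar> \<le> b) \<longrightarrow> norm (regular_distr f \<phi>) \<le> M * b)"
  proof (intro exI[of _ "integral {0..T} (\<lambda>t. norm (f t))"] exI[of _ "0::nat"] ballI impI allI)
    fix \<phi> b
    assume \<phi>: "\<phi> \<in> test_funs" "supp \<phi> \<subseteq> K" and "\<forall>k\<le>0. \<forall>t. \<bar>(deriv ^^ k) \<phi> t\<bar> \<le> b"
    then have b: "\<bar>\<phi> t\<bar> \<le> b" for t by (metis funpow_0 le_refl)
    have z: "\<phi> t = 0" if "T < t" for t
      using T[of t] that \<phi>(2) closure_subset[of "{t. \<phi> t \<noteq> 0}"] unfolding supp_def by fastforce
    have "norm (regular_distr f \<phi>) = norm (integral {0..T} (\<lambda>t. \<phi> t *\<^sub>R f t))"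
      using regular_distr_eq_integral[OF f \<phi>(1) z] by simp
    also have "\<dots> \<le> integral {0..T} (\<lambda>t. norm (f t) * b)"
      using b cf \<phi>(1) by (intro integral_norm_bound_integral integrable_continuous_real continuous_intros test_fun_continuous)
        (auto simp: mult.commute intro!: mult_right_mono)
    finally show "norm (regular_distr f \<phi>) \<le> integral {0..T} (\<lambda>t. norm (f t)) * b" by simp
  qed
qed

lemma supported_nonneg_regular_distr: "supported_nonneg (regular_distr f)"
  unfolding supported_nonneg_def
proof (intro ballI impI)
  fix \<phi> assume "supp \<phi> \<subseteq> {..<0}"
  then have "\<phi> t = 0" if "0 \<le> t" for t
    using that closure_subset[of "{t. \<phi> t \<noteq> 0}"] unfolding supp_def by fastforce
  then have "(LBINT t:{0..}. \<phi> t *\<^sub>R f t) = (LBINT t:{0::real..}. 0)"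
    by (intro set_lebesgue_integral_cong) auto
  then show "regular_distr f \<phi> = 0" by (simp add: regular_distr_def set_lebesgue_integral_def)
qed

text \<open>A bump at a point where the functions differ separates their distributions; at \<open>t = 0\<close>
  continuity decides.\<close>

lemma regular_distr_inject:
  fixes f g :: "real \<Rightarrow> real"
  assumes f: "continuous_on {0..} f" and g: "continuous_on {0..} g"
    and eq: "\<And>\<phi>. \<phi> \<in> test_funs \<Longrightarrow> regular_distr f \<phi> = regular_distr g \<phi>" and "0 \<le> t"
  shows "f t = g t"
proof -
  have pos: "h s \<le> 0" if h: "continuous_on {0..} h" "\<And>\<phi>. \<phi> \<in> test_funs \<Longrightarrow> regular_distr h \<phi> = 0" "0 < s"
    for h :: "real \<Rightarrow> real" and s
  proof (rule ccontr)
    assume "\<not> h s \<le> 0"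
    moreover have "isCont h s" using h(1,3) by (intro continuous_on_interior[of "{0..}"]) auto
    ultimately obtain d where d: "d > 0" "\<And>u. \<bar>u - s\<bar> < d \<Longrightarrow> h u > 0"
      using LIM_fun_gt_zero[of h "h s" s] by (force simp: isCont_def)
    define a b where "a = max (s / 2) (s - d)" and "b = s + d"
    have ab: "0 < a" "a < s" "s < b" "\<And>u. a < u \<Longrightarrow> u < b \<Longrightarrow> h u > 0"
      using d h(3) by (auto simp: a_def b_def)
    obtain \<rho> where \<rho>: "\<rho> \<in> test_funs" "\<And>t. a < t \<Longrightarrow> t < b \<Longrightarrow> 0 < \<rho> t" "\<And>t. \<not> (a < t \<and> t < b) \<Longrightarrow> \<rho> t = 0"
      using exists_bump[of a b] by blast
    have "integral {0..b} (\<lambda>t. \<rho> t * h t) = 0"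
      using regular_distr_eq_integral[OF h(1) \<rho>(1), of b] \<rho>(3) h(2)[OF \<rho>(1)] by auto
    moreover have "continuous_on {0..b} (\<lambda>t. \<rho> t * h t)"
      by (intro continuous_intros test_fun_continuous \<rho> continuous_on_subset[OF h(1)]) auto
    moreover have "0 \<le> \<rho> t * h t" for t using \<rho>(2,3)[of t] ab(4)[of t] by (cases "a < t \<and> t < b") auto
    ultimately have "\<rho> s * h s = 0"
      using integral_eq_0_iff[of 0 b "\<lambda>t. \<rho> t * h t"] ab by auto
    then show False using \<rho>(2)[of s] ab by force
  qed
  have fg: "f s = g s" if "0 < s" for s
  proof -
    have "regular_distr (\<lambda>t. f t - g t) \<phi> = 0" "regular_distr (\<lambda>t. g t - f t) \<phi> = 0" if "\<phi> \<in> test_funs" for \<phi>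
    proof -
      have "set_integrable lborel {0..} (\<lambda>t. \<phi> t * f t)" "set_integrable lborel {0..} (\<lambda>t. \<phi> t * g t)"
        using set_integrable_test_fun[OF f that] set_integrable_test_fun[OF g that] by auto
      then show "regular_distr (\<lambda>t. f t - g t) \<phi> = 0" "regular_distr (\<lambda>t. g t - f t) \<phi> = 0"
        using eq[OF that] by (simp_all add: regular_distr_def right_diff_distrib)
    qed
    with pos[of "\<lambda>t. f t - g t" s] pos[of "\<lambda>t. g t - f t" s] f g that show ?thesis
      by (force intro!: continuous_intros)
  qed
  moreover have "f 0 = g 0"
  proof -
    have "((\<lambda>t. f t - g t) \<longlongrightarrow> f 0 - g 0) (at 0 within {0..})"
      using f g by (intro tendsto_diff) (auto simp: continuous_on_def)
    then have "((\<lambda>t. f t - g t) \<longlongrightarrow> f 0 - g 0) (at_right 0)"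
      by (rule tendsto_within_subset) auto
    moreover have "\<forall>\<^sub>F t in at_right 0. f t - g t = 0"
      using fg by (auto simp: eventually_at_right_field intro!: exI[of _ 1])
    ultimately have "((\<lambda>t. 0) \<longlongrightarrow> f 0 - g 0) (at_right (0::real))"
      by (rule Lim_transform_eventually)
    then show ?thesis by (simp add: tendsto_const_iff)
  qed
  ultimately show ?thesis using \<open>0 \<le> t\<close> fg by (cases "t = 0") auto
qed


section \<open>Uniqueness for linear equations in distributions\<close>

definition linear_on_tests :: "'a::real_vector functional \<Rightarrow> bool" where
  "linear_on_tests x \<longleftrightarrow>
     (\<forall>\<phi>\<in>test_funs. \<forall>\<psi>\<in>test_funs. x (\<lambda>t. \<phi> t + \<psi> t) = x \<phi> + x \<psi>) \<and>
     (\<forall>c. \<forall>\<phi>\<in>test_funs. x (\<lambda>t. c * \<phi> t) = c *\<^sub>R x \<phi>)"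

lemma distribution_linear: "distribution x \<Longrightarrow> linear_on_tests x"
  by (simp add: distribution_def linear_on_tests_def)

text \<open>A distribution \<open>x\<close> with \<open>x' = A x\<close> annihilates, summed over components, every test vector
  \<open>\<Psi>' + A\<^sup>T \<Psi>\<close>. Any test vector \<open>\<Phi>\<close> has this form up to a part supported in the negative
  half-line: solve \<open>\<Psi>' + A\<^sup>T \<Psi> = \<Phi>\<close> backwards from \<open>\<Psi> = 0\<close> at large times and cut the solution off
  at negative times.\<close>

lemma homogeneous_distribution_zero:
  fixes x :: "(real^'n) functional" and A :: "real^'n^'n"
  assumes lin: "linear_on_tests x" and supp: "supported_nonneg x"
    and ode: "\<And>\<phi>. \<phi> \<in> test_funs \<Longrightarrow> - x (deriv \<phi>) = A *v x \<phi>"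
    and \<phi>: "\<phi> \<in> test_funs"
  shows "x \<phi> = 0"
proof -
  have add: "\<And>\<phi> \<psi>. \<phi> \<in> test_funs \<Longrightarrow> \<psi> \<in> test_funs \<Longrightarrow> x (\<lambda>t. \<phi> t + \<psi> t) = x \<phi> + x \<psi>"
    and scale: "\<And>c \<phi>. \<phi> \<in> test_funs \<Longrightarrow> x (\<lambda>t. c * \<phi> t) = c *\<^sub>R x \<phi>"
    using lin by (simp_all add: linear_on_tests_def)
  have neg: "x \<psi> = 0" if "\<psi> \<in> test_funs" "\<And>t. - 1 < t \<Longrightarrow> \<psi> t = 0" for \<psi>
  proof -
    have "supp \<psi> \<subseteq> {..-1}"
      unfolding supp_def using that(2) by (intro closure_minimal) (auto simp: not_less[symmetric])
    then have "supp \<psi> \<subseteq> {..<0}" by auto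
    then show ?thesis using supp that(1) unfolding supported_nonneg_def by blast
  qed
  have sumx: "x (\<lambda>t. \<Sum>j\<in>K. c j * \<psi> j t) = (\<Sum>j\<in>K. c j *\<^sub>R x (\<psi> j))" 
    if "finite K" "\<And>j. j \<in> K \<Longrightarrow> \<psi> j \<in> test_funs" for K :: "'n set" and c \<psi>
  proof -
    have "(\<lambda>t. \<Sum>j\<in>K. c j * \<psi> j t) \<in> test_funs \<and> x (\<lambda>t. \<Sum>j\<in>K. c j * \<psi> j t) = (\<Sum>j\<in>K. c j *\<^sub>R x (\<psi> j))"
      using that
    proof (induction K)
      case empty
      have "(\<lambda>t. 0::real) \<in> test_funs" by (intro test_funsI[of _ 0] smooth_fun_on_const) auto
      then show ?case using scale[OF \<phi>, of 0] by simp
    next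
      case (insert j K)
      then show ?case using add[of "\<lambda>t. c j * \<psi> j t"] scale by (simp add: test_fun_scale test_fun_add)
    qed
    then show ?thesis ..
  qed
  obtain M where M: "0 \<le> M" "\<And>t. M < \<bar>t\<bar> \<Longrightarrow> \<phi> t = 0" using \<phi> by (auto simp: test_funs_iff)
  obtain \<kappa> where \<kappa>: "smooth_fun_on UNIV \<kappa>" "\<And>t. t \<le> - 2 \<Longrightarrow> \<kappa> t = 0" "\<And>t. t \<ge> - 1 \<Longrightarrow> \<kappa> t = (1::real)"
    using exists_cutoff[of "-2" "-1"] by auto
  have d\<kappa>: "(\<kappa> has_real_derivative deriv \<kappa> t) (at t)" "smooth_fun_on UNIV (deriv \<kappa>)" for t
    using smooth_fun_deriv[OF \<kappa>(1)] by auto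
  have d0: "deriv \<kappa> t = 0" if "t < - 2 \<or> - 1 < t" for t
  proof (rule DERIV_imp_deriv)
    have "open {..< -2::real}" "open {-1::real<..}" by auto
    then show "(\<kappa> has_real_derivative 0) (at t)"
      using that has_field_derivative_transform_within_open[OF DERIV_const[of 0], of "{..< -2}" t \<kappa>]
        has_field_derivative_transform_within_open[OF DERIV_const[of 1], of "{-1<..}" t \<kappa>] \<kappa>(2,3) by auto
  qed
  have "x \<phi> $ k = 0" for k
  proof -
    define L where "L v = - (transpose A *v v)" for v :: "real^'n"
    have L: "linear L" "bounded_linear L"
      unfolding linear_conv_bounded_linear[symmetric] L_def
      by (intro linear_compose_neg matrix_vector_mul_linear)+
    have cb: "continuous_on UNIV (\<lambda>t. \<phi> t *\<^sub>R axis k 1 :: real^'n)"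
      by (intro continuous_intros test_fun_continuous \<phi>)
    (* the solution vanishes beyond the support of \<phi> *)
    obtain \<Psi> where \<Psi>: "\<Psi> (M + 1) = 0" "\<And>t. (\<Psi> has_vector_derivative L (\<Psi> t) + \<phi> t *\<^sub>R axis k 1) (at t)"
      using forced_ode_exists[OF L(1) cb, of "M + 1" 0] by blast
    have s\<Psi>: "smooth_fun_on UNIV \<Psi>"
    proof (rule smooth_fun_on_ode[OF L(2)])
      show "smooth_fun_on UNIV (\<lambda>t. \<phi> t *\<^sub>R axis k 1 :: real^'n)"
        using \<phi> by (intro smooth_fun_on_scaleR smooth_fun_on_const) (simp add: test_funs_iff)
    qed (rule \<Psi>(2))
    have \<Psi>0: "\<Psi> t = 0" if "M + 1 \<le> t" for t
    proof (rule linear_ode_zero[OF L(1), of "{M + 1..}" "M + 1" t])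
      fix s assume "s \<in> {M + 1..}"
      then show "(\<Psi> has_vector_derivative L (\<Psi> s)) (at s within {M + 1..})"
        using \<Psi>(2)[of s] M by (auto intro: has_vector_derivative_at_within)
    qed (use that \<Psi> in auto)
    have s\<Psi>i: "smooth_fun_on UNIV (\<lambda>t. \<Psi> t $ i)" for i
      by (rule smooth_fun_on_linear[OF bounded_linear_vec_nth s\<Psi>])
    define \<psi> where "\<psi> i t = \<kappa> t * \<Psi> t $ i" for i t
    have t1: "\<psi> i \<in> test_funs" for i
      unfolding \<psi>_def using M \<kappa>(2) \<Psi>0
      by (intro test_funsI[of _ "M + 2"] smooth_fun_on_mult \<kappa> s\<Psi>i) (auto simp: abs_if split: if_splits)
    have t2: "(\<lambda>t. deriv \<kappa> t * \<Psi> t $ i) \<in> test_funs" for i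
      using M d0 \<Psi>0
      by (intro test_funsI[of _ "M + 2"] smooth_fun_on_mult d\<kappa> s\<Psi>i) (auto simp: abs_if split: if_splits)
    have t3: "(\<lambda>t. \<kappa> t * \<phi> t) \<in> test_funs" by (intro test_fun_mult \<kappa> \<phi>)
    define \<epsilon> where "\<epsilon> i = (if i = k then 1 else 0::real)" for i
    have "((\<lambda>t. \<Psi> t $ i) has_real_derivative - (\<Sum>j\<in>UNIV. A $ j $ i * \<Psi> t $ j) + \<epsilon> i * \<phi> t) (at t)" for i t
    proof -
      have "((\<lambda>t. \<Psi> t $ i) has_vector_derivative (L (\<Psi> t) + \<phi> t *\<^sub>R axis k 1) $ i) (at t)"
        by (rule bounded_linear.has_vector_derivative[OF bounded_linear_vec_nth \<Psi>(2)])
      moreover have "(L (\<Psi> t) + \<phi> t *\<^sub>R axis k 1) $ i = - (\<Sum>j\<in>UNIV. A $ j $ i * \<Psi> t $ j) + \<epsilon> i * \<phi> t"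
        by (simp add: L_def matrix_vector_mult_def transpose_def axis_def \<epsilon>_def)
      ultimately show ?thesis by (simp add: has_real_derivative_iff_has_vector_derivative)
    qed
    moreover have "(\<Sum>j\<in>UNIV. (- A $ j $ i) * (\<kappa> t * \<Psi> t $ j)) = - (\<kappa> t * (\<Sum>j\<in>UNIV. A $ j $ i * \<Psi> t $ j))" for i t
      by (simp add: sum_distrib_left sum_negf mult.left_commute)
    ultimately have d\<psi>: "deriv (\<psi> i) = (\<lambda>t. (\<Sum>j\<in>UNIV. (- A $ j $ i) * \<psi> j t) + (\<epsilon> i * (\<kappa> t * \<phi> t) + deriv \<kappa> t * \<Psi> t $ i))" for i
      unfolding \<psi>_def
      by (intro ext DERIV_imp_deriv)
        (rule derivative_eq_intros d\<kappa>(1) refl | assumption | simp add: algebra_simps)+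
    have tA: "(\<lambda>t. \<Sum>j\<in>UNIV. (- A $ j $ i) * \<psi> j t) \<in> test_funs" for i
      by (intro test_fun_sum test_fun_scale t1)
    have "x (deriv (\<psi> i)) = (\<Sum>j\<in>UNIV. (- A $ j $ i) *\<^sub>R x (\<psi> j)) + \<epsilon> i *\<^sub>R x (\<lambda>t. \<kappa> t * \<phi> t)" for i
    proof -
      have "x (\<lambda>t. deriv \<kappa> t * \<Psi> t $ i) = 0" by (rule neg[OF t2]) (simp add: d0)
      then show ?thesis
        unfolding d\<psi>
        by (subst add[OF tA test_fun_add[OF test_fun_scale[OF t3] t2]])
          (simp add: add[OF test_fun_scale[OF t3] t2] scale[OF t3] sumx[OF _ t1, of UNIV "\<lambda>j. - A $ j $ i" for i, simplified] sumx t1)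
    qed
    then have "A *v x (\<psi> i) = (\<Sum>j\<in>UNIV. A $ j $ i *\<^sub>R x (\<psi> j)) - \<epsilon> i *\<^sub>R x (\<lambda>t. \<kappa> t * \<phi> t)" for i
      using ode[OF t1[of i]] by (simp add: sum_negf)
    from arg_cong[where f = "\<lambda>v. v $ _", OF this]
    have "(\<Sum>i\<in>UNIV. (A *v x (\<psi> i)) $ i) = (\<Sum>i\<in>UNIV. \<Sum>j\<in>UNIV. A $ j $ i * x (\<psi> j) $ i) - (\<Sum>i\<in>UNIV. \<epsilon> i * x (\<lambda>t. \<kappa> t * \<phi> t) $ i)"
      by (simp add: sum_subtractf)
    moreover have "(\<Sum>i\<in>UNIV. (A *v x (\<psi> i)) $ i) = (\<Sum>i\<in>UNIV. \<Sum>j\<in>UNIV. A $ j $ i * x (\<psi> j) $ i)"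
      unfolding matrix_vector_mult_def by (subst sum.swap) simp
    moreover have "(\<Sum>i\<in>UNIV. \<epsilon> i * x (\<lambda>t. \<kappa> t * \<phi> t) $ i) = x (\<lambda>t. \<kappa> t * \<phi> t) $ k"
      by (simp add: \<epsilon>_def if_distrib[of "\<lambda>c. c * _"] cong: if_cong)
    ultimately have 1: "x (\<lambda>t. \<kappa> t * \<phi> t) $ k = 0" by simp
    have t4: "(\<lambda>t. (1 - \<kappa> t) * \<phi> t) \<in> test_funs"
      by (intro test_fun_mult smooth_fun_on_diff smooth_fun_on_const \<kappa> \<phi>)
    have "x (\<lambda>t. (1 - \<kappa> t) * \<phi> t) = 0" by (rule neg[OF t4]) (simp add: \<kappa>(3))
    moreover have "\<phi> = (\<lambda>t. \<kappa> t * \<phi> t + (1 - \<kappa> t) * \<phi> t)" by (simp add: algebra_simps)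
    ultimately have "x \<phi> = x (\<lambda>t. \<kappa> t * \<phi> t)" using add[OF t3 t4] by simp
    with 1 show ?thesis by simp
  qed
  then show ?thesis by (simp add: vec_eq_iff)
qed

lemma linear_distribution_unique:
  fixes x x' :: "(real^'n) functional"
  assumes "linear_on_tests x" "supported_nonneg x" "linear_on_tests x'" "supported_nonneg x'"
    and "\<And>\<phi>. \<phi> \<in> test_funs \<Longrightarrow> - x (deriv \<phi>) = A *v x \<phi> + b \<phi>"
    and "\<And>\<phi>. \<phi> \<in> test_funs \<Longrightarrow> - x' (deriv \<phi>) = A *v x' \<phi> + b \<phi>"
    and "\<phi> \<in> test_funs"
  shows "x \<phi> = x' \<phi>"
proof -
  have "x \<phi> - x' \<phi> = 0"
  proof (rule homogeneous_distribution_zero[of "\<lambda>\<phi>. x \<phi> - x' \<phi>" A \<phi>])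
    show "- (x (deriv \<phi>) - x' (deriv \<phi>)) = A *v (x \<phi> - x' \<phi>)" if "\<phi> \<in> test_funs" for \<phi>
    proof -
      have "- (x (deriv \<phi>) - x' (deriv \<phi>)) = - x (deriv \<phi>) - - x' (deriv \<phi>)" by simp
      then show ?thesis
        unfolding assms(5)[OF that] assms(6)[OF that] by (simp add: matrix_vector_mult_diff_distrib)
    qed
  qed (use assms in \<open>auto simp: linear_on_tests_def supported_nonneg_def scaleR_diff_right\<close>)
  then show ?thesis by simp
qed


section \<open>Integrals over the half-line\<close>

context
  fixes f :: "real \<Rightarrow> real"
  assumes cont: "continuous_on {0..} f" and nonneg: "\<And>t. 0 \<le> t \<Longrightarrow> 0 \<le> f t"
begin

lemma half_line_finite_nn_integral:
  assumes fin: "(\<integral>\<^sup>+t\<in>{0..}. ennreal (f t) \<partial>lborel) < \<infinity>"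
  shows "f integrable_on {0..}"
proof -
  have m: "(\<lambda>x. indicator {0..} x * f x) \<in> borel_measurable borel"
    using borel_measurable_continuous_on_indicator[OF _ cont] by simp
  have "(\<lambda>x. indicator {0..} x * f x) integrable_on UNIV"
  proof (rule nn_integral_integrable_on[OF m])
    show "0 \<le> indicator {0..} x * f x" for x using nonneg by (auto simp: indicator_def)
    have "(\<integral>\<^sup>+x. ennreal (indicator {0..} x * f x) \<partial>lborel) = (\<integral>\<^sup>+t\<in>{0..}. ennreal (f t) \<partial>lborel)"
      by (intro nn_integral_cong) (auto simp: indicator_def)
    then show "(\<integral>\<^sup>+x. ennreal (indicator {0..} x * f x) \<partial>lborel) < \<infinity>" using fin by simp
  qed
  then show ?thesis
    by (subst (asm) integrable_restrict_UNIV[symmetric, of f "{0..}"] |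
        simp add: integrable_restrict_UNIV[symmetric, of f "{0..}"] indicator_def of_bool_def
          if_distrib[of "\<lambda>c. c * _"] cong: if_cong)+
qed

lemma half_line_nn_integral:
  assumes "f integrable_on {0..}"
  shows "(\<integral>\<^sup>+t\<in>{0..}. ennreal (f t) \<partial>lborel) = ennreal (integral {0..} f)"
  using nn_integral_has_integral_lebesgue'[of "{0..}" f] nonneg assms by auto

lemma half_line_bounded_integrable:
  assumes M: "\<And>T. 0 \<le> T \<Longrightarrow> integral {0..T} f \<le> M"
  shows "f integrable_on {0..}" "integral {0..} f \<le> M"
proof -
  let ?f = "\<lambda>(k::nat) t. if t \<in> {0..real k} then f t else 0"
  have c: "continuous_on {0..T} f" for T by (rule continuous_on_subset[OF cont]) auto
  have i: "?f k integrable_on {0..}" for k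
    by (rule integrable_on_superset[of _ "{0..real k}"])
      (auto intro: integrable_eq[OF integrable_continuous_real[OF c]])
  have e: "integral {0..} (?f k) = integral {0..real k} f" for k
    using integral_restrict_Int[of "{0..}" "{0..real k}" f] by (simp add: Int_absorb1 cong: if_cong)
  have "f integrable_on {0..} \<and> (\<lambda>k. integral {0..} (?f k)) \<longlonglongrightarrow> integral {0..} f"
  proof (rule monotone_convergence_increasing)
    show "?f k integrable_on {0..}" for k by (rule i)
    show "?f k t \<le> ?f (Suc k) t" if "t \<in> {0..}" for k t using nonneg that by auto
    show "(\<lambda>k. ?f k t) \<longlonglongrightarrow> f t" if "t \<in> {0..}" for t
    proof (rule tendsto_eventually)
      obtain n where "t < real n" using reals_Archimedean2 by blast
      then show "\<forall>\<^sub>F k in sequentially. ?f k t = f t"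
        using that by (auto simp: eventually_sequentially intro!: exI[of _ n])
    qed
    have "0 \<le> integral {0..real k} f" for k by (rule integral_nonneg) (auto intro: integrable_continuous_real c nonneg)
    then show "bounded (range (\<lambda>k. integral {0..} (?f k)))"
      unfolding e using M by (auto intro!: boundedI[of _ M])
  qed
  then have "f integrable_on {0..}" "(\<lambda>k. integral {0..real k} f) \<longlonglongrightarrow> integral {0..} f"
    unfolding e by blast+
  then show "f integrable_on {0..}" "integral {0..} f \<le> M"
    using M by (auto intro!: LIMSEQ_le_const2[of _ _ M])
qed

lemma integral_le_half_line_integral:
  assumes "f integrable_on {0..}"
  shows "integral {0..T} f \<le> integral {0..} f"
  using assms nonneg
  by (intro integral_subset_le integrable_continuous_real continuous_on_subset[OF cont]) auto

end

lemma inner_has_vector_derivative: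
  "(f has_vector_derivative f') (at t within S) \<Longrightarrow> (g has_vector_derivative g') (at t within S) \<Longrightarrow>
    ((\<lambda>t. f t \<bullet> g t) has_vector_derivative (f t \<bullet> g' + f' \<bullet> g t)) (at t within S)"
  by (rule bounded_bilinear.has_vector_derivative[OF bounded_bilinear_inner])

lemma matrix_has_vector_derivative:
  "(f has_vector_derivative f') F \<Longrightarrow> ((\<lambda>t. M *v f t) has_vector_derivative (M *v f' :: real^'n)) F"
  by (rule bounded_linear.has_vector_derivative[OF matrix_vector_mul_bounded_linear])


lemma continuous_on_matrix [continuous_intros]:
  "continuous_on I f \<Longrightarrow> continuous_on I (\<lambda>t. M *v f t :: real^'n)"
  by (rule continuous_on_compose2[OF matrix_vector_mult_linear_continuous_on[of UNIV]]) auto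


section \<open>The value of a linear-quadratic problem\<close>

text \<open>
  The problem is to minimize the integral of \<open>z \<bullet> Q z + v \<bullet> R v\<close> subject to \<open>z' = A z + B v\<close>, where
  the kernel of \<open>R\<close> is invisible to \<open>B\<close>. For the horizon \<open>T\<close> the optimal trajectories and their
  costates, read backwards in time, form the Hamiltonian flow started at \<open>(\<xi>, 0)\<close>; the value at
  \<open>z\<close> is \<open>z \<bullet> Y (X\<^sup>-\<^sup>1 z)\<close>, where \<open>X\<close> and \<open>Y\<close> are the two halves of the flow at time \<open>T\<close>.
\<close>

locale lq_problem =
  fixes A Q :: "real^'n^'n" and B :: "real^'m^'n" and R N :: "real^'m^'m"
  assumes Q: "pos_semidef Q" and R: "pos_semidef R" and N_sym: "transpose N = N"
    and NRN: "N ** R ** N = N" and BNR: "B ** N ** R = B"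
begin

definition G :: "real^'n \<Rightarrow> real^'n" where
  "G y = B *v (N *v (transpose B *v y))"

definition hamiltonian :: "(real^'n) \<times> (real^'n) \<Rightarrow> (real^'n) \<times> (real^'n)" where
  "hamiltonian w = (- (A *v fst w) + G (snd w), Q *v fst w + transpose A *v snd w)"

definition X :: "real \<Rightarrow> real^'n \<Rightarrow> real^'n" where "X t \<xi> = fst (flow hamiltonian t (\<xi>, 0))"
definition Y :: "real \<Rightarrow> real^'n \<Rightarrow> real^'n" where "Y t \<xi> = snd (flow hamiltonian t (\<xi>, 0))"

lemma Q_inner: "x \<bullet> (Q *v y) = (Q *v x) \<bullet> y" and Q_nonneg: "0 \<le> x \<bullet> (Q *v x)"
  using Q by (auto simp: pos_semidef_def symmetric_iff_inner)

lemma R_inner: "u \<bullet> (R *v v) = (R *v u) \<bullet> v" and R_nonneg: "0 \<le> u \<bullet> (R *v u)"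
  using R by (auto simp: pos_semidef_def symmetric_iff_inner)

lemma N_inner: "u \<bullet> (N *v v) = (N *v u) \<bullet> v"
  using N_sym by (auto simp: symmetric_iff_inner)

lemma NRN_apply: "N *v (R *v (N *v u)) = N *v u"
  by (metis NRN matrix_vector_mul_assoc)

lemma BNR_apply: "B *v (N *v (R *v u)) = B *v u"
  by (metis BNR matrix_vector_mul_assoc)

lemma linear_G: "linear G"
  by (rule linearI) (simp_all add: G_def matrix_vector_right_distrib matrix_vector_mult_scaleR)

lemma G_inner: "x \<bullet> G y = G x \<bullet> y"
  unfolding G_def by (metis N_inner inner_commute inner_matrix_vector)

lemma inner_G: "y \<bullet> G y = (N *v (transpose B *v y)) \<bullet> (R *v (N *v (transpose B *v y)))"
  unfolding G_def by (metis N_inner NRN_apply inner_commute inner_matrix_vector)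

lemma G_nonneg: "0 \<le> y \<bullet> G y" unfolding inner_G by (rule R_nonneg)

lemma G_eq_0: "y \<bullet> G y = 0 \<Longrightarrow> G y = 0"
proof -
  assume "y \<bullet> G y = 0"
  then have "R *v (N *v (transpose B *v y)) = 0" unfolding inner_G by (rule pos_semidef_kernel[OF R])
  then show ?thesis unfolding G_def by (metis NRN_apply matrix_vector_mult_0_right)
qed

lemma linear_hamiltonian: "linear hamiltonian"
  by (rule linearI)
    (simp_all add: hamiltonian_def matrix_vector_right_distrib matrix_vector_mult_scaleR
      linear_add[OF linear_G] linear_scale[OF linear_G] scaleR_add_right scaleR_diff_right)

lemma X_0: "X 0 \<xi> = \<xi>" and Y_0: "Y 0 \<xi> = 0"
  by (simp_all add: X_def Y_def flow_at_0[OF linear_hamiltonian])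

lemma linear_X: "linear (X t)" and linear_Y: "linear (Y t)"
  using linear_compose[OF linear_compose[OF _ linear_flow[OF linear_hamiltonian, of t]] linear_fst]
    linear_compose[OF linear_compose[OF _ linear_flow[OF linear_hamiltonian, of t]] linear_snd]
    bounded_linear.linear[OF bounded_linear_Pair[OF bounded_linear_ident bounded_linear_zero]]
  unfolding X_def Y_def o_def by blast+

lemma X_has_derivative: "((\<lambda>t. X t \<xi>) has_vector_derivative - (A *v X t \<xi>) + G (Y t \<xi>)) (at t within S)"
  and Y_has_derivative: "((\<lambda>t. Y t \<xi>) has_vector_derivative Q *v X t \<xi> + transpose A *v Y t \<xi>) (at t within S)"
  using bounded_linear.has_vector_derivative[OF bounded_linear_fst flow_has_derivative[OF linear_hamiltonian, of "(\<xi>, 0)" t S]]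
    bounded_linear.has_vector_derivative[OF bounded_linear_snd flow_has_derivative[OF linear_hamiltonian, of "(\<xi>, 0)" t S]]
  by (simp_all add: X_def Y_def hamiltonian_def)

lemma reversed_has_derivative:
  "((\<lambda>t. X (T - t) \<xi>) has_vector_derivative A *v X (T - t) \<xi> - G (Y (T - t) \<xi>)) (at t within S)"
  "((\<lambda>t. Y (T - t) \<xi>) has_vector_derivative - (Q *v X (T - t) \<xi> + transpose A *v Y (T - t) \<xi>)) (at t within S)"
proof -
  have d: "((-) T has_vector_derivative - 1) (at t within S)" by (auto intro!: derivative_eq_intros)
  show "((\<lambda>t. X (T - t) \<xi>) has_vector_derivative A *v X (T - t) \<xi> - G (Y (T - t) \<xi>)) (at t within S)"
    using vector_diff_chain_within[OF d X_has_derivative[of \<xi> "T - t"]] by (simp add: o_def)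
  show "((\<lambda>t. Y (T - t) \<xi>) has_vector_derivative - (Q *v X (T - t) \<xi> + transpose A *v Y (T - t) \<xi>)) (at t within S)"
    using vector_diff_chain_within[OF d Y_has_derivative[of \<xi> "T - t"]] by (simp add: o_def)
qed

lemma continuous_on_XY: "continuous_on S (\<lambda>t. X t \<xi>)" "continuous_on S (\<lambda>t. Y t \<xi>)"
  by (rule continuous_on_vector_derivative, rule X_has_derivative)
    (rule continuous_on_vector_derivative, rule Y_has_derivative)

text \<open>The flow is symplectic and \<open>\<xi> \<mapsto> (\<xi>, 0)\<close> is Lagrangian.\<close>

lemma isotropic: "X t \<xi> \<bullet> Y t \<zeta> = Y t \<xi> \<bullet> X t \<zeta>"
proof -
  let ?g = "\<lambda>t. X t \<xi> \<bullet> Y t \<zeta> - Y t \<xi> \<bullet> X t \<zeta>"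
  have "(?g has_vector_derivative 0) (at s)" for s
  proof -
    have "(?g has_vector_derivative
      (X s \<xi> \<bullet> (Q *v X s \<zeta> + transpose A *v Y s \<zeta>) + (- (A *v X s \<xi>) + G (Y s \<xi>)) \<bullet> Y s \<zeta>) -
      (Y s \<xi> \<bullet> (- (A *v X s \<zeta>) + G (Y s \<zeta>)) + (Q *v X s \<xi> + transpose A *v Y s \<xi>) \<bullet> X s \<zeta>)) (at s)"
      by (intro has_vector_derivative_diff inner_has_vector_derivative X_has_derivative Y_has_derivative)
    moreover have "X s \<xi> \<bullet> (transpose A *v Y s \<zeta>) = (A *v X s \<xi>) \<bullet> Y s \<zeta>"
      by (simp only: inner_matrix_vector transpose_transpose)
    ultimately show ?thesis
      by (simp add: inner_add_left inner_add_right inner_diff_left inner_diff_right Q_inner G_inner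
          inner_matrix_vector[of _ A])
  qed
  from constant_on_if_derivative_zero[of UNIV, OF _ this, of 0 t] show ?thesis by (simp add: Y_0)
qed

lemma energy_of_flow:
  assumes "0 \<le> T"
  shows "((\<lambda>t. X t \<xi> \<bullet> (Q *v X t \<xi>) + Y t \<xi> \<bullet> G (Y t \<xi>)) has_integral Y T \<xi> \<bullet> X T \<xi>) {0..T}"
proof -
  have "((\<lambda>t. Y t \<xi> \<bullet> X t \<xi>) has_vector_derivative X t \<xi> \<bullet> (Q *v X t \<xi>) + Y t \<xi> \<bullet> G (Y t \<xi>)) (at t within {0..T})" for t
  proof -
    have "((\<lambda>t. Y t \<xi> \<bullet> X t \<xi>) has_vector_derivative
      Y t \<xi> \<bullet> (- (A *v X t \<xi>) + G (Y t \<xi>)) + (Q *v X t \<xi> + transpose A *v Y t \<xi>) \<bullet> X t \<xi>) (at t within {0..T})"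
      by (intro inner_has_vector_derivative X_has_derivative Y_has_derivative)
    then show ?thesis
      by (simp add: inner_add_left inner_add_right inner_diff_left inner_diff_right Q_inner
          inner_matrix_vector[of _ A] add.commute)
  qed
  from fundamental_theorem_of_calculus[OF assms this] show ?thesis by (simp add: Y_0)
qed

lemma YX_nonneg: "0 \<le> T \<Longrightarrow> 0 \<le> Y T \<xi> \<bullet> X T \<xi>"
  by (rule has_integral_nonneg[OF energy_of_flow]) (auto intro: add_nonneg_nonneg Q_nonneg G_nonneg)

text \<open>If \<open>X T \<xi> = 0\<close>, the energy on \<open>[0, T]\<close> vanishes, so \<open>G Y = 0\<close> there and \<open>X\<close> solves a
  homogeneous equation.\<close>

lemma X_injective:
  assumes "0 \<le> T" "X T \<xi> = 0"
  shows "\<xi> = 0"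
proof (cases "T = 0")
  case True
  then show ?thesis using assms by (simp add: X_0)
next
  case False
  let ?e = "\<lambda>t. X t \<xi> \<bullet> (Q *v X t \<xi>) + Y t \<xi> \<bullet> G (Y t \<xi>)"
  have "continuous_on {0..T} (\<lambda>t. G (Y t \<xi>))"
    using linear_G by (intro continuous_on_compose2[OF linear_continuous_on[of G UNIV] continuous_on_XY(2)]) (auto simp: linear_linear)
  then have c: "continuous_on {0..T} ?e"
    by (intro continuous_intros continuous_on_XY)
  have "integral {0..T} ?e = 0" using integral_unique[OF energy_of_flow[OF assms(1)]] assms(2) by simp
  then have z: "?e t = 0" if "t \<in> {0..T}" for t
    using integral_eq_0_iff[OF c] that False assms(1) Q_nonneg G_nonneg by (auto intro: add_nonneg_nonneg)
  have "G (Y t \<xi>) = 0" if "t \<in> {0..T}" for t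
    using z[OF that] Q_nonneg[of "X t \<xi>"] G_nonneg[of "Y t \<xi>"] by (intro G_eq_0) linarith
  then have "((\<lambda>t. X t \<xi>) has_vector_derivative (\<lambda>x. - (A *v x)) (X t \<xi>)) (at t within {0..T})" if "t \<in> {0..T}" for t
    using X_has_derivative[of \<xi> t "{0..T}"] that by simp
  then have "X 0 \<xi> = 0"
    by (rule linear_ode_zero[of "\<lambda>x. - (A *v x)" "{0..T}" T 0 "\<lambda>t. X t \<xi>", rotated 4])
      (use assms in \<open>auto intro: linear_compose_neg matrix_vector_mul_linear\<close>)
  then show ?thesis by (simp add: X_0)
qed

text \<open>The value for horizon \<open>T\<close> at \<open>z\<close> is \<open>K T z \<bullet> z\<close>; \<open>K T z\<close> is the initial costate.\<close>

definition K :: "real \<Rightarrow> real^'n \<Rightarrow> real^'n" where "K T z = Y T (inv (X T) z)"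

lemma X_bij: "0 \<le> T \<Longrightarrow> bij (X T)"
proof -
  assume "0 \<le> T"
  then have "inj (X T)" using X_injective linear_injective_0[OF linear_X] by blast
  then show ?thesis using linear_injective_imp_surjective[OF linear_X] by (auto simp: bij_def)
qed

lemma K_X: "0 \<le> T \<Longrightarrow> K T (X T \<xi>) = Y T \<xi>"
  unfolding K_def using X_bij by (simp add: bij_is_inj)

lemma X_surj: assumes "0 \<le> T" obtains \<xi> where "z = X T \<xi>"
  using X_bij[OF assms] by (metis bij_is_surj surjD)

lemma K_add: "0 \<le> T \<Longrightarrow> K T (z + w) = K T z + K T w"
  by (metis K_X X_surj linear_add[OF linear_X] linear_add[OF linear_Y])

lemma K_scale: "0 \<le> T \<Longrightarrow> K T (c *\<^sub>R z) = c *\<^sub>R K T z"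
  by (metis K_X X_surj linear_scale[OF linear_X] linear_scale[OF linear_Y])

lemma K_inner: "0 \<le> T \<Longrightarrow> z \<bullet> K T w = K T z \<bullet> w"
  by (metis K_X X_surj isotropic)

lemma K_nonneg: "0 \<le> T \<Longrightarrow> 0 \<le> K T z \<bullet> z"
  by (metis K_X X_surj YX_nonneg)

text \<open>Completing the square along the costate \<open>Y\<close> bounds the cost of every control from below.\<close>

lemma K_le_cost:
  assumes T: "0 \<le> T"
    and z: "\<And>t. t \<in> {0..T} \<Longrightarrow> (z has_vector_derivative A *v z t + B *v v t) (at t within {0..T})"
    and v: "continuous_on {0..T} v"
  shows "K T (z 0) \<bullet> z 0 \<le> integral {0..T} (\<lambda>t. z t \<bullet> (Q *v z t) + v t \<bullet> (R *v v t))"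
proof -
  obtain \<xi> where \<xi>: "z 0 = X T \<xi>" using X_surj[OF T] .
  define x q where "x t = X (T - t) \<xi>" and "q t = Y (T - t) \<xi>" for t
  (* the optimal remaining cost q \<bullet> x, linearized at x and evaluated at z; the cost of z exceeds the
     decrease of F by a sum of squares in z - x and in the deviation from the optimal control *)
  define F where "F t = q t \<bullet> (2 *\<^sub>R z t - x t)" for t
  define F' where "F' t = q t \<bullet> (2 *\<^sub>R (A *v z t + B *v v t) - (A *v x t - G (q t)))
      + (- (Q *v x t + transpose A *v q t)) \<bullet> (2 *\<^sub>R z t - x t)" for t
  have "(F has_vector_derivative F' t) (at t within {0..T})" if "t \<in> {0..T}" for t
    unfolding F_def F'_def x_def q_def
    by (intro inner_has_vector_derivative has_vector_derivative_diff reversed_has_derivative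
        bounded_linear.has_vector_derivative[OF bounded_linear_scaleR_right] z that)
  from fundamental_theorem_of_calculus[OF T this]
  have F: "(F' has_integral F T - F 0) {0..T}" .
  have sq: "- F' t \<le> z t \<bullet> (Q *v z t) + v t \<bullet> (R *v v t)" for t
  proof -
    define n where "n = N *v (transpose B *v q t)"
    have 1: "q t \<bullet> (A *v w) = (transpose A *v q t) \<bullet> w" for w by (rule inner_matrix_vector)
    have 2: "v t \<bullet> (R *v n) = q t \<bullet> (B *v v t)"
      unfolding n_def by (metis BNR_apply N_inner R_inner inner_commute inner_matrix_vector)
    have "0 \<le> (z t - x t) \<bullet> (Q *v (z t - x t)) + (v t + n) \<bullet> (R *v (v t + n))"
      by (intro add_nonneg_nonneg Q_nonneg R_nonneg)
    also have "\<dots> = z t \<bullet> (Q *v z t) - 2 * ((Q *v x t) \<bullet> z t) + (Q *v x t) \<bullet> x t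
        + v t \<bullet> (R *v v t) + 2 * (v t \<bullet> (R *v n)) + n \<bullet> (R *v n)"
    proof -
      have "z t \<bullet> (Q *v x t) = (Q *v x t) \<bullet> z t" "x t \<bullet> (Q *v z t) = (Q *v x t) \<bullet> z t"
        "x t \<bullet> (Q *v x t) = (Q *v x t) \<bullet> x t" "n \<bullet> (R *v v t) = v t \<bullet> (R *v n)"
        by (metis Q_inner R_inner inner_commute)+
      then show ?thesis
        by (simp add: matrix_vector_mult_diff_distrib matrix_vector_right_distrib inner_diff_left inner_diff_right
            inner_add_left inner_add_right)
    qed
    also have "\<dots> = z t \<bullet> (Q *v z t) + v t \<bullet> (R *v v t) + F' t"
      by (simp add: F'_def inner_diff_left inner_diff_right inner_add_left inner_add_right 1 2 inner_G n_def[symmetric])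
    finally show ?thesis by linarith
  qed
  have cz: "continuous_on {0..T} z"
    by (rule continuous_on_vector_derivative[of _ _ "\<lambda>t. A *v z t + B *v v t"]) (rule z)
  have "integral {0..T} (\<lambda>t. - F' t) \<le> integral {0..T} (\<lambda>t. z t \<bullet> (Q *v z t) + v t \<bullet> (R *v v t))"
  proof (rule integral_le)
    show "(\<lambda>t. - F' t) integrable_on {0..T}" using has_integral_neg[OF F] by blast
    show "(\<lambda>t. z t \<bullet> (Q *v z t) + v t \<bullet> (R *v v t)) integrable_on {0..T}"
      by (intro integrable_continuous_real continuous_intros cz v)
  qed (rule sq)
  moreover have "integral {0..T} (\<lambda>t. - F' t) = F 0" 
    using integral_unique[OF F] by (simp add: F_def q_def Y_0)
  moreover have "F 0 = K T (z 0) \<bullet> z 0"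
    by (simp add: F_def q_def x_def \<xi> K_X[OF T] scaleR_2)
  ultimately show ?thesis by simp
qed

text \<open>The optimal trajectory for horizon \<open>T\<close>, stopped at time \<open>S\<close>, is a competitor for horizon
  \<open>S\<close>, and the cost that remains after \<open>S\<close> is nonnegative.\<close>

lemma K_mono:
  assumes "0 \<le> S" "S \<le> T"
  shows "K S z \<bullet> z \<le> K T z \<bullet> z"
proof -
  have T: "0 \<le> T" using assms by simp
  obtain \<xi> where \<xi>: "z = X T \<xi>" using X_surj[OF T] .
  define x q v where "x t = X (T - t) \<xi>" and "q t = Y (T - t) \<xi>" and "v t = - (N *v (transpose B *v q t))" for t
  have x: "(x has_vector_derivative A *v x t + B *v v t) (at t within {0..S})" for t
    using reversed_has_derivative(1)[of T \<xi> t]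
    unfolding x_def q_def v_def G_def
    by (simp add: linear_neg[OF matrix_vector_mul_linear])
  have q: "(q has_vector_derivative - (Q *v x t + transpose A *v q t)) (at t within {0..S})" for t
    unfolding x_def q_def by (rule reversed_has_derivative)
  have "continuous_on {0..S} q" by (rule continuous_on_vector_derivative) (rule q)
  then have "continuous_on {0..S} v" unfolding v_def by (intro continuous_intros)
  from K_le_cost[OF assms(1) x this]
  have "K S z \<bullet> z \<le> integral {0..S} (\<lambda>t. x t \<bullet> (Q *v x t) + v t \<bullet> (R *v v t))"
    by (simp add: x_def \<xi>)
  also have "\<dots> = - (q S \<bullet> x S - q 0 \<bullet> x 0)"
  proof (rule integral_unique)
    have "((\<lambda>t. q t \<bullet> x t) has_vector_derivative - (x t \<bullet> (Q *v x t) + v t \<bullet> (R *v v t))) (at t within {0..S})" for t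
    proof -
      have "q t \<bullet> (B *v v t) = - (v t \<bullet> (R *v v t))"
        using inner_G[of "q t"] by (simp add: v_def G_def linear_neg[OF matrix_vector_mul_linear])
      then show ?thesis
        using inner_has_vector_derivative[OF q x, of t]
        by (simp add: inner_add_left inner_add_right inner_diff_left inner_matrix_vector[of _ A] Q_inner
            algebra_simps)
    qed
    from has_integral_neg[OF fundamental_theorem_of_calculus[OF assms(1) this]]
    show "((\<lambda>t. x t \<bullet> (Q *v x t) + v t \<bullet> (R *v v t)) has_integral - (q S \<bullet> x S - q 0 \<bullet> x 0)) {0..S}" by (simp add: algebra_simps)
  qed
  also have "\<dots> \<le> q 0 \<bullet> x 0" using YX_nonneg[of "T - S" \<xi>] assms by (simp add: q_def x_def)
  also have "\<dots> = K T z \<bullet> z" by (simp add: q_def x_def \<xi> K_X[OF T])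
  finally show ?thesis .
qed

text \<open>Values for growing horizons increase to a limit \<open>P\<close> if they are bounded. The flow run
  backwards maps the graph of \<open>K T\<close> to that of \<open>K (T - t)\<close>, hence it preserves the graph of \<open>P\<close>.
  The Riccati equation is the infinitesimal form of this invariance.\<close>

lemma value_matrix:
  assumes bounded: "\<And>z. \<exists>M. \<forall>T\<ge>0. K T z \<bullet> z \<le> M"
  shows "\<exists>P. pos_semidef P \<and> (\<forall>z. ((\<lambda>T. K T z \<bullet> z) \<longlongrightarrow> z \<bullet> (P *v z)) at_top) \<and>
    (\<forall>z. P *v (A *v z) + transpose A *v (P *v z) + Q *v z - P *v G (P *v z) = 0)"
proof -
  have "\<exists>l. ((\<lambda>T. K T z \<bullet> z) \<longlongrightarrow> l) at_top" for z
  proof -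
    obtain M where M: "\<And>T. 0 \<le> T \<Longrightarrow> K T z \<bullet> z \<le> M" using bounded by blast
    have bdd: "bdd_above ((\<lambda>T. K T z \<bullet> z) ` {0..})" using M by (intro bdd_aboveI[of _ M]) auto
    have "((\<lambda>T. K T z \<bullet> z) \<longlongrightarrow> (SUP T\<in>{0..}. K T z \<bullet> z)) at_top"
    proof (rule increasing_tendsto)
      show "\<forall>\<^sub>F T in at_top. K T z \<bullet> z \<le> (SUP T\<in>{0..}. K T z \<bullet> z)"
        using eventually_ge_at_top[of 0] by eventually_elim (rule cSUP_upper[OF _ bdd], simp)
      fix l assume "l < (SUP T\<in>{0..}. K T z \<bullet> z)"
      then obtain S where S: "0 \<le> S" "l < K S z \<bullet> z" using less_cSUP_iff[OF _ bdd] by auto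
      show "\<forall>\<^sub>F T in at_top. l < K T z \<bullet> z"
        using eventually_ge_at_top[of S] by eventually_elim (use S K_mono in \<open>blast intro: less_le_trans\<close>)
    qed
    then show ?thesis by blast
  qed
  then obtain V where V: "\<And>z. ((\<lambda>T. K T z \<bullet> z) \<longlongrightarrow> V z) at_top" by metis
  have Kp: "((\<lambda>T. z \<bullet> K T w) \<longlongrightarrow> (V (z + w) - V z - V w) / 2) at_top" for z w
  proof (rule Lim_transform_eventually)
    show "((\<lambda>T. (K T (z + w) \<bullet> (z + w) - K T z \<bullet> z - K T w \<bullet> w) / 2) \<longlongrightarrow> (V (z + w) - V z - V w) / 2) at_top"
      by (intro tendsto_intros V) simp
    show "\<forall>\<^sub>F T in at_top. (K T (z + w) \<bullet> (z + w) - K T z \<bullet> z - K T w \<bullet> w) / 2 = z \<bullet> K T w"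
      using eventually_ge_at_top[of 0]
    proof eventually_elim
      case (elim T)
      then have "K T w \<bullet> z = z \<bullet> K T w" "K T z \<bullet> w = z \<bullet> K T w" by (metis K_inner inner_commute)+
      then show ?case using elim by (simp add: K_add inner_add_left inner_add_right)
    qed
  qed
  define p where "p w = (\<chi> i. (V (axis i 1 + w) - V (axis i 1) - V w) / 2)" for w :: "real^'n"
  have pl: "((\<lambda>T. K T w) \<longlongrightarrow> p w) at_top" for w
  proof (rule vec_tendstoI)
    show "((\<lambda>T. K T w $ i) \<longlongrightarrow> p w $ i) at_top" for i
      using Kp[of "axis i 1" w] by (simp add: p_def inner_axis')
  qed
  have ev0: "\<forall>\<^sub>F T in at_top. (0::real) \<le> T" by (rule eventually_ge_at_top)
  have "linear p"
  proof (rule linearI)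
    fix z w and c :: real
    have "((\<lambda>T. K T (z + w)) \<longlongrightarrow> p z + p w) at_top"
      by (rule Lim_transform_eventually[OF tendsto_add[OF pl pl]])
        (use ev0 in eventually_elim, simp add: K_add)
    then show "p (z + w) = p z + p w" using tendsto_unique[OF _ pl] by simp
    have "((\<lambda>T. K T (c *\<^sub>R z)) \<longlongrightarrow> c *\<^sub>R p z) at_top"
      by (rule Lim_transform_eventually[OF tendsto_scaleR[OF tendsto_const pl]])
        (use ev0 in eventually_elim, simp add: K_scale)
    then show "p (c *\<^sub>R z) = c *\<^sub>R p z" using tendsto_unique[OF _ pl] by simp
  qed
  then have P: "matrix p *v w = p w" for w by (simp add: matrix_works)
  define P where "P = matrix p"
  have KP: "((\<lambda>T. K T w) \<longlongrightarrow> P *v w) at_top" for w using pl by (simp add: P P_def)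
  have sym: "z \<bullet> (P *v w) = (P *v z) \<bullet> w" for z w
  proof (rule tendsto_unique)
    show "((\<lambda>T. z \<bullet> K T w) \<longlongrightarrow> z \<bullet> (P *v w)) at_top" by (intro tendsto_intros KP)
    show "((\<lambda>T. z \<bullet> K T w) \<longlongrightarrow> (P *v z) \<bullet> w) at_top"
      by (rule Lim_transform_eventually[OF tendsto_inner[OF KP tendsto_const]])
        (use ev0 in eventually_elim, simp add: K_inner)
  qed simp
  have lim: "((\<lambda>T. K T z \<bullet> z) \<longlongrightarrow> z \<bullet> (P *v z)) at_top" for z
    unfolding sym by (intro tendsto_intros KP)
  have "0 \<le> z \<bullet> (P *v z)" for z
    by (rule tendsto_lowerbound[OF lim]) (use ev0 in eventually_elim, simp_all add: K_nonneg)
  then have psd: "pos_semidef P" by (simp add: pos_semidef_def symmetric_iff_inner sym)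
  have graph: "snd (flow hamiltonian (- t) (z, P *v z)) = P *v fst (flow hamiltonian (- t) (z, P *v z))"
    if t: "0 \<le> t" for z t
  proof -
    let ?w = "\<lambda>T. flow hamiltonian (- t) (z, K T z)"
    have w: "snd (?w T) = K (T - t) (fst (?w T))" if "t \<le> T" for T
    proof -
      have T: "0 \<le> T" "0 \<le> T - t" using t that by auto
      obtain \<xi> where \<xi>: "z = X T \<xi>" using X_surj[OF T(1)] .
      have "(z, K T z) = flow hamiltonian T (\<xi>, 0)"
        by (simp add: \<xi> K_X[OF T(1)]) (simp add: X_def Y_def)
      then have "?w T = flow hamiltonian (T - t) (\<xi>, 0)"
        using flow_add[OF linear_hamiltonian, of "- t" T "(\<xi>, 0)"] by simp
      then show ?thesis using K_X[OF T(2), of \<xi>] by (simp add: X_def Y_def)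
    qed
    have wl: "(?w \<longlongrightarrow> flow hamiltonian (- t) (z, P *v z)) at_top"
      using linear_flow[OF linear_hamiltonian, of "- t"]
      by (intro bounded_linear.tendsto[of "flow hamiltonian (- t)"] tendsto_Pair tendsto_const KP)
        (simp add: linear_linear)
    have "snd (flow hamiltonian (- t) (z, P *v z)) $ i = (P *v fst (flow hamiltonian (- t) (z, P *v z))) $ i" for i
    proof (rule tendsto_unique)
      show "((\<lambda>T. snd (?w T) $ i) \<longlongrightarrow> snd (flow hamiltonian (- t) (z, P *v z)) $ i) at_top"
        by (intro tendsto_intros wl)
      have shift: "filterlim (\<lambda>T. T - t) at_top at_top"
        using filterlim_tendsto_add_at_top[OF tendsto_const[of "- t"] filterlim_ident] by (simp add: add.commute)
      have "((\<lambda>T. fst (?w T) \<bullet> K (T - t) (axis i 1)) \<longlongrightarrow> fst (flow hamiltonian (- t) (z, P *v z)) \<bullet> (P *v axis i 1)) at_top"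
        by (intro tendsto_intros wl filterlim_compose[OF KP shift])
      moreover have "\<forall>\<^sub>F T in at_top. fst (?w T) \<bullet> K (T - t) (axis i 1) = snd (?w T) $ i"
        using eventually_ge_at_top[of t]
        by eventually_elim (simp add: w K_inner inner_axis)
      moreover have "x \<bullet> (P *v axis i 1) = (P *v x) $ i" for x by (simp add: sym inner_axis)
      ultimately show "((\<lambda>T. snd (?w T) $ i) \<longlongrightarrow> (P *v fst (flow hamiltonian (- t) (z, P *v z))) $ i) at_top"
        by (simp add: Lim_transform_eventually)
    qed simp
    then show ?thesis by (simp add: vec_eq_iff)
  qed
  have "P *v (A *v z) + transpose A *v (P *v z) + Q *v z - P *v G (P *v z) = 0" for z
  proof -
    let ?w = "\<lambda>t. flow hamiltonian (- t) (z, P *v z)"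
    have d: "(?w has_vector_derivative - hamiltonian (z, P *v z)) (at 0 within {0..})"
      using flow_uminus_moving_has_derivative[OF linear_hamiltonian has_vector_derivative_const, of "(z, P *v z)" 0 "{0..}"]
      by (simp add: flow_at_0[OF linear_hamiltonian])
    have d1: "((\<lambda>t. snd (?w t)) has_vector_derivative snd (- hamiltonian (z, P *v z))) (at 0 within {0..})"
      by (rule bounded_linear.has_vector_derivative[OF bounded_linear_snd d])
    have "((\<lambda>t. P *v fst (?w t)) has_vector_derivative P *v fst (- hamiltonian (z, P *v z))) (at 0 within {0..})"
      by (intro matrix_has_vector_derivative bounded_linear.has_vector_derivative[OF bounded_linear_fst d])
    then have d2: "((\<lambda>t. snd (?w t)) has_vector_derivative P *v fst (- hamiltonian (z, P *v z))) (at 0 within {0..})"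
      by (rule has_vector_derivative_transform[rotated 2]) (auto simp: graph)
    have "at (0::real) within {0..} \<noteq> bot"
      by (metis at_within_Ici_at_right trivial_limit_at_right_real)
    then have "snd (- hamiltonian (z, P *v z)) = P *v fst (- hamiltonian (z, P *v z))"
      using vector_derivative_unique_within d1 d2 by blast
    then show ?thesis
      by (simp add: hamiltonian_def matrix_vector_mult_diff_distrib algebra_simps)
  qed
  with psd lim show ?thesis by blast
qed

end


section \<open>Trajectories and their cost\<close>

definition trajectory :: "real^'n^'n \<Rightarrow> real^'m^'n \<Rightarrow> (real \<Rightarrow> real^'n) \<Rightarrow> (real \<Rightarrow> real^'m) \<Rightarrow> bool" where
  "trajectory A B x u \<longleftrightarrow> smooth_fun_on {0..} u \<and>
     (\<forall>t\<ge>0. (x has_vector_derivative A *v x t + B *v u t) (at t within {0..}))"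

lemma trajectory_smooth:
  assumes "trajectory A B x u"
  shows "smooth_fun_on {0..} u" "smooth_fun_on {0..} x" "continuous_on {0..} u" "continuous_on {0..} x"
proof -
  show u: "smooth_fun_on {0..} u" using assms by (simp add: trajectory_def)
  show x: "smooth_fun_on {0..} x"
    by (rule smooth_fun_on_ode[of "(*v) A" _ "\<lambda>t. B *v u t"])
      (use assms in \<open>simp_all add: trajectory_def matrix_vector_mul_bounded_linear smooth_fun_on_matrix\<close>)
  show "continuous_on {0..} u" "continuous_on {0..} x"
    using u x by (auto intro: smooth_fun_on_continuous)
qed

lemma trajectory_exists:
  assumes "smooth_fun_on {0..} u"
  shows "\<exists>x. trajectory A B x u \<and> x 0 = x0"
proof -
  have "continuous_on {0..} (\<lambda>t. B *v u t)"
    by (intro smooth_fun_on_continuous smooth_fun_on_matrix assms)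
  from forced_ode_exists_nonneg[OF matrix_vector_mul_linear this, of x0 A] assms show ?thesis
    by (auto simp: trajectory_def)
qed

lemma feedback_trajectory_exists:
  "\<exists>x. trajectory A B x (\<lambda>t. F *v x t) \<and> x 0 = x0"
proof (intro exI conjI)
  let ?x = "\<lambda>t. flow ((*v) (A + B ** F)) t x0"
  show "trajectory A B ?x (\<lambda>t. F *v ?x t)"
    unfolding trajectory_def
  proof (intro conjI allI impI)
    show "smooth_fun_on {0..} (\<lambda>t. F *v ?x t)"
      by (intro smooth_fun_on_matrix smooth_fun_on_flow matrix_vector_mul_linear)
    show "(?x has_vector_derivative A *v ?x t + B *v (F *v ?x t)) (at t within {0..})" for t
      using flow_has_derivative[OF matrix_vector_mul_linear, of "A + B ** F" x0 t "{0..}"]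
      by (simp add: matrix_vector_mult_add_rdistrib[symmetric] matrix_vector_mul_assoc)
  qed
  show "?x 0 = x0" by (rule flow_at_0[OF matrix_vector_mul_linear])
qed

lemma state_distr_regular:
  assumes t: "trajectory A B x u" and U: "\<And>\<phi>. \<phi> \<in> test_funs \<Longrightarrow> U \<phi> = regular_distr u \<phi>"
  shows "state_distr A B (x 0) U (regular_distr x)"
  unfolding state_distr_def
proof (intro conjI ballI)
  note c = trajectory_smooth(3,4)[OF t]
  show "distribution (regular_distr x)" by (rule distribution_regular_distr[OF c(2)])
  show "supported_nonneg (regular_distr x)" by (rule supported_nonneg_regular_distr)
  fix \<phi> assume p: "\<phi> \<in> test_funs"
  have cA: "continuous_on {0..} (\<lambda>t. A *v x t)" "continuous_on {0..} (\<lambda>t. B *v u t)"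
    using trajectory_smooth(1,2)[OF t] by (auto intro!: smooth_fun_on_continuous smooth_fun_on_matrix)
  have "- regular_distr x (deriv \<phi>) = regular_distr (\<lambda>t. A *v x t + B *v u t) \<phi> + \<phi> 0 *\<^sub>R x 0"
    using t cA p by (intro regular_distr_derivative continuous_on_add) (auto simp: trajectory_def)
  also have "regular_distr (\<lambda>t. A *v x t + B *v u t) \<phi> = A *v regular_distr x \<phi> + B *v regular_distr u \<phi>"
    by (simp add: regular_distr_add[OF cA p] regular_distr_linear[OF matrix_vector_mul_linear _ p] c)
  finally show "- regular_distr x (deriv \<phi>) = A *v regular_distr x \<phi> + B *v U \<phi> + dirac_deriv 0 \<phi> *\<^sub>R x 0"
    by (simp add: U[OF p] dirac_deriv_def)
qed

text \<open>The state is unique, and the distribution of a continuous function determines the function,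
  so all choices of the output functions give the same energy.\<close>

lemma output_energy_eq:
  assumes "smooth_output A B p C D x0 U y"
  shows "output_energy A B p C D x0 U = (\<integral>\<^sup>+t\<in>{0..}. ennreal (\<Sum>i<p. (y i t)\<^sup>2) \<partial>lborel)"
proof -
  define y' where "y' = (SOME y. smooth_output A B p C D x0 U y)"
  have "smooth_output A B p C D x0 U y'" unfolding y'_def by (rule someI[of _ y]) (rule assms)
  then obtain x' where x': "state_distr A B x0 U x'"
    "\<And>i. i < p \<Longrightarrow> smooth_fun_on {0..} (y' i)"
    "\<And>i \<phi>. i < p \<Longrightarrow> \<phi> \<in> test_funs \<Longrightarrow> C i \<bullet> x' \<phi> + D i \<bullet> U \<phi> = regular_distr (y' i) \<phi>"
    by (auto simp: smooth_output_def)
  obtain x where x: "state_distr A B x0 U x"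
    "\<And>i. i < p \<Longrightarrow> smooth_fun_on {0..} (y i)"
    "\<And>i \<phi>. i < p \<Longrightarrow> \<phi> \<in> test_funs \<Longrightarrow> C i \<bullet> x \<phi> + D i \<bullet> U \<phi> = regular_distr (y i) \<phi>"
    using assms by (auto simp: smooth_output_def)
  have "x \<phi> = x' \<phi>" if "\<phi> \<in> test_funs" for \<phi>
    using x(1) x'(1) that
    by (intro linear_distribution_unique[of x x' A "\<lambda>\<phi>. B *v U \<phi> + dirac_deriv 0 \<phi> *\<^sub>R x0"])
      (auto simp: state_distr_def add.assoc distribution_linear)
  then have eq: "regular_distr (y i) \<phi> = regular_distr (y' i) \<phi>" if "i < p" "\<phi> \<in> test_funs" for i \<phi>
    using x(3)[OF that] x'(3)[OF that] that by simp
  have "y i t = y' i t" if "i < p" "0 \<le> t" for i t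
    by (rule regular_distr_inject[OF smooth_fun_on_continuous[OF x(2)] smooth_fun_on_continuous[OF x'(2)]])
      (use that eq in simp_all)
  then have "(\<integral>\<^sup>+t\<in>{0..}. ennreal (\<Sum>i<p. (y' i t)\<^sup>2) \<partial>lborel) = (\<integral>\<^sup>+t\<in>{0..}. ennreal (\<Sum>i<p. (y i t)\<^sup>2) \<partial>lborel)"
    by (intro nn_integral_cong) (auto simp: indicator_def)
  then show ?thesis using assms unfolding output_energy_def y'_def Let_def by auto
qed

lemma output_energy_regular:
  assumes t: "trajectory A B x u" and U: "\<And>\<phi>. \<phi> \<in> test_funs \<Longrightarrow> U \<phi> = regular_distr u \<phi>"
  shows "output_energy A B p C D (x 0) U = (\<integral>\<^sup>+t\<in>{0..}. ennreal (\<Sum>i<p. (C i \<bullet> x t + D i \<bullet> u t)\<^sup>2) \<partial>lborel)"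
proof (rule output_energy_eq)
  have s: "smooth_fun_on {0..} (\<lambda>t. C i \<bullet> x t)" "smooth_fun_on {0..} (\<lambda>t. D i \<bullet> u t)" for i
    using trajectory_smooth(1,2)[OF t] by (auto intro: smooth_fun_on_linear[OF bounded_linear_inner_right])
  have "C i \<bullet> regular_distr x \<phi> + D i \<bullet> U \<phi> = regular_distr (\<lambda>t. C i \<bullet> x t + D i \<bullet> u t) \<phi>"
    if "\<phi> \<in> test_funs" for i \<phi>
    using that trajectory_smooth(3,4)[OF t]
    by (simp add: U regular_distr_add smooth_fun_on_continuous[OF s(1)] smooth_fun_on_continuous[OF s(2)]
        regular_distr_linear[OF bounded_linear.linear[OF bounded_linear_inner_right]])
  then show "smooth_output A B p C D (x 0) U (\<lambda>i t. C i \<bullet> x t + D i \<bullet> u t)"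
    unfolding smooth_output_def
    by (intro exI[of _ "regular_distr x"] conjI state_distr_regular[OF t U] allI impI ballI smooth_fun_on_add s)
qed

definition rate :: "real^'n^'n \<Rightarrow> real^'m^'n \<Rightarrow> real^'m^'m \<Rightarrow> real^'n \<Rightarrow> real^'m \<Rightarrow> real" where
  "rate Q S R x u = x \<bullet> (Q *v x) + 2 * (x \<bullet> (S *v u)) + u \<bullet> (R *v u)"

lemma gram_apply:
  fixes M :: "real^'b^'a"
  assumes "\<And>a b. M $ a $ b = (\<Sum>k<p. c k $ a * d k $ b)"
  shows "M *v x = (\<Sum>k<p. (d k \<bullet> x) *\<^sub>R c k)"
proof -
  have "(M *v x) $ a = (\<Sum>k<p. (d k \<bullet> x) *\<^sub>R c k) $ a" for a
  proof -
    have "(M *v x) $ a = (\<Sum>b\<in>UNIV. \<Sum>k<p. c k $ a * d k $ b * x $ b)"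
      by (simp add: matrix_vector_mult_def assms sum_distrib_right)
    also have "\<dots> = (\<Sum>k<p. \<Sum>b\<in>UNIV. c k $ a * d k $ b * x $ b)" by (rule sum.swap)
    also have "\<dots> = (\<Sum>k<p. (d k \<bullet> x) *\<^sub>R c k) $ a"
      by (simp add: inner_vec_def sum_distrib_left sum_distrib_right mult.commute mult.left_commute)
    finally show ?thesis .
  qed
  then show ?thesis by (simp add: vec_eq_iff)
qed

text \<open>
  Feeding back \<open>u = v - R\<^sup>\<dagger> S\<^sup>T x\<close> removes the cross term from the cost: the running cost becomes
  \<open>x \<bullet> Q0 x + v \<bullet> R v\<close>, and the system matrix becomes \<open>A0\<close>.
\<close>

locale factored_system =
  fixes A Q :: "real^'n^'n" and B S :: "real^'m^'n" and R :: "real^'m^'m"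
    and p :: nat and C :: "nat \<Rightarrow> real^'n" and D :: "nat \<Rightarrow> real^'m"
  assumes fac: "factorization Q S R p C D"
begin

lemma entries:
  "Q $ a $ b = (\<Sum>k<p. C k $ a * C k $ b)" "S $ a $ i = (\<Sum>k<p. C k $ a * D k $ i)"
  "transpose S $ i $ a = (\<Sum>k<p. D k $ i * C k $ a)" "R $ i $ j = (\<Sum>k<p. D k $ i * D k $ j)"
proof -
  have e: "popov_matrix Q S R $ r $ s = (\<Sum>k<p. join_vec (C k) (D k) $ r * join_vec (C k) (D k) $ s)" for r s
    using fac by (simp add: factorization_def)
  show "Q $ a $ b = (\<Sum>k<p. C k $ a * C k $ b)" "S $ a $ i = (\<Sum>k<p. C k $ a * D k $ i)"
    "transpose S $ i $ a = (\<Sum>k<p. D k $ i * C k $ a)" "R $ i $ j = (\<Sum>k<p. D k $ i * D k $ j)"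
    using e[of "Inl a" "Inl b"] e[of "Inl a" "Inr i"] e[of "Inr i" "Inl a"] e[of "Inr i" "Inr j"]
    by (simp_all add: popov_matrix_def join_vec_def)
qed

lemma apply_eq:
  "Q *v x = (\<Sum>k<p. (C k \<bullet> x) *\<^sub>R C k)" "S *v u = (\<Sum>k<p. (D k \<bullet> u) *\<^sub>R C k)"
  "transpose S *v x = (\<Sum>k<p. (C k \<bullet> x) *\<^sub>R D k)" "R *v u = (\<Sum>k<p. (D k \<bullet> u) *\<^sub>R D k)"
  by (rule gram_apply, rule entries)+

lemma rate_eq: "rate Q S R x u = (\<Sum>k<p. (C k \<bullet> x + D k \<bullet> u)\<^sup>2)"
  unfolding rate_def apply_eq inner_sum_right sum_distrib_left sum.distrib[symmetric]
  by (intro sum.cong) (auto simp: inner_commute[of x] inner_commute[of u] power2_eq_square algebra_simps)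

lemma rate_nonneg: "0 \<le> rate Q S R x u" unfolding rate_eq by (intro sum_nonneg) auto

lemma rate_eq_0: "rate Q S R x u = 0 \<longleftrightarrow> (\<forall>k<p. C k \<bullet> x + D k \<bullet> u = 0)"
  unfolding rate_eq by (subst sum_nonneg_eq_0_iff) auto

lemma R_pos_semidef: "pos_semidef R" and Q_sym: "transpose Q = Q"
proof -
  show "transpose Q = Q" by (simp add: vec_eq_iff transpose_def entries mult.commute)
  have "transpose R = R" by (simp add: vec_eq_iff transpose_def entries mult.commute)
  then show "pos_semidef R" using rate_nonneg[of 0] by (simp add: pos_semidef_def rate_def)
qed

lemma R_sym: "transpose R = R" using R_pos_semidef by (simp add: pos_semidef_def)

lemma R_inner: "u \<bullet> (R *v v) = (R *v u) \<bullet> v"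
  using R_sym by (auto simp: symmetric_iff_inner)

lemma R_nonneg: "0 \<le> u \<bullet> (R *v u)" using R_pos_semidef by (simp add: pos_semidef_def)

lemma R_kernel: "R *v u = 0 \<longleftrightarrow> (\<forall>k<p. D k \<bullet> u = 0)"
proof
  assume "R *v u = 0"
  then have "rate Q S R 0 u = 0" by (simp add: rate_def)
  then show "\<forall>k<p. D k \<bullet> u = 0" by (simp add: rate_eq_0)
qed (simp add: apply_eq)

lemma S_kernel: "R *v u = 0 \<Longrightarrow> S *v u = 0"
  by (simp add: R_kernel apply_eq(2))

abbreviation N :: "real^'m^'m" where "N \<equiv> pseudo_inv R"

lemmas N_props = pseudo_inv_symmetric[OF R_sym]

lemma N_inner: "u \<bullet> (N *v v) = (N *v u) \<bullet> v"
  using N_props(3) by (auto simp: symmetric_iff_inner)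

lemma RNR: "R *v (N *v (R *v u)) = R *v u" and NRN: "N *v (R *v (N *v u)) = N *v u"
  and NR: "N *v (R *v u) = R *v (N *v u)"
  by (metis N_props(1) matrix_vector_mul_assoc, metis N_props(2) matrix_vector_mul_assoc,
      metis N_props(4) matrix_vector_mul_assoc)

lemma kernel_part: "R *v (u - N *v (R *v u)) = 0"
  by (simp add: matrix_vector_mult_diff_distrib RNR)

lemma SNR: "S *v (N *v (R *v u)) = S *v u"
  using S_kernel[OF kernel_part[of u]] by (simp add: matrix_vector_mult_diff_distrib)

definition A0 :: "real^'n^'n" where "A0 = A - B ** N ** transpose S"
definition Q0 :: "real^'n^'n" where "Q0 = Q - S ** N ** transpose S"

lemma A0_apply: "A0 *v x = A *v x - B *v (N *v (transpose S *v x))"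
  and Q0_apply: "Q0 *v x = Q *v x - S *v (N *v (transpose S *v x))"
  by (simp_all add: A0_def Q0_def matrix_vector_mult_diff_rdistrib matrix_vector_mul_assoc matrix_mul_assoc)

lemma inner_S: "x \<bullet> (S *v u) = (transpose S *v x) \<bullet> u" by (rule inner_matrix_vector)

lemma transpose_A0_apply: "transpose A0 *v x = transpose A *v x - S *v (N *v (transpose B *v x))"
proof -
  have "y \<bullet> (transpose A0 *v x) = y \<bullet> (transpose A *v x - S *v (N *v (transpose B *v x)))" for y
  proof -
    have "y \<bullet> (transpose A0 *v x) = (A0 *v y) \<bullet> x"
      by (simp only: inner_matrix_vector transpose_transpose)
    also have "\<dots> = (A *v y) \<bullet> x - x \<bullet> (B *v (N *v (transpose S *v y)))"
      by (simp add: A0_apply inner_diff_left inner_commute[of x])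
    also have "(A *v y) \<bullet> x = y \<bullet> (transpose A *v x)" by (simp only: inner_matrix_vector transpose_transpose)
    also have "x \<bullet> (B *v (N *v (transpose S *v y))) = y \<bullet> (S *v (N *v (transpose B *v x)))"
      by (metis N_inner inner_commute inner_matrix_vector)
    finally show ?thesis by (simp add: inner_diff_right)
  qed
  then show ?thesis using vector_eq_ldot by blast
qed

lemma system_apply: "A *v x + B *v u = A0 *v x + B *v (u + N *v (transpose S *v x))"
  by (simp add: A0_apply matrix_vector_right_distrib)

lemma rate_completed:
  "rate Q S R x u = x \<bullet> (Q0 *v x) + (u + N *v (transpose S *v x)) \<bullet> (R *v (u + N *v (transpose S *v x)))"
proof -
  let ?w = "transpose S *v x"
  have 1: "(N *v ?w) \<bullet> (R *v u) = x \<bullet> (S *v u)" "u \<bullet> (R *v (N *v ?w)) = x \<bullet> (S *v u)"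
    by (metis N_inner SNR inner_S) (metis N_inner R_inner SNR inner_S inner_commute)
  have 2: "(N *v ?w) \<bullet> (R *v (N *v ?w)) = x \<bullet> (S *v (N *v ?w))"
    by (metis N_inner NRN inner_S)
  show ?thesis
    by (simp add: rate_def Q0_apply inner_diff_right matrix_vector_right_distrib inner_add_left inner_add_right 1 2)
qed

lemma Q0_pos_semidef: "pos_semidef Q0"
proof -
  have "x \<bullet> (Q0 *v y) = (Q0 *v x) \<bullet> y" for x y
  proof -
    have "x \<bullet> (S *v (N *v (transpose S *v y))) = (S *v (N *v (transpose S *v x))) \<bullet> y"
      by (metis N_inner inner_S inner_commute)
    then show ?thesis using Q_sym by (auto simp: Q0_apply inner_diff_left inner_diff_right symmetric_iff_inner)
  qed
  moreover have "0 \<le> x \<bullet> (Q0 *v x)" for x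
    using rate_nonneg[of x "- (N *v (transpose S *v x))"] by (simp add: rate_completed)
  ultimately show ?thesis by (simp add: pos_semidef_def symmetric_iff_inner)
qed

lemma Q0_nonneg: "0 \<le> x \<bullet> (Q0 *v x)" using Q0_pos_semidef by (simp add: pos_semidef_def)

text \<open>The residual of the Riccati equation in terms of \<open>A0\<close> and \<open>Q0\<close>, applied to a vector.\<close>

definition ricc :: "real^'n^'n \<Rightarrow> real^'n \<Rightarrow> real^'n" where
  "ricc X x = X *v (A0 *v x) + transpose A0 *v (X *v x) + Q0 *v x
     - X *v (B *v (N *v (transpose B *v (X *v x))))"

text \<open>The kernel of \<open>R\<close> lies in that of \<open>S\<close>, so the kernel condition only concerns \<open>X B\<close>.\<close>

lemma cgcare_iff:
  assumes X: "transpose X = X"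
  shows "cgcare A B Q S R X \<longleftrightarrow> (\<forall>x. ricc X x = 0) \<and> (\<forall>u. R *v u = 0 \<longrightarrow> X *v (B *v u) = 0)"
proof -
  have "(X ** A + transpose A ** X - (S + X ** B) ** N ** (transpose S + transpose B ** X) + Q) *v x = ricc X x" for x
    unfolding ricc_def
    by (simp add: matrix_vector_mult_add_rdistrib matrix_vector_mult_diff_rdistrib matrix_vector_mul_assoc[symmetric]
        matrix_vector_right_distrib matrix_vector_mult_diff_distrib A0_apply Q0_apply transpose_A0_apply algebra_simps)
  then have "X ** A + transpose A ** X - (S + X ** B) ** N ** (transpose S + transpose B ** X) + Q = 0 \<longleftrightarrow>
      (\<forall>x. ricc X x = 0)"
    by (simp add: matrix_eq)
  moreover have "mat_ker R \<subseteq> mat_ker (S + X ** B) \<longleftrightarrow> (\<forall>u. R *v u = 0 \<longrightarrow> X *v (B *v u) = 0)"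
    by (auto simp: mat_ker_def matrix_vector_mult_add_rdistrib S_kernel matrix_vector_mul_assoc)
  ultimately show ?thesis by (simp add: cgcare_def)
qed

text \<open>The feedback \<open>u = gain X x\<close> makes the square in \<open>dissipation\<close> below vanish.\<close>

definition gain :: "real^'n^'n \<Rightarrow> real^'n^'m" where
  "gain X = - (N ** (transpose S + transpose B ** X))"

lemma gain_apply: "gain X *v x = - (N *v (transpose S *v x) + N *v (transpose B *v (X *v x)))"
proof -
  have "(- M) *v x = - (M *v x)" for M :: "real^'n^'m"
    by (metis add.right_inverse add_eq_0_iff matrix_vector_mult_0 matrix_vector_mult_add_rdistrib)
  then show ?thesis
    by (simp add: gain_def matrix_vector_mul_assoc[symmetric] matrix_vector_mult_add_rdistrib matrix_vector_right_distrib)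
qed

text \<open>The left-hand side is the running cost plus the derivative of the storage \<open>x \<bullet> X x\<close> along
  the system; the square on the right measures the deviation from the feedback.\<close>

lemma dissipation:
  assumes X: "transpose X = X" and ker: "\<And>u. R *v u = 0 \<Longrightarrow> X *v (B *v u) = 0"
  shows "rate Q S R x u + 2 * ((X *v x) \<bullet> (A *v x + B *v u))
    = x \<bullet> ricc X x + (u - gain X *v x) \<bullet> (R *v (u - gain X *v x))"
proof -
  define v where "v = u + N *v (transpose S *v x)"
  define n where "n = N *v (transpose B *v (X *v x))"
  have Xs: "y \<bullet> (X *v z) = (X *v y) \<bullet> z" for y z using X by (simp add: symmetric_iff_inner)
  have XBNR: "X *v (B *v (N *v (R *v w))) = X *v (B *v w)" for w
    using ker[OF kernel_part[of w]] by (simp add: matrix_vector_mult_diff_distrib)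
  have 1: "v \<bullet> (R *v n) = (X *v x) \<bullet> (B *v v)" "n \<bullet> (R *v v) = (X *v x) \<bullet> (B *v v)"
  proof -
    have "(X *v x) \<bullet> (B *v v) = (X *v x) \<bullet> (B *v (N *v (R *v v)))"
      by (metis XBNR Xs)
    then show "v \<bullet> (R *v n) = (X *v x) \<bullet> (B *v v)" "n \<bullet> (R *v v) = (X *v x) \<bullet> (B *v v)"
      unfolding n_def by (metis N_inner R_inner inner_commute inner_matrix_vector)+
  qed
  have 2: "n \<bullet> (R *v n) = (X *v x) \<bullet> (B *v n)"
    unfolding n_def by (metis N_inner NRN inner_matrix_vector)
  have 3: "x \<bullet> (transpose A0 *v (X *v x)) = (X *v x) \<bullet> (A0 *v x)"
    by (metis inner_commute inner_matrix_vector transpose_transpose)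
  have "u - gain X *v x = v + n" by (simp add: gain_apply v_def n_def)
  then have "(u - gain X *v x) \<bullet> (R *v (u - gain X *v x))
      = v \<bullet> (R *v v) + 2 * ((X *v x) \<bullet> (B *v v)) + (X *v x) \<bullet> (B *v n)"
    by (simp add: matrix_vector_right_distrib inner_add_left inner_add_right 1 2)
  moreover have "x \<bullet> ricc X x = 2 * ((X *v x) \<bullet> (A0 *v x)) + x \<bullet> (Q0 *v x) - (X *v x) \<bullet> (B *v n)"
    by (simp add: ricc_def inner_add_right inner_diff_right 3 Xs n_def)
  ultimately show ?thesis
    unfolding rate_completed system_apply v_def[symmetric] by (simp add: inner_add_right)
qed

lemma cost_of_trajectory:
  assumes X: "transpose X = X" and ker: "\<And>u. R *v u = 0 \<Longrightarrow> X *v (B *v u) = 0"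
    and t: "trajectory A B x u" and T: "0 \<le> T"
  shows "((\<lambda>t. rate Q S R (x t) (u t) - x t \<bullet> ricc X (x t)
      - (u t - gain X *v x t) \<bullet> (R *v (u t - gain X *v x t)))
    has_integral x 0 \<bullet> (X *v x 0) - x T \<bullet> (X *v x T)) {0..T}"
proof -
  have Xs: "y \<bullet> (X *v z) = (X *v y) \<bullet> z" for y z using X by (simp add: symmetric_iff_inner)
  have "((\<lambda>t. - (x t \<bullet> (X *v x t))) has_vector_derivative rate Q S R (x t) (u t) - x t \<bullet> ricc X (x t)
      - (u t - gain X *v x t) \<bullet> (R *v (u t - gain X *v x t))) (at t within {0..T})" if "t \<in> {0..T}" for t
  proof -
    have d: "(x has_vector_derivative A *v x t + B *v u t) (at t within {0..T})"
      using t that by (auto simp: trajectory_def intro: has_vector_derivative_within_subset)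
    have "x t \<bullet> (X *v (A *v x t + B *v u t)) + (A *v x t + B *v u t) \<bullet> (X *v x t)
        = 2 * ((X *v x t) \<bullet> (A *v x t + B *v u t))"
      by (metis Xs inner_commute mult_2)
    then have "- (x t \<bullet> (X *v (A *v x t + B *v u t)) + (A *v x t + B *v u t) \<bullet> (X *v x t))
       = rate Q S R (x t) (u t) - x t \<bullet> ricc X (x t) - (u t - gain X *v x t) \<bullet> (R *v (u t - gain X *v x t))"
      using dissipation[OF X ker, of "x t" "u t"] by linarith
    then show ?thesis
      using has_vector_derivative_minus[OF inner_has_vector_derivative[OF d matrix_has_vector_derivative[OF d, of X]]]
      by simp
  qed
  from fundamental_theorem_of_calculus[OF T this] show ?thesis by simp
qed

lemma continuous_on_rate:
  assumes "continuous_on I x" "continuous_on I u"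
  shows "continuous_on I (\<lambda>t. rate Q S R (x t) (u t))"
  unfolding rate_eq using assms by (intro continuous_intros)

text \<open>Along the feedback of a Riccati solution the cost up to time \<open>T\<close> is the storage \<open>x \<bullet> X x\<close>
  given up by then, which cannot exceed the initial storage.\<close>

lemma cost_le_storage:
  assumes X: "pos_semidef X" and cg: "cgcare A B Q S R X"
    and t: "trajectory A B x (\<lambda>t. gain X *v x t)"
  shows "(\<integral>\<^sup>+t\<in>{0..}. ennreal (rate Q S R (x t) (gain X *v x t)) \<partial>lborel) \<le> ennreal (x 0 \<bullet> (X *v x 0))"
proof -
  have Xs: "transpose X = X" and Xp: "\<And>v. 0 \<le> v \<bullet> (X *v v)" using X by (auto simp: pos_semidef_def)
  have r: "ricc X y = 0" and ker: "R *v w = 0 \<Longrightarrow> X *v (B *v w) = 0" for y w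
    using cg by (auto simp: cgcare_iff[OF Xs])
  have c: "continuous_on {0..} (\<lambda>t. rate Q S R (x t) (gain X *v x t))"
    by (intro continuous_on_rate trajectory_smooth[OF t])
  have le: "integral {0..T} (\<lambda>t. rate Q S R (x t) (gain X *v x t)) \<le> x 0 \<bullet> (X *v x 0)" if "0 \<le> T" for T
    using integral_unique[OF cost_of_trajectory[OF Xs ker t that]] Xp[of "x T"] by (simp add: r)
  note i = half_line_bounded_integrable[OF c rate_nonneg le]
  have "(\<integral>\<^sup>+t\<in>{0..}. ennreal (rate Q S R (x t) (gain X *v x t)) \<partial>lborel)
      = ennreal (integral {0..} (\<lambda>t. rate Q S R (x t) (gain X *v x t)))"
    by (rule half_line_nn_integral[OF c rate_nonneg i(1)])
  then show ?thesis using i(2) by (simp add: ennreal_leI)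
qed

end

lemma cost_eq_output_energy:
  assumes "pos_semidef (popov_matrix Q S R)"
  obtains p C D where "factored_system Q S R p C D"
    "\<And>A B x0 U. cost A B Q S R x0 U = output_energy A B p C D x0 U"
proof -
  obtain p C D where pcd: "(SOME (p, C, D). factorization Q S R p C D) = (p, C, D)"
    by (metis prod_cases3)
  have "\<exists>w. case w of (p, C, D) \<Rightarrow> factorization Q S R p C D"
    using exists_factorization[OF assms] by auto
  from someI_ex[OF this] have "factorization Q S R p C D" by (simp add: pcd)
  then show thesis by (intro that[of p C D]) (auto simp: factored_system_def cost_def pcd)
qed

lemma cost_regular:
  assumes "pos_semidef (popov_matrix Q S R)"
    and t: "trajectory A B x u" and U: "\<And>\<phi>. \<phi> \<in> test_funs \<Longrightarrow> U \<phi> = regular_distr u \<phi>"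
  shows "cost A B Q S R (x 0) U = (\<integral>\<^sup>+t\<in>{0..}. ennreal (rate Q S R (x t) (u t)) \<partial>lborel)"
proof -
  obtain p C D where f: "factored_system Q S R p C D"
    and c: "\<And>A B x0 U. cost A B Q S R x0 U = output_energy A B p C D x0 U"
    using cost_eq_output_energy[OF assms(1)] by blast
  show ?thesis unfolding c factored_system.rate_eq[OF f] by (rule output_energy_regular[OF t U])
qed


section \<open>Reduction modulo a subspace that costs nothing\<close>

context factored_system
begin

text \<open>On the kernel of \<open>Q0\<close> the control \<open>- R\<^sup>\<dagger> S\<^sup>T w\<close> makes the output vanish.\<close>

lemma output_residual:
  assumes "Q0 *v w = 0" "k < p"
  shows "C k \<bullet> w = D k \<bullet> (N *v (transpose S *v w))"
proof -
  have "rate Q S R w (- (N *v (transpose S *v w))) = 0" using assms(1) by (simp add: rate_completed)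
  then show ?thesis using assms(2) by (simp add: rate_eq_0)
qed

text \<open>Only the part of the state outside the subspace and the output enter the reduced equation.
  Both are free of impulses when the energy is finite, whatever the control is.\<close>

lemma reduced_trajectory:
  assumes EA: "\<And>x. E *v (A0 *v (E *v x)) = E *v (A0 *v x)" and EB: "\<And>u. R *v u = 0 \<Longrightarrow> E *v (B *v u) = 0"
    and QE: "\<And>x. Q0 *v (E *v x) = Q0 *v x"
    and fin: "output_energy A B p C D x0 U < \<infinity>"
  obtains z v where "z 0 = E *v x0" "continuous_on {0..} v"
    "\<And>t. 0 \<le> t \<Longrightarrow> (z has_vector_derivative E *v (A0 *v z t) + E *v (B *v v t)) (at t within {0..})"
    "(\<integral>\<^sup>+t\<in>{0..}. ennreal (z t \<bullet> (Q0 *v z t) + v t \<bullet> (R *v v t)) \<partial>lborel) = output_energy A B p C D x0 U"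
proof -
  have "\<exists>y. smooth_output A B p C D x0 U y"
    using fin by (auto simp: output_energy_def split: if_splits)
  then obtain y where y: "smooth_output A B p C D x0 U y" by blast
  then obtain x where x: "state_distr A B x0 U x" and ys: "\<And>i. i < p \<Longrightarrow> smooth_fun_on {0..} (y i)"
    and yx: "\<And>i \<phi>. i < p \<Longrightarrow> \<phi> \<in> test_funs \<Longrightarrow> C i \<bullet> x \<phi> + D i \<bullet> U \<phi> = regular_distr (y i) \<phi>"
    by (auto simp: smooth_output_def)
  note yc = smooth_fun_on_continuous[OF ys]
  (* the correlation of the output with the columns of D; it determines R u up to a state term *)
  define r where "r t = (\<Sum>i<p. y i t *\<^sub>R D i)" for t
  have rc: "continuous_on {0..} r" unfolding r_def by (intro continuous_intros yc) simp
  have r: "transpose S *v x \<phi> + R *v U \<phi> = regular_distr r \<phi>" if "\<phi> \<in> test_funs" for \<phi>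
  proof -
    have "transpose S *v x \<phi> + R *v U \<phi> = (\<Sum>i<p. regular_distr (y i) \<phi> *\<^sub>R D i)"
      unfolding apply_eq sum.distrib[symmetric] using that
      by (intro sum.cong) (auto simp: scaleR_add_left[symmetric] yx)
    also have "\<dots> = (\<Sum>i<p. regular_distr (\<lambda>t. y i t *\<^sub>R D i) \<phi>)"
      using that yc by (intro sum.cong regular_distr_linear[of "\<lambda>a. a *\<^sub>R D _"])
        (auto intro: bounded_linear.linear[OF bounded_linear_scaleR_left])
    also have "\<dots> = regular_distr r \<phi>"
      unfolding r_def using that yc by (intro regular_distr_sum[symmetric] continuous_intros) auto
    finally show ?thesis .
  qed
  define v where "v t = N *v r t" for t
  have vc: "continuous_on {0..} v"
    unfolding v_def by (intro continuous_intros rc)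
  have v: "N *v (transpose S *v x \<phi>) + N *v (R *v U \<phi>) = regular_distr v \<phi>" if "\<phi> \<in> test_funs" for \<phi>
    unfolding v_def using regular_distr_linear[OF matrix_vector_mul_linear rc that, of N]
    by (simp add: r[OF that, symmetric] matrix_vector_right_distrib)
  have EBv: "E *v (B *v (N *v (R *v u))) = E *v (B *v u)" for u
    using EB[OF kernel_part[of u]] by (simp add: matrix_vector_mult_diff_distrib)
  define b where "b t = E *v (B *v v t)" for t
  have bc: "continuous_on {0..} b"
    unfolding b_def by (intro continuous_intros vc)
  obtain z where z: "z 0 = E *v x0" "\<And>t. 0 \<le> t \<Longrightarrow> (z has_vector_derivative (E ** A0) *v z t + b t) (at t within {0..})"
    using forced_ode_exists_nonneg[OF matrix_vector_mul_linear bc, of "E *v x0" "E ** A0"] by blast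
  have zc: "continuous_on {0..} z"
    by (rule continuous_on_vector_derivative[of _ _ "\<lambda>t. (E ** A0) *v z t + b t"]) (use z in simp)
  have zd: "- regular_distr z (deriv \<phi>) = (E ** A0) *v regular_distr z \<phi> + (regular_distr b \<phi> + \<phi> 0 *\<^sub>R (E *v x0))"
    if "\<phi> \<in> test_funs" for \<phi>
  proof -
    have c: "continuous_on {0..} (\<lambda>t. (E ** A0) *v z t)"
      by (intro continuous_intros zc)
    have "- regular_distr z (deriv \<phi>) = regular_distr (\<lambda>t. (E ** A0) *v z t + b t) \<phi> + \<phi> 0 *\<^sub>R z 0"
      using z(2) c bc that by (intro regular_distr_derivative continuous_on_add) auto
    then show ?thesis
      by (simp only: regular_distr_add[OF c bc that] regular_distr_linear[OF matrix_vector_mul_linear zc that] z(1) add.assoc)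
  qed
  have Ex: "E *v x \<phi> = regular_distr z \<phi>" if "\<phi> \<in> test_funs" for \<phi>
  proof (rule linear_distribution_unique[of "\<lambda>\<phi>. E *v x \<phi>" "regular_distr z" "E ** A0"
        "\<lambda>\<phi>. regular_distr b \<phi> + \<phi> 0 *\<^sub>R (E *v x0)" \<phi>])
    have dx: "distribution x" "supported_nonneg x" using x by (auto simp: state_distr_def)
    show "supported_nonneg (\<lambda>\<phi>. E *v x \<phi>)" using dx(2) by (auto simp: supported_nonneg_def)
    show "linear_on_tests (\<lambda>\<phi>. E *v x \<phi>)"
      using distribution_linear[OF dx(1)]
      by (auto simp: linear_on_tests_def matrix_vector_right_distrib matrix_vector_mult_scaleR)
    fix \<psi> :: "real \<Rightarrow> real" assume p: "\<psi> \<in> test_funs"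
    have "- x (deriv \<psi>) = A *v x \<psi> + B *v U \<psi> + \<psi> 0 *\<^sub>R x0"
      using x p by (auto simp: state_distr_def dirac_deriv_def)
    then have "- (E *v x (deriv \<psi>)) = E *v (A0 *v x \<psi>) + E *v (B *v (U \<psi> + N *v (transpose S *v x \<psi>))) + \<psi> 0 *\<^sub>R (E *v x0)"
      by (metis (no_types, lifting) system_apply linear_neg[OF matrix_vector_mul_linear]
          matrix_vector_mult_scaleR matrix_vector_right_distrib)
    also have "E *v (B *v (U \<psi> + N *v (transpose S *v x \<psi>))) = E *v (B *v regular_distr v \<psi>)"
      by (simp add: v[OF p, symmetric] matrix_vector_right_distrib EBv add.commute)
    also have "\<dots> = regular_distr b \<psi>"
      unfolding b_def
      using regular_distr_linear[OF linear_compose[OF matrix_vector_mul_linear[of B] matrix_vector_mul_linear[of E]] vc p]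
      by simp
    also have "E *v (A0 *v x \<psi>) = (E ** A0) *v (E *v x \<psi>)"
      by (simp add: matrix_vector_mul_assoc[symmetric] EA)
    finally show "- (E *v x (deriv \<psi>)) = (E ** A0) *v (E *v x \<psi>) + (regular_distr b \<psi> + \<psi> 0 *\<^sub>R (E *v x0))"
      by (simp only: add.assoc)
  next
    fix \<psi> :: "real \<Rightarrow> real" assume "\<psi> \<in> test_funs"
    then show "- regular_distr z (deriv \<psi>) = (E ** A0) *v regular_distr z \<psi> + (regular_distr b \<psi> + \<psi> 0 *\<^sub>R (E *v x0))"
      by (rule zd)
  qed (use that in \<open>simp_all add: distribution_linear distribution_regular_distr[OF zc] supported_nonneg_regular_distr\<close>)
  define u where "u t = v t - N *v (transpose S *v z t)" for t
  have uc: "continuous_on {0..} u"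
    unfolding u_def by (intro continuous_intros vc zc)
  have yz: "y i t = C i \<bullet> z t + D i \<bullet> u t" if i: "i < p" and t: "0 \<le> t" for i t
  proof (rule regular_distr_inject[OF yc[OF i] _ _ t])
    show c: "continuous_on {0..} (\<lambda>t. C i \<bullet> z t + D i \<bullet> u t)" by (intro continuous_intros zc uc)
    fix \<phi> :: "real \<Rightarrow> real" assume p: "\<phi> \<in> test_funs"
    define w where "w = x \<phi> - E *v x \<phi>"
    have "Q0 *v w = 0" by (simp add: w_def matrix_vector_mult_diff_distrib QE)
    from output_residual[OF this i]
    have w: "C i \<bullet> x \<phi> - C i \<bullet> (E *v x \<phi>) =
        D i \<bullet> (N *v (transpose S *v x \<phi>)) - D i \<bullet> (N *v (transpose S *v (E *v x \<phi>)))"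
      by (simp add: w_def matrix_vector_mult_diff_distrib inner_diff_right)
    have "D i \<bullet> (U \<phi> - N *v (R *v U \<phi>)) = 0"
      using kernel_part[of "U \<phi>"] i by (simp add: R_kernel)
    then have D: "D i \<bullet> U \<phi> = D i \<bullet> (N *v (R *v U \<phi>))" by (simp add: inner_diff_right)
    have uz: "regular_distr u \<phi> = regular_distr v \<phi> - N *v (transpose S *v regular_distr z \<phi>)"
    proof -
      have c: "continuous_on {0..} (\<lambda>t. - (N *v (transpose S *v z t)))"
        by (intro continuous_intros zc)
      have "linear (\<lambda>w. - (N *v (transpose S *v w)))"
        by (intro linear_compose_neg linear_compose[OF matrix_vector_mul_linear matrix_vector_mul_linear, unfolded o_def])
      from regular_distr_linear[OF this zc p] regular_distr_add[OF vc c p] show ?thesis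
        by (simp add: u_def[abs_def])
    qed
    have "C i \<bullet> x \<phi> + D i \<bullet> U \<phi> = C i \<bullet> regular_distr z \<phi> + D i \<bullet> regular_distr u \<phi>"
      using w D by (simp add: uz v[OF p, symmetric] Ex[OF p, symmetric] inner_diff_right inner_add_right)
    also have "\<dots> = regular_distr (\<lambda>t. C i \<bullet> z t + D i \<bullet> u t) \<phi>"
      using regular_distr_add[of "\<lambda>t. C i \<bullet> z t" "\<lambda>t. D i \<bullet> u t", OF _ _ p]
        regular_distr_linear[OF bounded_linear.linear[OF bounded_linear_inner_right] zc p]
        regular_distr_linear[OF bounded_linear.linear[OF bounded_linear_inner_right] uc p]
      by (simp add: continuous_on_inner zc uc)
    finally show "regular_distr (y i) \<phi> = regular_distr (\<lambda>t. C i \<bullet> z t + D i \<bullet> u t) \<phi>"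
      using yx[OF i p] by simp
  qed
  have "(\<Sum>i<p. (y i t)\<^sup>2) = z t \<bullet> (Q0 *v z t) + v t \<bullet> (R *v v t)" if "0 \<le> t" for t
  proof -
    have "(\<Sum>i<p. (y i t)\<^sup>2) = rate Q S R (z t) (u t)" using yz[OF _ that] by (simp add: rate_eq)
    then show ?thesis by (simp add: rate_completed u_def)
  qed
  then have "(\<integral>\<^sup>+t\<in>{0..}. ennreal (z t \<bullet> (Q0 *v z t) + v t \<bullet> (R *v v t)) \<partial>lborel)
      = (\<integral>\<^sup>+t\<in>{0..}. ennreal (\<Sum>i<p. (y i t)\<^sup>2) \<partial>lborel)"
    by (intro nn_integral_cong) (auto simp: indicator_def)
  then show thesis
    using z vc by (intro that[of z v])
      (simp_all add: output_energy_eq[OF y] b_def matrix_vector_mul_assoc[symmetric])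
qed

text \<open>The projection \<open>E\<close> along \<open>W\<close> yields a linear-quadratic problem in which \<open>B\<close> does not see the
  kernel of \<open>R\<close>, as \<open>B\<close> maps that kernel into \<open>W\<close>. Every control of finite energy, impulsive or
  not, projects to a competitor of the same cost, so the value matrix \<open>P\<close> of the projected problem
  is a lower bound for all of them. States in \<open>W\<close> have value \<open>0\<close>, hence \<open>P\<close> vanishes on \<open>W\<close> and
  the projections drop out of its Riccati equation.\<close>

lemma riccati_solution_from_subspace:
  assumes W: "subspace W" and BW: "\<And>u. R *v u = 0 \<Longrightarrow> B *v u \<in> W"
    and friend: "\<And>w. w \<in> W \<Longrightarrow> \<exists>u. (\<forall>k<p. C k \<bullet> w + D k \<bullet> u = 0) \<and> A *v w + B *v u \<in> W"
    and fin: "\<And>x0. \<exists>U. output_energy A B p C D x0 U < \<infinity>"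
  shows "\<exists>X. pos_semidef X \<and> cgcare A B Q S R X \<and> (\<forall>x0 U. ennreal (x0 \<bullet> (X *v x0)) \<le> output_energy A B p C D x0 U)"
proof -
  have W0: "Q0 *v w = 0 \<and> A0 *v w \<in> W" if w: "w \<in> W" for w
  proof -
    obtain u where u: "\<forall>k<p. C k \<bullet> w + D k \<bullet> u = 0" "A *v w + B *v u \<in> W" using friend[OF w] by blast
    define v where "v = u + N *v (transpose S *v w)"
    have "w \<bullet> (Q0 *v w) + v \<bullet> (R *v v) = 0"
      using u(1) rate_eq_0[of w u] by (simp add: rate_completed v_def)
    then have "w \<bullet> (Q0 *v w) = 0" "v \<bullet> (R *v v) = 0" using Q0_nonneg[of w] R_nonneg[of v] by linarith+
    then have 0: "Q0 *v w = 0" "R *v v = 0"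
      using pos_semidef_kernel Q0_pos_semidef R_pos_semidef by blast+
    have "A0 *v w = (A *v w + B *v u) - B *v v" by (simp add: system_apply v_def)
    then show ?thesis using subspace_diff[OF W u(2) BW[OF 0(2)]] 0 by simp
  qed
  obtain Z where Z: "transpose Z = Z" "\<And>x. Z *v x \<in> W" "\<And>w. w \<in> W \<Longrightarrow> Z *v w = w"
    using exists_orthogonal_projector[OF W] by blast
  define E where "E = mat 1 - Z"
  have E: "E *v x = x - Z *v x" for x by (simp add: E_def matrix_vector_mult_diff_rdistrib)
  have EW: "E *v w = 0" if "w \<in> W" for w by (simp add: E Z(3)[OF that])
  have xE: "x - E *v x \<in> W" for x by (simp add: E Z(2))
  have Esym: "x \<bullet> (E *v y) = (E *v x) \<bullet> y" for x y
    using Z(1) by (simp add: E inner_diff_left inner_diff_right symmetric_iff_inner)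
  have EA: "E *v (A0 *v (E *v x)) = E *v (A0 *v x)" for x
    using EW[of "A0 *v (x - E *v x)"] W0[OF xE[of x]] by (simp add: matrix_vector_mult_diff_distrib)
  have QE: "Q0 *v (E *v x) = Q0 *v x" for x
    using W0[OF xE[of x]] by (simp add: matrix_vector_mult_diff_distrib)
  have EB: "E *v (B *v u) = 0" if "R *v u = 0" for u by (rule EW[OF BW[OF that]])
  interpret lq: lq_problem "E ** A0" Q0 "E ** B" R N
  proof
    have "E *v (B *v (N *v (R *v u))) = E *v (B *v u)" for u
      using EB[OF kernel_part[of u]] by (simp add: matrix_vector_mult_diff_distrib)
    then show "E ** B ** N ** R = E ** B"
      by (simp add: matrix_eq matrix_vector_mul_assoc[symmetric])
  qed (use Q0_pos_semidef R_pos_semidef N_props in simp_all)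
  have le: "ennreal (lq.K T x0 \<bullet> x0) \<le> output_energy A B p C D x0 U" if T: "0 \<le> T" for T x0 U
  proof (cases "output_energy A B p C D x0 U < \<infinity>")
    case True
    obtain z v where z: "z 0 = E *v x0" "continuous_on {0..} v"
      "\<And>t. 0 \<le> t \<Longrightarrow> (z has_vector_derivative E *v (A0 *v z t) + E *v (B *v v t)) (at t within {0..})"
      and J: "(\<integral>\<^sup>+t\<in>{0..}. ennreal (z t \<bullet> (Q0 *v z t) + v t \<bullet> (R *v v t)) \<partial>lborel) = output_energy A B p C D x0 U"
      by (rule reduced_trajectory[OF EA EB QE True]) (assumption, rule that)
    let ?f = "\<lambda>t. z t \<bullet> (Q0 *v z t) + v t \<bullet> (R *v v t)"
    have zc: "continuous_on {0..} z"
      by (rule continuous_on_vector_derivative[of _ _ "\<lambda>t. E *v (A0 *v z t) + E *v (B *v v t)"]) (use z in simp)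
    have fc: "continuous_on {0..} ?f"
      by (intro continuous_intros zc z(2))
    have f0: "0 \<le> ?f t" for t by (intro add_nonneg_nonneg Q0_nonneg R_nonneg)
    have fi: "?f integrable_on {0..}"
      by (rule half_line_finite_nn_integral[OF fc f0]) (use J True in simp)
    define w where "w = x0 - E *v x0"
    have wW: "w \<in> W" unfolding w_def by (rule xE)
    have "lq.K T ((\<lambda>t. z t + w) 0) \<bullet> ((\<lambda>t. z t + w) 0)
        \<le> integral {0..T} (\<lambda>t. (z t + w) \<bullet> (Q0 *v (z t + w)) + v t \<bullet> (R *v v t))"
    proof (rule lq.K_le_cost[OF T])
      show "continuous_on {0..T} v" by (rule continuous_on_subset[OF z(2)]) auto
      fix t assume t: "t \<in> {0..T}"
      have "E *v (A0 *v w) = 0" using W0[OF wW] EW by simp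
      then have "(E ** A0) *v (z t + w) + (E ** B) *v v t = E *v (A0 *v z t) + E *v (B *v v t)"
        by (simp add: matrix_vector_mul_assoc[symmetric] matrix_vector_right_distrib)
      moreover have "((\<lambda>t. z t + w) has_vector_derivative E *v (A0 *v z t) + E *v (B *v v t)) (at t within {0..T})"
      proof -
        have "(z has_vector_derivative E *v (A0 *v z t) + E *v (B *v v t)) (at t within {0..T})"
          by (rule has_vector_derivative_within_subset[OF z(3)]) (use t in auto)
        from has_vector_derivative_add[OF this has_vector_derivative_const[of w]] show ?thesis by simp
      qed
      ultimately show "((\<lambda>t. z t + w) has_vector_derivative (E ** A0) *v (z t + w) + (E ** B) *v v t) (at t within {0..T})"
        by simp
    qed
    also have "(\<lambda>t. (z t + w) \<bullet> (Q0 *v (z t + w)) + v t \<bullet> (R *v v t)) = ?f"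
    proof
      fix t
      have "Q0 *v w = 0" using W0[OF wW] by simp
      moreover have "w \<bullet> (Q0 *v z t) = (Q0 *v w) \<bullet> z t"
        using Q0_pos_semidef by (simp add: pos_semidef_def symmetric_iff_inner)
      ultimately show "(z t + w) \<bullet> (Q0 *v (z t + w)) + v t \<bullet> (R *v v t) = ?f t"
        by (simp add: matrix_vector_right_distrib inner_add_left)
    qed
    also have "integral {0..T} ?f \<le> integral {0..} ?f" by (rule integral_le_half_line_integral[OF fc f0 fi])
    finally have "lq.K T x0 \<bullet> x0 \<le> integral {0..} ?f" by (simp add: z(1) w_def)
    then have "ennreal (lq.K T x0 \<bullet> x0) \<le> ennreal (integral {0..} ?f)" by (rule ennreal_leI)
    also have "\<dots> = output_energy A B p C D x0 U" using half_line_nn_integral[OF fc f0 fi] J by simp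
    finally show ?thesis .
  qed (simp add: less_top[symmetric])
  have "\<exists>M. \<forall>T\<ge>0. lq.K T z \<bullet> z \<le> M" for z
  proof -
    obtain U where U: "output_energy A B p C D z U < \<infinity>" using fin by blast
    then obtain M where M: "output_energy A B p C D z U = ennreal M" "0 \<le> M"
      by (cases "output_energy A B p C D z U") auto
    have "lq.K T z \<bullet> z \<le> M" if "0 \<le> T" for T
      using le[OF that, of z U] M by (simp add: ennreal_le_iff)
    then show ?thesis by blast
  qed
  from lq.value_matrix[OF this] obtain P where P: "pos_semidef P"
    "\<And>z. ((\<lambda>T. lq.K T z \<bullet> z) \<longlongrightarrow> z \<bullet> (P *v z)) at_top"
    "\<And>z. P *v ((E ** A0) *v z) + transpose (E ** A0) *v (P *v z) + Q0 *v z - P *v lq.G (P *v z) = 0" by blast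
  have low: "ennreal (x0 \<bullet> (P *v x0)) \<le> output_energy A B p C D x0 U" for x0 U
  proof (rule tendsto_upperbound)
    show "((\<lambda>T. ennreal (lq.K T x0 \<bullet> x0)) \<longlongrightarrow> ennreal (x0 \<bullet> (P *v x0))) at_top"
      by (intro tendsto_ennrealI P)
    show "\<forall>\<^sub>F T in at_top. ennreal (lq.K T x0 \<bullet> x0) \<le> output_energy A B p C D x0 U"
      using eventually_ge_at_top[of 0] by eventually_elim (rule le)
  qed simp
  have Ps: "transpose P = P" and Psym: "x \<bullet> (P *v y) = (P *v x) \<bullet> y" and Pp: "0 \<le> x \<bullet> (P *v x)" for x y
    using P(1) by (auto simp: pos_semidef_def symmetric_iff_inner)
  have PW: "P *v w = 0" if w: "w \<in> W" for w
  proof (rule pos_semidef_kernel[OF P(1)])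
    have "lq.K T w \<bullet> w \<le> 0" if T: "0 \<le> T" for T
    proof -
      have "lq.K T ((\<lambda>t. w) 0) \<bullet> ((\<lambda>t. w) 0) \<le> integral {0..T} (\<lambda>t. w \<bullet> (Q0 *v w) + 0 \<bullet> (R *v 0))"
        using W0[OF w] EW by (intro lq.K_le_cost[OF T]) (auto simp: matrix_vector_mul_assoc[symmetric])
      then show ?thesis using W0[OF w] by simp
    qed
    then have "w \<bullet> (P *v w) \<le> 0"
      by (intro tendsto_upperbound[OF P(2)]) (auto simp: eventually_at_top_linorder)
    then show "w \<bullet> (P *v w) = 0" using Pp[of w] by simp
  qed
  have PE: "P *v (E *v x) = P *v x" for x
    using PW[OF xE[of x]] by (simp add: matrix_vector_mult_diff_distrib)
  have EP: "E *v (P *v x) = P *v x" for x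
  proof -
    have "y \<bullet> (E *v (P *v x)) = y \<bullet> (P *v x)" for y by (simp add: Esym Psym PE)
    then show ?thesis using vector_eq_ldot by blast
  qed
  have Et: "transpose E = E" by (simp add: symmetric_iff_inner Esym)
  have "ricc P x = 0" for x
    using P(3)[of x]
    by (simp add: ricc_def lq.G_def matrix_transpose_mul Et matrix_vector_mul_assoc[symmetric] PE EP)
  then have "cgcare A B Q S R P" using PW[OF BW] by (simp add: cgcare_iff[OF Ps])
  with P(1) low show ?thesis by blast
qed


section \<open>The subspaces of the quadruple\<close>

text \<open>Output injection leaves a trajectory with zero output unchanged, and turns the velocity into
  a part that preserves \<open>V\<close> and a part that lies in \<open>V\<close>.\<close>

lemma zero_output_stays_in_input_containing:
  assumes V: "input_containing A B p C D V" and x0: "x 0 = 0" and T: "0 \<le> T"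
    and x: "\<forall>t\<in>{0..T}. (x has_vector_derivative A *v x t + B *v u t) (at t within {0..T})"
    and out: "\<forall>t\<in>{0..T}. \<forall>i<p. C i \<bullet> x t + D i \<bullet> u t = 0" and t: "t \<in> {0..T}"
  shows "x t \<in> V"
proof -
  obtain L where L: "\<And>x. x \<in> V \<Longrightarrow> A *v x + (\<Sum>i<p. (C i \<bullet> x) *\<^sub>R L i) \<in> V"
    "\<And>w. B *v w + (\<Sum>i<p. (D i \<bullet> w) *\<^sub>R L i) \<in> V" and sub: "subspace V"
    using V by (auto simp: input_containing_def)
  define M where "M x = A *v x + (\<Sum>i<p. (C i \<bullet> x) *\<^sub>R L i)" for x
  define b where "b t = B *v u t + (\<Sum>i<p. (D i \<bullet> u t) *\<^sub>R L i)" for t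
  have lM: "linear M"
    by (rule linearI) (simp_all add: M_def matrix_vector_right_distrib matrix_vector_mult_scaleR inner_add_right
        scaleR_add_left sum.distrib scaleR_right_distrib scaleR_sum_right)
  have eq: "A *v x t + B *v u t = M (x t) + b t" if t: "t \<in> {0..T}" for t
  proof -
    have "(\<Sum>i<p. (C i \<bullet> x t) *\<^sub>R L i) + (\<Sum>i<p. (D i \<bullet> u t) *\<^sub>R L i) = 0"
      using out t by (simp add: sum.distrib[symmetric] scaleR_add_left[symmetric])
    moreover have "a + s + (b + t) = a + b + (s + t)" for a b s t :: "real^'n" by (simp add: algebra_simps)
    ultimately show ?thesis unfolding M_def b_def by (metis add.right_neutral)
  qed
  show ?thesis
  proof (rule ode_stays_in_subspace[OF sub lM])
    show "(x has_vector_derivative M (x t) + b t) (at t within {0..T})" if "t \<in> {0..T}" for t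
      using bspec[OF x that] by (simp only: eq[OF that])
    show "0 \<in> {0..T}" "x 0 \<in> V" using T x0 subspace_0[OF sub] by simp_all
    show "convex {0..T}" by simp
    show "t \<in> {0..T}" by (rule t)
    show "M w \<in> V" if "w \<in> V" for w using L(1)[OF that] by (simp add: M_def)
    show "b t \<in> V" for t unfolding b_def by (rule L)
  qed
qed

lemma R_star_subset_input_containing:
  assumes "input_containing A B p C D V"
  shows "R_star A B p C D \<subseteq> V"
proof
  fix w assume "w \<in> R_star A B p C D"
  then obtain T u x where "0 < T" "x 0 = 0" "x T = w"
    "\<forall>t\<in>{0..T}. (x has_vector_derivative A *v x t + B *v u t) (at t within {0..T})"
    "\<forall>t\<in>{0..T}. \<forall>i<p. C i \<bullet> x t + D i \<bullet> u t = 0"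
    by (auto simp: R_star_def)
  then show "w \<in> V"
    using zero_output_stays_in_input_containing[OF assms, of x T u T] by simp
qed

text \<open>
  Let \<open>W\<close> be the space reachable under \<open>A0\<close> through inputs in the kernel of \<open>R\<close>. A solution \<open>X\<close> of the
  Riccati equation annihilates \<open>B u\<close> for these inputs \<open>u\<close>, and \<open>X w = 0\<close> forces \<open>Q0 w = 0\<close> and then \<open>X A0 w = 0\<close>, so
  \<open>X\<close> and \<open>Q0\<close> vanish on \<open>W\<close>. This makes \<open>W\<close> input-containing. Conversely every state of \<open>W\<close> is
  reached with zero output: a vector \<open>\<xi>\<close> orthogonal to all states that are reached at time \<open>1\<close> with
  inputs generated by adjoint trajectories is the end point of an adjoint trajectory that does not
  excite \<open>ker R\<close>, and successive derivatives at time \<open>1\<close> show that \<open>\<xi>\<close> is orthogonal to \<open>W\<close>.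
\<close>

lemma S_star_eq_R_star:
  assumes X: "transpose X = X" and cg: "cgcare A B Q S R X"
  shows "S_star A B p C D = R_star A B p C D"
proof -
  define gens where "gens = {(((*v) A0) ^^ k) (B *v u) |k u. R *v u = 0}"
  define W where "W = span gens"
  have sW: "subspace W" by (simp add: W_def)
  have BW: "B *v u \<in> W" if "R *v u = 0" for u
    unfolding W_def by (rule span_base) (use that in \<open>auto simp: gens_def intro!: exI[of _ 0] exI[of _ u]\<close>)
  have AW: "A0 *v w \<in> W" if "w \<in> W" for w
  proof -
    have "(*v) A0 ` gens \<subseteq> gens"
    proof
      fix y assume "y \<in> (*v) A0 ` gens"
      then obtain k u where "y = A0 *v (((*v) A0 ^^ k) (B *v u))" "R *v u = 0" by (auto simp: gens_def)
      then show "y \<in> gens" by (auto simp: gens_def intro!: exI[of _ "Suc k"] exI[of _ u])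
    qed
    then have "(*v) A0 ` W \<subseteq> W"
      unfolding W_def by (metis linear_span_image matrix_vector_mul_linear span_mono)
    then show ?thesis using that by blast
  qed
  have r: "ricc X x = 0" and ker: "R *v u = 0 \<Longrightarrow> X *v (B *v u) = 0" for x u
    using cg by (auto simp: cgcare_iff[OF X])
  have Xs: "y \<bullet> (X *v z) = (X *v y) \<bullet> z" for y z using X by (simp add: symmetric_iff_inner)
  have XA: "Q0 *v w = 0 \<and> X *v (A0 *v w) = 0" if "X *v w = 0" for w
  proof -
    have e: "X *v (A0 *v w) + Q0 *v w = 0" using r[of w] that by (simp add: ricc_def)
    have "w \<bullet> (X *v (A0 *v w)) = 0" using that by (simp add: Xs)
    then have "w \<bullet> (Q0 *v w) = 0" using arg_cong[OF e, of "(\<bullet>) w"] by (simp add: inner_add_right)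
    then have "Q0 *v w = 0" by (rule pos_semidef_kernel[OF Q0_pos_semidef])
    then show ?thesis using e by simp
  qed
  have XW: "X *v w = 0" if "w \<in> W" for w
  proof -
    have "X *v (((*v) A0 ^^ k) (B *v u)) = 0" if "R *v u = 0" for k u
      by (induction k) (simp_all add: ker[OF that] XA)
    then have "gens \<subseteq> {w. X *v w = 0}" by (auto simp: gens_def)
    moreover have "subspace {w. X *v w = 0}"
      by (auto simp: subspace_def matrix_vector_right_distrib matrix_vector_mult_scaleR)
    ultimately show ?thesis using that unfolding W_def by (metis (mono_tags) mem_Collect_eq span_minimal subsetD)
  qed
  have QW: "Q0 *v w = 0" if "w \<in> W" for w using XA[OF XW[OF that]] by simp
  have ic: "input_containing A B p C D W"
    unfolding input_containing_iff
  proof (intro conjI sW ballI allI impI)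
    fix x u assume x: "x \<in> W" and 0: "\<forall>i<p. C i \<bullet> x + D i \<bullet> u = 0"
    let ?v = "u + N *v (transpose S *v x)"
    have "rate Q S R x u = 0" using 0 by (simp add: rate_eq_0)
    then have "?v \<bullet> (R *v ?v) = 0" by (simp add: rate_completed QW[OF x])
    then have "R *v ?v = 0" by (rule pos_semidef_kernel[OF R_pos_semidef])
    then show "A *v x + B *v u \<in> W"
      unfolding system_apply by (intro subspace_add[OF sW] AW x BW)
  qed
  have "W \<subseteq> R_star A B p C D"
  proof -
    define K where "K u = u - N *v (R *v u)" for u
    have K: "R *v K u = 0" "K (K u) = K u" "u \<bullet> K w = K u \<bullet> w" "linear K" "R *v u = 0 \<Longrightarrow> K u = u" for u w
    proof -
      show 1: "R *v K u = 0" for u unfolding K_def by (rule kernel_part)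
      show "K (K u) = K u" using 1[of u] by (simp add: K_def[of "K u"])
      show "u \<bullet> K w = K u \<bullet> w"
        by (simp add: K_def inner_diff_left inner_diff_right) (metis N_inner NR R_inner)
      show "linear K" unfolding K_def
        by (intro linear_compose_sub linear_ident linear_compose[OF matrix_vector_mul_linear matrix_vector_mul_linear, unfolded o_def])
      show "K u = u" if "R *v u = 0" using that by (simp add: K_def)
    qed
    define Bt where "Bt q = K (transpose B *v q)" for q
    have lBt: "linear Bt" unfolding Bt_def
      using linear_compose[OF matrix_vector_mul_linear K(4), of "transpose B"] by (simp add: o_def)
    have qB: "q \<bullet> (B *v Bt q) = Bt q \<bullet> Bt q" for q
      unfolding Bt_def by (metis K(2,3) inner_matrix_vector)
    define h where "h w = (- (transpose A0 *v fst w), A0 *v snd w + B *v Bt (fst w))"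
      for w :: "(real^'n) \<times> (real^'n)"
    have lh: "linear h"
      by (rule linearI) (simp_all add: h_def matrix_vector_right_distrib matrix_vector_mult_scaleR
          linear_add[OF lBt] linear_scale[OF lBt] scaleR_add_right)
    define q x where "q a t = fst (flow h t (a, 0))" and "x a t = snd (flow h t (a, 0))" for a t
    have qd: "(q a has_vector_derivative - (transpose A0 *v q a t)) (at t within I)"
      and xd: "(x a has_vector_derivative A0 *v x a t + B *v Bt (q a t)) (at t within I)" for a t I
      using bounded_linear.has_vector_derivative[OF bounded_linear_fst flow_has_derivative[OF lh, of "(a, 0)" t I]]
        bounded_linear.has_vector_derivative[OF bounded_linear_snd flow_has_derivative[OF lh, of "(a, 0)" t I]]
      by (simp_all add: q_def[abs_def] x_def[abs_def] h_def)
    have q0: "q a 0 = a" and x0: "x a 0 = 0" for a by (simp_all add: q_def x_def flow_at_0[OF lh])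
    have xW: "x a t \<in> W" for a t
    proof -
      have bW: "B *v Bt (q a t) \<in> W" for t by (intro BW) (simp add: Bt_def K)
      show ?thesis
        by (rule ode_stays_in_subspace[where s = 0 and I = UNIV, OF sW matrix_vector_mul_linear AW bW _ _ _ _ xd])
          (simp_all add: x0 subspace_0[OF sW])
    qed
    have reach: "x a 1 \<in> R_star A B p C D" for a
    proof -
      define u where "u t = Bt (q a t) - N *v (transpose S *v x a t)" for t
      have sf: "smooth_fun_on {0..1} (\<lambda>t. flow h t (a, 0))" by (rule smooth_fun_on_flow[OF lh])
      have "smooth_fun_on {0..1} (q a)" "smooth_fun_on {0..1} (x a)"
        unfolding q_def[abs_def] x_def[abs_def]
        using smooth_fun_on_linear[OF bounded_linear_fst sf] smooth_fun_on_linear[OF bounded_linear_snd sf] by auto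
      then have "smooth_fun_on {0..1} u"
        unfolding u_def
        by (intro smooth_fun_on_diff smooth_fun_on_matrix smooth_fun_on_linear[OF linear_linear[THEN iffD2, OF lBt]])
      moreover have "A *v x a t + B *v u t = A0 *v x a t + B *v Bt (q a t)" for t
        by (simp add: system_apply u_def)
      moreover have "rate Q S R (x a t) (u t) = 0" for t
        by (simp add: rate_completed u_def QW[OF xW] Bt_def K)
      ultimately show ?thesis unfolding R_star_def
        by (intro CollectI exI[of _ 1] conjI exI[of _ u] exI[of _ "x a"]) (use xd x0 in \<open>simp_all add: rate_eq_0\<close>)
    qed
    define V where "V = range (\<lambda>a. x a 1)"
    have "linear (\<lambda>a. x a 1)"
    proof (rule linearI)
      fix a b :: "real^'n" and c :: real
      show "x (a + b) 1 = x a 1 + x b 1"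
        using linear_add[OF linear_flow[OF lh], of 1 "(a, 0)" "(b, 0)"] by (simp add: x_def)
      show "x (c *\<^sub>R a) 1 = c *\<^sub>R x a 1"
        using linear_scale[OF linear_flow[OF lh], of 1 c "(a, 0)"] by (simp add: x_def)
    qed
    then have sV: "subspace V" unfolding V_def by (rule linear_subspace_image) (rule subspace_UNIV)
    have perp: "w \<bullet> \<xi> = 0" if \<xi>: "\<And>y. y \<in> V \<Longrightarrow> y \<bullet> \<xi> = 0" and w: "w \<in> W" for \<xi> w
    proof -
      (* the adjoint trajectory that ends at \<xi> *)
      define g where "g y = - (transpose A0 *v y)" for y
      have lg: "linear g" unfolding g_def by (intro linear_compose_neg matrix_vector_mul_linear)
      define a where "a = flow g (- 1) \<xi>"
      have "q a 1 - flow g 1 a = 0"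
      proof (rule linear_ode_zero[OF lg, of UNIV 0 1 "\<lambda>t. q a t - flow g t a"])
        fix t
        show "((\<lambda>t. q a t - flow g t a) has_vector_derivative g (q a t - flow g t a)) (at t within UNIV)"
          unfolding linear_diff[OF lg]
          using qd[of a t UNIV] flow_has_derivative[OF lg, of a t UNIV]
          by (intro has_vector_derivative_diff) (simp_all add: g_def)
      qed (simp_all add: q0 flow_at_0[OF lg])
      then have q1: "q a 1 = \<xi>" by (simp add: a_def flow_inverse[OF lg])
      have "((\<lambda>t. q a t \<bullet> x a t) has_vector_derivative Bt (q a t) \<bullet> Bt (q a t)) (at t within {0..1})" for t
        using inner_has_vector_derivative[OF qd[of a t "{0..1}"] xd[of a t "{0..1}"]]
        by (simp add: inner_add_right qB inner_matrix_vector[of _ A0])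
      from fundamental_theorem_of_calculus[OF zero_le_one this]
      have i: "((\<lambda>t. Bt (q a t) \<bullet> Bt (q a t)) has_integral \<xi> \<bullet> x a 1) {0..1}"
        by (simp add: x0 q1)
      have "\<xi> \<bullet> x a 1 = 0" using \<xi>[of "x a 1"] by (simp add: V_def inner_commute)
      then have "integral {0..1} (\<lambda>t. Bt (q a t) \<bullet> Bt (q a t)) = 0" using integral_unique[OF i] by simp
      moreover have "continuous_on {0..1} (\<lambda>t. Bt (q a t) \<bullet> Bt (q a t))"
        by (intro continuous_intros linear_continuous_on_compose[OF _ lBt] continuous_on_vector_derivative[OF qd])
      ultimately have B0: "Bt (q a t) = 0" if "t \<in> {0..1}" for t
        using integral_eq_0_iff[of 0 1 "\<lambda>t. Bt (q a t) \<bullet> Bt (q a t)"] that by auto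
      have Bk: "\<forall>t\<in>{0..1}. Bt (((*v) (transpose A0) ^^ k) (q a t)) = 0" for k
      proof (induction k)
        case (Suc k)
        show ?case
        proof
          fix t :: real assume t: "t \<in> {0..1}"
          let ?F = "\<lambda>y. Bt (((*v) (transpose A0) ^^ k) y)"
          have lF: "linear ?F"
            using linear_compose[OF funpow_linear[OF matrix_vector_mul_linear] lBt] by (simp add: o_def)
          have "((\<lambda>t. ?F (q a t)) has_vector_derivative ?F (- (transpose A0 *v q a t))) (at t within {0..1})"
            using lF by (intro bounded_linear.has_vector_derivative[OF _ qd]) (simp add: linear_linear)
          moreover have "((\<lambda>t. ?F (q a t)) has_vector_derivative 0) (at t within {0..1})"
            by (rule has_vector_derivative_transform[OF t _ has_vector_derivative_const[of 0]]) (use Suc in auto)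
          moreover have "at t within {0..1} \<noteq> bot"
            using t by (simp add: trivial_limit_within islimpt_Icc)
          ultimately have "?F (- (transpose A0 *v q a t)) = 0" using vector_derivative_unique_within by blast
          then show "Bt (((*v) (transpose A0) ^^ Suc k) (q a t)) = 0"
            by (simp add: linear_neg[OF lF] funpow_swap1)
        qed
      qed (use B0 in simp)
      have "(((*v) A0 ^^ k) (B *v u)) \<bullet> \<xi> = 0" if u: "R *v u = 0" for k u
      proof -
        have adj: "(((*v) A0 ^^ k) y) \<bullet> e = y \<bullet> (((*v) (transpose A0) ^^ k) e)" for y e
        proof (induction k arbitrary: e)
          case (Suc k)
          have "(A0 *v y) \<bullet> e = y \<bullet> (transpose A0 *v e)" for y e
            by (metis inner_commute inner_matrix_vector)
          moreover have "((*v) (transpose A0) ^^ Suc k) e = ((*v) (transpose A0) ^^ k) (transpose A0 *v e)"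
            by (simp only: funpow_Suc_right o_apply)
          ultimately show ?case by (simp only: funpow.simps o_apply Suc)
        qed simp
        have "(((*v) A0 ^^ k) (B *v u)) \<bullet> \<xi> = (B *v K u) \<bullet> (((*v) (transpose A0) ^^ k) \<xi>)"
          by (simp add: adj K(5)[OF u])
        also have "\<dots> = u \<bullet> Bt (((*v) (transpose A0) ^^ k) \<xi>)"
          unfolding Bt_def by (metis K(3) inner_commute inner_matrix_vector)
        also have "\<dots> = 0" using Bk[of k] by (auto simp: q1 dest: bspec[of _ _ 1])
        finally show ?thesis .
      qed
      then have "gens \<subseteq> {w. w \<bullet> \<xi> = 0}" by (auto simp: gens_def)
      moreover have "subspace {w. w \<bullet> \<xi> = 0}" by (auto simp: subspace_def inner_add_left)
      ultimately show ?thesis using w unfolding W_def by (metis (mono_tags) mem_Collect_eq span_minimal subsetD)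
    qed
    show ?thesis
    proof
      fix w assume w: "w \<in> W"
      obtain y e where ye: "y \<in> span V" "\<And>v. v \<in> span V \<Longrightarrow> orthogonal e v" "w = y + e"
        using orthogonal_subspace_decomp_exists[of V w] by blast
      have sp: "span V = V" using sV by (simp add: span_eq_iff)
      have eV: "v \<bullet> e = 0" if "v \<in> V" for v
        using ye(2)[of v] sp that by (simp add: orthogonal_def inner_commute[of v])
      have "w \<bullet> e = 0" by (rule perp[OF eV w])
      moreover have "y \<bullet> e = 0" using ye(1) sp by (simp add: eV)
      ultimately have "e = 0" using ye(3) by (simp add: inner_add_left)
      then have "w \<in> V" using ye(1,3) sp by simp
      then show "w \<in> R_star A B p C D" using reach by (auto simp: V_def)
    qed
  qed
  then have "R_star A B p C D = W"
    using R_star_subset_input_containing[OF ic] by blast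
  then show ?thesis
    using R_star_subset_input_containing by (intro S_star_eqI) (simp_all add: ic)
qed

text \<open>A zero-output trajectory that ends in \<open>w\<close> remains in the subspace, and so does its final
  velocity.\<close>

lemma friend_of_R_star:
  assumes eq: "S_star A B p C D = R_star A B p C D" and w: "w \<in> S_star A B p C D"
  shows "\<exists>u. (\<forall>k<p. C k \<bullet> w + D k \<bullet> u = 0) \<and> A *v w + B *v u \<in> S_star A B p C D"
proof -
  let ?W = "S_star A B p C D"
  have ic: "input_containing A B p C D ?W" by (rule input_containing_S_star)
  then have sW: "subspace ?W" by (simp add: input_containing_def)
  obtain T u x where T: "0 < T" "smooth_fun_on {0..T} u" "x 0 = 0" "x T = w"
    and x: "\<forall>t\<in>{0..T}. (x has_vector_derivative A *v x t + B *v u t) (at t within {0..T})"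
    and out: "\<forall>t\<in>{0..T}. \<forall>i<p. C i \<bullet> x t + D i \<bullet> u t = 0"
    using w unfolding eq by (auto simp: R_star_def)
  have xW: "x t \<in> ?W" if "t \<in> {0..T}" for t
    by (rule zero_output_stays_in_input_containing[OF ic T(3) _ x out that]) (use T in simp)
  obtain Z where "transpose Z = Z" and Z: "\<And>x. Z *v x \<in> ?W" "\<And>w. w \<in> ?W \<Longrightarrow> Z *v w = w"
    by (rule exists_orthogonal_projector[OF sW]) (rule that)
  have TT: "T \<in> {0..T}" using T by simp
  have d: "(x has_vector_derivative A *v w + B *v u T) (at T within {0..T})" using x TT T(4) by fastforce
  have "(x has_vector_derivative Z *v (A *v w + B *v u T)) (at T within {0..T})"
    by (rule has_vector_derivative_transform[OF TT _ matrix_has_vector_derivative[OF d]]) (simp add: Z xW)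
  moreover have "at T within {0..T} \<noteq> bot"
    using T by (simp add: trivial_limit_within islimpt_Icc)
  ultimately have "A *v w + B *v u T = Z *v (A *v w + B *v u T)"
    using d vector_derivative_unique_within by blast
  then have "A *v w + B *v u T \<in> ?W" by (metis Z(1))
  moreover have "\<forall>k<p. C k \<bullet> w + D k \<bullet> u T = 0" using out TT T(4) by auto
  ultimately show ?thesis by blast
qed

end


section \<open>From regular optimal controls to a Riccati solution\<close>

lemma shift_has_vector_derivative:
  assumes "0 \<le> t" "0 \<le> s" "(f has_vector_derivative D) (at (t + s) within {0..})"
  shows "((\<lambda>s. f (t + s)) has_vector_derivative D) (at s within {0..})"
proof -
  have "(f has_vector_derivative D) (at (t + s) within (+) t ` {0..})"
    by (rule has_vector_derivative_within_subset[OF assms(3)]) (use assms(1) in auto)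
  moreover have "((+) t has_vector_derivative 1) (at s within {0..})" by (auto intro!: derivative_eq_intros)
  ultimately show ?thesis using vector_diff_chain_within by (fastforce simp: o_def)
qed

lemma smooth_fun_on_shift:
  fixes f :: "real \<Rightarrow> 'a::real_normed_vector"
  assumes "smooth_fun_on {0..} f" "0 \<le> t"
  shows "smooth_fun_on {0..} (\<lambda>s. f (t + s))"
proof (rule smooth_fun_on_coinduct[where P = "\<lambda>h. \<exists>f. smooth_fun_on {0..} f \<and> h = (\<lambda>s. f (t + s))"])
  fix h :: "real \<Rightarrow> 'a"
  assume "\<exists>f. smooth_fun_on {0..} f \<and> h = (\<lambda>s. f (t + s))"
  then obtain f where f: "smooth_fun_on {0..} f" "h = (\<lambda>s. f (t + s))" by blast
  obtain f' where f': "smooth_fun_on {0..} f'" "\<And>t. t \<in> {0..} \<Longrightarrow> (f has_vector_derivative f' t) (at t within {0..})"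
    by (rule smooth_fun_on_derivative[OF f(1)]) blast
  have "(h has_vector_derivative f' (t + s)) (at s within {0..})" if "s \<in> {0..}" for s
    unfolding f(2) using that assms(2) by (intro shift_has_vector_derivative f'(2)) auto
  then show "\<exists>h'. (\<forall>s\<in>{0..}. (h has_vector_derivative h' s) (at s within {0..})) \<and>
      (\<exists>f. smooth_fun_on {0..} f \<and> h' = (\<lambda>s. f (t + s)))"
    using f'(1) by (intro exI[of _ "\<lambda>s. f' (t + s)"] conjI exI[of _ f']) auto
qed (use assms in blast)

lemma derivative_nonpos_at_max:
  fixes g :: "real \<Rightarrow> real"
  assumes d: "(g has_vector_derivative D) (at 0 within {0..})" and le: "\<And>t. 0 \<le> t \<Longrightarrow> g t \<le> g 0"
  shows "D \<le> 0"
proof -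
  have "(g has_real_derivative D) (at_right 0)"
    using d by (simp add: has_real_derivative_iff_has_vector_derivative at_within_Ici_at_right)
  then have "((\<lambda>t. (g t - g 0) / (t - 0)) \<longlongrightarrow> D) (at_right 0)"
    by (simp add: has_field_derivative_iff)
  then show ?thesis
    by (rule tendsto_upperbound) (auto simp: eventually_at_right_field le divide_nonpos_pos intro!: exI[of _ 1])
qed

context factored_system
begin

definition out :: "nat \<Rightarrow> (real^'n) \<times> (real^'m) \<Rightarrow> real" where
  "out k w = C k \<bullet> fst w + D k \<bullet> snd w"

text \<open>The polar form of the running cost.\<close>

definition corr :: "(real^'n) \<times> (real^'m) \<Rightarrow> (real^'n) \<times> (real^'m) \<Rightarrow> real" where
  "corr v w = (\<Sum>k<p. out k v * out k w)"

lemma corr_rate: "corr w w = rate Q S R (fst w) (snd w)"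
  by (simp add: corr_def out_def rate_eq power2_eq_square)

lemma corr_commute: "corr v w = corr w v" by (simp add: corr_def mult.commute)

lemma corr_linear: "corr v (w + s *\<^sub>R w') = corr v w + s * corr v w'"
  by (simp add: corr_def out_def inner_add_right sum.distrib sum_distrib_left algebra_simps)

lemma corr_nonneg: "0 \<le> corr w w" unfolding corr_rate by (rule rate_nonneg)

lemma corr_square: "corr (v + s *\<^sub>R w) (v + s *\<^sub>R w) = corr v v + 2 * s * corr v w + s\<^sup>2 * corr w w"
  by (simp add: corr_linear corr_commute[of "v + s *\<^sub>R w"] corr_commute[of w v] power2_eq_square algebra_simps)

definition finite_cost :: "(real \<Rightarrow> (real^'n) \<times> (real^'m)) \<Rightarrow> bool" where
  "finite_cost \<tau> \<longleftrightarrow> trajectory A B (\<lambda>t. fst (\<tau> t)) (\<lambda>t. snd (\<tau> t)) \<and>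
     (\<lambda>t. corr (\<tau> t) (\<tau> t)) integrable_on {0..}"

definition ip :: "(real \<Rightarrow> (real^'n) \<times> (real^'m)) \<Rightarrow> (real \<Rightarrow> (real^'n) \<times> (real^'m)) \<Rightarrow> real" where
  "ip \<sigma> \<tau> = integral {0..} (\<lambda>t. corr (\<sigma> t) (\<tau> t))"

lemma trajectory_linear:
  assumes "trajectory A B x u" "trajectory A B x' u'"
  shows "trajectory A B (\<lambda>t. x t + s *\<^sub>R x' t) (\<lambda>t. u t + s *\<^sub>R u' t)"
  unfolding trajectory_def
proof (intro conjI allI impI)
  show "smooth_fun_on {0..} (\<lambda>t. u t + s *\<^sub>R u' t)"
    using assms by (intro smooth_fun_on_add smooth_fun_on_scaleR_const) (simp_all add: trajectory_def)
  fix t :: real assume "0 \<le> t"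
  then have "(x has_vector_derivative A *v x t + B *v u t) (at t within {0..})"
    "(x' has_vector_derivative A *v x' t + B *v u' t) (at t within {0..})"
    using assms by (simp_all add: trajectory_def)
  then have "((\<lambda>t. x t + s *\<^sub>R x' t) has_vector_derivative
      (A *v x t + B *v u t) + s *\<^sub>R (A *v x' t + B *v u' t)) (at t within {0..})"
    by (intro has_vector_derivative_add bounded_linear.has_vector_derivative[OF bounded_linear_scaleR_right])
  moreover have "(A *v x t + B *v u t) + s *\<^sub>R (A *v x' t + B *v u' t)
      = A *v (x t + s *\<^sub>R x' t) + B *v (u t + s *\<^sub>R u' t)"
    by (simp add: matrix_vector_right_distrib matrix_vector_mult_scaleR scaleR_add_right)
  ultimately show "((\<lambda>t. x t + s *\<^sub>R x' t) has_vector_derivative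
      A *v (x t + s *\<^sub>R x' t) + B *v (u t + s *\<^sub>R u' t)) (at t within {0..})" by simp
qed

lemma continuous_on_corr:
  assumes "trajectory A B (\<lambda>t. fst (\<sigma> t)) (\<lambda>t. snd (\<sigma> t))" "trajectory A B (\<lambda>t. fst (\<tau> t)) (\<lambda>t. snd (\<tau> t))"
  shows "continuous_on {0..} (\<lambda>t. corr (\<sigma> t) (\<tau> t))"
  unfolding corr_def out_def
  by (intro continuous_intros trajectory_smooth(3,4)[OF assms(1)] trajectory_smooth(3,4)[OF assms(2)])

lemma finite_cost_linear:
  assumes \<sigma>: "finite_cost \<sigma>" and \<tau>: "finite_cost \<tau>"
  shows "finite_cost (\<lambda>t. \<sigma> t + s *\<^sub>R \<tau> t)"
proof -
  let ?f = "\<lambda>t. \<sigma> t + s *\<^sub>R \<tau> t"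
  have tr: "trajectory A B (\<lambda>t. fst (?f t)) (\<lambda>t. snd (?f t))"
    using trajectory_linear \<sigma> \<tau> by (simp add: finite_cost_def)
  have ts: "trajectory A B (\<lambda>t. fst (\<sigma> t)) (\<lambda>t. snd (\<sigma> t))" "trajectory A B (\<lambda>t. fst (\<tau> t)) (\<lambda>t. snd (\<tau> t))"
    using \<sigma> \<tau> by (simp_all add: finite_cost_def)
  let ?b = "\<lambda>t. 2 * corr (\<sigma> t) (\<sigma> t) + 2 * s\<^sup>2 * corr (\<tau> t) (\<tau> t)"
  have bc: "continuous_on {0..} ?b" by (intro continuous_intros continuous_on_corr ts)
  have b0: "0 \<le> ?b t" for t by (intro add_nonneg_nonneg mult_nonneg_nonneg corr_nonneg) auto
  have bi: "?b integrable_on {0..}"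
    using \<sigma> \<tau> by (intro integrable_add integrable_on_mult_right) (simp_all add: finite_cost_def)
  have le: "corr (?f t) (?f t) \<le> ?b t" for t
    using corr_nonneg[of "\<sigma> t + (- s) *\<^sub>R \<tau> t"] unfolding corr_square[of "\<sigma> t" s] corr_square[of "\<sigma> t" "- s"] by simp
  have "integral {0..T} (\<lambda>t. corr (?f t) (?f t)) \<le> integral {0..} ?b" if "0 \<le> T" for T
  proof -
    have "integral {0..T} (\<lambda>t. corr (?f t) (?f t)) \<le> integral {0..T} ?b"
      by (intro integral_le integrable_continuous_real le continuous_on_subset[OF bc]
          continuous_on_subset[OF continuous_on_corr[OF tr tr]]) auto
    also have "\<dots> \<le> integral {0..} ?b" by (rule integral_le_half_line_integral[OF bc b0 bi])
    finally show ?thesis .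
  qed
  then have "(\<lambda>t. corr (?f t) (?f t)) integrable_on {0..}"
    by (rule half_line_bounded_integrable(1)[OF continuous_on_corr[OF tr tr] corr_nonneg])
  then show ?thesis using tr by (simp add: finite_cost_def)
qed

lemma corr_integrable:
  assumes \<sigma>: "finite_cost \<sigma>" and \<tau>: "finite_cost \<tau>"
  shows "(\<lambda>t. corr (\<sigma> t) (\<tau> t)) integrable_on {0..}"
proof -
  have e: "corr (\<sigma> t) (\<tau> t) = (1/2) * (corr (\<sigma> t + 1 *\<^sub>R \<tau> t) (\<sigma> t + 1 *\<^sub>R \<tau> t) - corr (\<sigma> t) (\<sigma> t) - corr (\<tau> t) (\<tau> t))" for t
    unfolding corr_square by simp
  show ?thesis
    unfolding e using \<sigma> \<tau> finite_cost_linear[OF \<sigma> \<tau>, of 1]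
    by (intro integrable_on_mult_right integrable_diff) (simp_all only: finite_cost_def)
qed

lemma ip_commute: "ip \<sigma> \<tau> = ip \<tau> \<sigma>"
  unfolding ip_def by (subst corr_commute) (rule refl)

lemma ip_linear:
  assumes "finite_cost \<rho>" "finite_cost \<sigma>" "finite_cost \<tau>"
  shows "ip \<rho> (\<lambda>t. \<sigma> t + s *\<^sub>R \<tau> t) = ip \<rho> \<sigma> + s * ip \<rho> \<tau>"
  unfolding ip_def corr_linear
  using assms by (simp add: integral_add corr_integrable integrable_on_mult_right)

lemma ip_square:
  assumes "finite_cost \<sigma>" "finite_cost \<tau>"
  shows "ip (\<lambda>t. \<sigma> t + s *\<^sub>R \<tau> t) (\<lambda>t. \<sigma> t + s *\<^sub>R \<tau> t) = ip \<sigma> \<sigma> + 2 * s * ip \<sigma> \<tau> + s\<^sup>2 * ip \<tau> \<tau>"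
  unfolding ip_def corr_square
  using assms by (simp add: integral_add corr_integrable integrable_on_mult_right integrable_add)

lemma ip_nonneg: "finite_cost \<tau> \<Longrightarrow> 0 \<le> ip \<tau> \<tau>"
  unfolding ip_def by (rule integral_nonneg) (auto simp: corr_integrable corr_nonneg)

definition optimal :: "(real \<Rightarrow> (real^'n) \<times> (real^'m)) \<Rightarrow> bool" where
  "optimal \<tau> \<longleftrightarrow> finite_cost \<tau> \<and> (\<forall>\<sigma>. finite_cost \<sigma> \<longrightarrow> fst (\<sigma> 0) = fst (\<tau> 0) \<longrightarrow> ip \<tau> \<tau> \<le> ip \<sigma> \<sigma>)"

text \<open>First-order condition for perturbations that keep the initial state.\<close>

lemma optimal_orthogonal:
  assumes opt: "optimal \<tau>" and h: "finite_cost h" "fst (h 0) = 0"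
  shows "ip \<tau> h = 0"
proof -
  have \<tau>: "finite_cost \<tau>" using opt by (simp add: optimal_def)
  have "0 \<le> (2 * ip \<tau> h) * s + ip h h * s\<^sup>2" for s
  proof -
    have "ip \<tau> \<tau> \<le> ip (\<lambda>t. \<tau> t + s *\<^sub>R h t) (\<lambda>t. \<tau> t + s *\<^sub>R h t)"
      using opt finite_cost_linear[OF \<tau> h(1)] h(2) by (simp add: optimal_def)
    then show ?thesis unfolding ip_square[OF \<tau> h(1)] by (simp add: algebra_simps)
  qed
  from linear_term_vanishes[OF this] show ?thesis by simp
qed

text \<open>Optimal trajectories depend linearly on the initial state, so the optimal cost is a
  quadratic form.\<close>

lemma optimal_cost_matrix:
  assumes opt: "\<And>x0. \<exists>\<tau>. optimal \<tau> \<and> fst (\<tau> 0) = x0"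
  obtains P where "pos_semidef P" "\<And>\<sigma>. finite_cost \<sigma> \<Longrightarrow> fst (\<sigma> 0) \<bullet> (P *v fst (\<sigma> 0)) \<le> ip \<sigma> \<sigma>"
    "\<And>x0. \<exists>\<tau>. finite_cost \<tau> \<and> fst (\<tau> 0) = x0 \<and> ip \<tau> \<tau> = x0 \<bullet> (P *v x0)"
proof -
  have "\<forall>i. \<exists>\<tau>. optimal \<tau> \<and> fst (\<tau> 0) = axis i 1" using opt by blast
  then obtain \<beta> where \<beta>: "\<And>i. optimal (\<beta> i)" "\<And>i. fst (\<beta> i 0) = axis i 1" by metis
  have f\<beta>: "finite_cost (\<beta> i)" for i using \<beta>(1) by (simp add: optimal_def)
  (* a difference of equal trajectories, whichever index is taken *)
  have zero: "finite_cost (\<lambda>t. 0)"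
    using finite_cost_linear[OF f\<beta> f\<beta>, of undefined "-1" undefined] by simp
  have comb: "finite_cost (\<lambda>t. \<Sum>i\<in>I. c i *\<^sub>R \<beta> i t) \<and>
      ip \<rho> (\<lambda>t. \<Sum>i\<in>I. c i *\<^sub>R \<beta> i t) = (\<Sum>i\<in>I. c i * ip \<rho> (\<beta> i))"
    if "finite I" "finite_cost \<rho>" for I c \<rho>
    using that(1)
  proof (induction I)
    case empty
    show ?case using zero by (simp add: ip_def corr_def out_def)
  next
    case (insert i I)
    then have I: "finite_cost (\<lambda>t. \<Sum>i\<in>I. c i *\<^sub>R \<beta> i t)" by simp
    show ?case
      using finite_cost_linear[OF I f\<beta>, of "c i" i] ip_linear[OF that(2) I f\<beta>, of "c i" i] insert
      by (simp add: add.commute)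
  qed
  define opt_from where "opt_from x t = (\<Sum>i\<in>UNIV. (x $ i) *\<^sub>R \<beta> i t)" for x :: "real^'n" and t
  define P :: "real^'n^'n" where "P = (\<chi> i j. ip (\<beta> i) (\<beta> j))"
  have fo: "finite_cost (opt_from x)" for x
    using comb[of UNIV "\<lambda>t. 0"] zero unfolding opt_from_def[abs_def] by simp
  have ipo: "ip \<rho> (opt_from x) = (\<Sum>i\<in>UNIV. x $ i * ip \<rho> (\<beta> i))" if "finite_cost \<rho>" for \<rho> x
    using comb[of UNIV \<rho>] that unfolding opt_from_def[abs_def] by simp
  have start: "fst (opt_from x 0) = x" for x
  proof -
    have "fst (opt_from x 0) = (\<Sum>i\<in>UNIV. (x $ i) *\<^sub>R axis i 1)"
      by (simp add: opt_from_def fst_sum \<beta>(2))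
    then show ?thesis by (simp add: vec_eq_iff axis_def if_distrib[of "\<lambda>a. _ * a"] cong: if_cong)
  qed
  have ip\<beta>: "ip (\<beta> i) \<sigma> = (P *v fst (\<sigma> 0)) $ i" if \<sigma>: "finite_cost \<sigma>" for i \<sigma>
  proof -
    let ?o = "opt_from (fst (\<sigma> 0))"
    have "ip (\<beta> i) (\<lambda>t. \<sigma> t + (-1) *\<^sub>R ?o t) = 0"
      by (rule optimal_orthogonal[OF \<beta>(1) finite_cost_linear[OF \<sigma> fo]]) (simp add: start)
    then have "ip (\<beta> i) \<sigma> = ip (\<beta> i) ?o" unfolding ip_linear[OF f\<beta> \<sigma> fo] by simp
    also have "\<dots> = (P *v fst (\<sigma> 0)) $ i"
      by (simp add: ipo[OF f\<beta>] P_def matrix_vector_mult_def mult.commute)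
    finally show ?thesis .
  qed
  have ips: "ip \<sigma> (opt_from x) = x \<bullet> (P *v fst (\<sigma> 0))" if "finite_cost \<sigma>" for \<sigma> x
    by (simp add: ipo[OF that] ip_commute[of \<sigma> "\<beta> _"] ip\<beta>[OF that] inner_vec_def)
  have E: "ip (opt_from x) (opt_from x) = x \<bullet> (P *v x)" for x using ips[OF fo] by (simp add: start)
  show thesis
  proof (rule that[of P])
    have "transpose P = P" by (simp add: P_def transpose_def vec_eq_iff ip_commute)
    then show "pos_semidef P" using ip_nonneg[OF fo] E by (simp add: pos_semidef_def)
    fix \<sigma> assume \<sigma>: "finite_cost \<sigma>"
    let ?x = "fst (\<sigma> 0)"
    let ?h = "\<lambda>t. \<sigma> t + (-1) *\<^sub>R opt_from ?x t"
    have "0 \<le> ip ?h ?h" by (rule ip_nonneg[OF finite_cost_linear[OF \<sigma> fo]])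
    then show "?x \<bullet> (P *v ?x) \<le> ip \<sigma> \<sigma>" unfolding ip_square[OF \<sigma> fo] ips[OF \<sigma>] E by simp
  next
    fix x0
    show "\<exists>\<tau>. finite_cost \<tau> \<and> fst (\<tau> 0) = x0 \<and> ip \<tau> \<tau> = x0 \<bullet> (P *v x0)"
      using fo[of x0] start[of x0] E[of x0] by blast
  qed
qed

text \<open>Exponentially decaying trajectories \<open>e\<^sup>-\<^sup>l\<^sup>t (\<eta>, \<omega>)\<close> have \<open>l \<eta> = - (A \<eta> + B \<omega>)\<close>, so \<open>l \<eta>\<close>
  tends to \<open>- B \<omega>\<close> for large \<open>l\<close>, whereas the cost, multiplied by \<open>l\<^sup>2\<close>, tends to \<open>0\<close> if
  \<open>R \<omega> = 0\<close>: an impulse in the direction \<open>\<omega>\<close> costs nothing.\<close>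

lemma cost_matrix_kernel:
  assumes P: "pos_semidef P"
    and low: "\<And>\<sigma>. finite_cost \<sigma> \<Longrightarrow> fst (\<sigma> 0) \<bullet> (P *v fst (\<sigma> 0)) \<le> ip \<sigma> \<sigma>"
    and \<omega>: "R *v \<omega> = 0"
  shows "P *v (B *v \<omega>) = 0"
proof (rule pos_semidef_kernel[OF P])
  let ?b = "B *v \<omega>"
  obtain K where K: "\<And>v. norm (A *v v) \<le> norm v * K" "0 < K"
    using bounded_linear.pos_bounded[OF matrix_vector_mul_bounded_linear[of A]] by blast
  have "\<exists>\<eta>. A *v \<eta> + l *\<^sub>R \<eta> = - ?b" if l: "K < l" for l
  proof -
    have "v = 0" if "(A + l *\<^sub>R mat 1) *v v = 0" for v
    proof (rule ccontr)
      assume v: "v \<noteq> 0"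
      have "A *v v + l *\<^sub>R v = 0"
        using that by (simp add: matrix_vector_mult_add_rdistrib scaleR_matrix_vector_assoc[symmetric])
      then have "norm (A *v v) = \<bar>l\<bar> * norm v" by (metis add_eq_0_iff norm_minus_cancel norm_scaleR)
      then show False using K(1)[of v] l K(2) v by (simp add: mult.commute)
    qed
    then obtain M where "M ** (A + l *\<^sub>R mat 1) = mat 1"
      using matrix_left_invertible_ker[of "A + l *\<^sub>R mat 1"] by blast
    then have "(A + l *\<^sub>R mat 1) ** M = mat 1" by (simp add: matrix_left_right_inverse)
    then have "(A + l *\<^sub>R mat 1) *v (M *v (- ?b)) = - ?b" by (simp add: matrix_vector_mul_assoc)
    then show ?thesis
      by (intro exI[of _ "M *v (- ?b)"])
        (simp add: matrix_vector_mult_add_rdistrib scaleR_matrix_vector_assoc[symmetric])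
  qed
  then obtain \<eta> where \<eta>: "\<And>l. K < l \<Longrightarrow> A *v \<eta> l + l *\<^sub>R \<eta> l = - ?b" by metis
  have ev: "\<forall>\<^sub>F l in at_top. K < l" by (rule eventually_gt_at_top)
  have \<eta>0: "(\<eta> \<longlongrightarrow> 0) at_top"
  proof (rule Lim_null_comparison)
    show "\<forall>\<^sub>F l in at_top. norm (\<eta> l) \<le> norm ?b / (l - K)"
      using ev
    proof eventually_elim
      case (elim l)
      have "l *\<^sub>R \<eta> l = - ?b - A *v \<eta> l" using \<eta>[OF elim] by (simp add: algebra_simps)
      then have "l * norm (\<eta> l) = norm (- ?b - A *v \<eta> l)"
        using elim K(2) by (metis abs_of_pos less_trans norm_scaleR)
      also have "\<dots> \<le> norm ?b + norm (\<eta> l) * K"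
        using norm_triangle_ineq4[of "- ?b" "A *v \<eta> l"] K(1)[of "\<eta> l"] by simp
      finally show ?case using elim by (simp add: field_simps)
    qed
    show "((\<lambda>l. norm ?b / (l - K)) \<longlongrightarrow> 0) at_top"
      using filterlim_tendsto_add_at_top[OF tendsto_const[of "- K"] filterlim_ident]
      by (intro tendsto_divide_0[OF tendsto_const] filterlim_at_top_imp_at_infinity) (simp add: add.commute)
  qed
  have \<eta>l: "((\<lambda>l. l *\<^sub>R \<eta> l) \<longlongrightarrow> - ?b) at_top"
  proof (rule Lim_transform_eventually)
    have "((\<lambda>l. - ?b - A *v \<eta> l) \<longlongrightarrow> - ?b - A *v 0) at_top"
      by (intro tendsto_intros bounded_linear.tendsto[OF matrix_vector_mul_bounded_linear] \<eta>0)
    then show "((\<lambda>l. - ?b - A *v \<eta> l) \<longlongrightarrow> - ?b) at_top" by simp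
    show "\<forall>\<^sub>F l in at_top. - ?b - A *v \<eta> l = l *\<^sub>R \<eta> l"
      using ev by eventually_elim (use \<eta> in \<open>simp add: algebra_simps\<close>)
  qed
  have cost: "(l *\<^sub>R \<eta> l) \<bullet> (P *v (l *\<^sub>R \<eta> l)) \<le> ((l *\<^sub>R \<eta> l) \<bullet> (Q *v (l *\<^sub>R \<eta> l))) * (1 / (2 * l))" if l: "K < l" for l
  proof -
    have l0: "0 < l" using l K by simp
    define \<sigma> where "\<sigma> t = exp (- l * t) *\<^sub>R (\<eta> l, \<omega>)" for t
    have de: "((\<lambda>t. exp (- l * t) *\<^sub>R v) has_vector_derivative - l *\<^sub>R (exp (- l * t) *\<^sub>R v)) (at t within I)"
      for v :: "'v::real_normed_vector" and t I
    proof -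
      have "((\<lambda>t. exp (- l * t)) has_real_derivative - l * exp (- l * t)) (at t within I)"
        by (auto intro!: derivative_eq_intros)
      from has_vector_derivative_scaleR[OF this has_vector_derivative_const[of v]] show ?thesis by simp
    qed
    have "trajectory A B (\<lambda>t. fst (\<sigma> t)) (\<lambda>t. snd (\<sigma> t))"
      unfolding trajectory_def
    proof (intro conjI allI impI)
      show "smooth_fun_on {0..} (\<lambda>t. snd (\<sigma> t))"
        by (rule smooth_fun_on_ode[OF bounded_linear_scaleR_right[of "- l"] smooth_fun_on_const[of _ 0]])
          (use de in \<open>simp add: \<sigma>_def\<close>)
      fix t
      have "- l *\<^sub>R (exp (- l * t) *\<^sub>R \<eta> l) = exp (- l * t) *\<^sub>R (- l *\<^sub>R \<eta> l)" by simp
      also have "- l *\<^sub>R \<eta> l = A *v \<eta> l + ?b"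
      proof -
        have "l *\<^sub>R \<eta> l = - ?b - A *v \<eta> l" using \<eta>[OF l] by (simp add: algebra_simps)
        then show ?thesis by simp
      qed
      finally show "((\<lambda>t. fst (\<sigma> t)) has_vector_derivative A *v fst (\<sigma> t) + B *v snd (\<sigma> t)) (at t within {0..})"
        using de[of "\<eta> l" t "{0..}"]
        by (simp add: \<sigma>_def matrix_vector_mult_scaleR scaleR_add_right)
    qed
    moreover have c: "corr (\<sigma> t) (\<sigma> t) = (\<eta> l \<bullet> (Q *v \<eta> l)) * exp (- (2 * l) * t)" for t
    proof -
      have "corr (\<sigma> t) (\<sigma> t) = exp (- l * t) * exp (- l * t) * (\<eta> l \<bullet> (Q *v \<eta> l))"
        by (simp add: corr_rate rate_def \<sigma>_def matrix_vector_mult_scaleR \<omega> S_kernel[OF \<omega>])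
      then show ?thesis by (simp add: exp_add[symmetric] algebra_simps)
    qed
    have e: "((\<lambda>t. exp (- (2 * l) * t)) has_integral 1 / (2 * l)) {0..}"
      using has_integral_exp_minus_to_infinity[of "2 * l" 0] l0 by simp
    have i: "((\<lambda>t. corr (\<sigma> t) (\<sigma> t)) has_integral (\<eta> l \<bullet> (Q *v \<eta> l)) * (1 / (2 * l))) {0..}"
      unfolding c by (rule has_integral_mult_right[OF e])
    ultimately have "finite_cost \<sigma>" by (auto simp: finite_cost_def)
    from low[OF this] have "\<eta> l \<bullet> (P *v \<eta> l) \<le> (\<eta> l \<bullet> (Q *v \<eta> l)) * (1 / (2 * l))"
      using integral_unique[OF i] by (simp add: ip_def \<sigma>_def)
    from mult_left_mono[OF this, of "l * l"] l0 show ?thesis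
      by (simp add: matrix_vector_mult_scaleR mult.assoc)
  qed
  have "(- ?b) \<bullet> (P *v (- ?b)) \<le> ((- ?b) \<bullet> (Q *v (- ?b))) * 0"
  proof (rule tendsto_le)
    show "((\<lambda>l. (l *\<^sub>R \<eta> l) \<bullet> (P *v (l *\<^sub>R \<eta> l))) \<longlongrightarrow> (- ?b) \<bullet> (P *v (- ?b))) at_top"
      by (intro tendsto_inner bounded_linear.tendsto[OF matrix_vector_mul_bounded_linear] \<eta>l)
    have "((\<lambda>l::real. 1 / (2 * l)) \<longlongrightarrow> 0) at_top"
      by (intro tendsto_divide_0[OF tendsto_const] filterlim_at_top_imp_at_infinity
          filterlim_tendsto_pos_mult_at_top[OF tendsto_const _ filterlim_ident]) simp
    then show "((\<lambda>l. ((l *\<^sub>R \<eta> l) \<bullet> (Q *v (l *\<^sub>R \<eta> l))) * (1 / (2 * l))) \<longlongrightarrow> ((- ?b) \<bullet> (Q *v (- ?b))) * 0) at_top"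
      by (intro tendsto_mult tendsto_inner bounded_linear.tendsto[OF matrix_vector_mul_bounded_linear] \<eta>l)
    show "\<forall>\<^sub>F l in at_top. (l *\<^sub>R \<eta> l) \<bullet> (P *v (l *\<^sub>R \<eta> l)) \<le> ((l *\<^sub>R \<eta> l) \<bullet> (Q *v (l *\<^sub>R \<eta> l))) * (1 / (2 * l))"
      using ev by eventually_elim (rule cost)
  qed simp
  then have "?b \<bullet> (P *v ?b) \<le> 0" by (simp add: linear_neg[OF matrix_vector_mul_linear])
  moreover have "0 \<le> ?b \<bullet> (P *v ?b)" using P by (simp add: pos_semidef_def)
  ultimately show "?b \<bullet> (P *v ?b) = 0" by simp
qed

lemma finite_cost_tail:
  assumes \<tau>: "finite_cost \<tau>" and t: "0 \<le> t"
  shows "finite_cost (\<lambda>s. \<tau> (t + s))"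
    "ip (\<lambda>s. \<tau> (t + s)) (\<lambda>s. \<tau> (t + s)) \<le> ip \<tau> \<tau> - integral {0..t} (\<lambda>s. corr (\<tau> s) (\<tau> s))"
proof -
  let ?q = "\<lambda>s. corr (\<tau> s) (\<tau> s)"
  have tr: "trajectory A B (\<lambda>t. fst (\<tau> t)) (\<lambda>t. snd (\<tau> t))" and i: "?q integrable_on {0..}"
    using \<tau> by (simp_all add: finite_cost_def)
  have qc: "continuous_on {0..} ?q" by (rule continuous_on_corr[OF tr tr])
  have tr': "trajectory A B (\<lambda>s. fst (\<tau> (t + s))) (\<lambda>s. snd (\<tau> (t + s)))"
    unfolding trajectory_def
  proof (intro conjI allI impI)
    show "smooth_fun_on {0..} (\<lambda>s. snd (\<tau> (t + s)))"
      using smooth_fun_on_shift[OF trajectory_smooth(1)[OF tr] t] .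
    fix s :: real assume "0 \<le> s"
    then show "((\<lambda>s. fst (\<tau> (t + s))) has_vector_derivative A *v fst (\<tau> (t + s)) + B *v snd (\<tau> (t + s))) (at s within {0..})"
      using tr t by (intro shift_has_vector_derivative[of t s "\<lambda>t. fst (\<tau> t)"]) (auto simp: trajectory_def)
  qed
  have "integral {0..T} (\<lambda>s. corr (\<tau> (t + s)) (\<tau> (t + s))) \<le> ip \<tau> \<tau> - integral {0..t} ?q" if T: "0 \<le> T" for T
  proof -
    have c: "continuous_on {a..b} ?q" if "0 \<le> a" for a b
      by (rule continuous_on_subset[OF qc]) (use that in auto)
    have "integral {0..T} (\<lambda>s. corr (\<tau> (t + s)) (\<tau> (t + s))) = integral {t..t + T} ?q"
      using integral_shift[of 0 t T ?q] c[OF t] by (simp add: o_def add.commute)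
    also have "\<dots> = integral {0..t + T} ?q - integral {0..t} ?q"
      using Henstock_Kurzweil_Integration.integral_combine[of 0 t "t + T" ?q] t T
      by (simp add: integrable_continuous_real c)
    also have "\<dots> \<le> ip \<tau> \<tau> - integral {0..t} ?q"
      unfolding ip_def using integral_le_half_line_integral[OF qc corr_nonneg i] by simp
    finally show ?thesis .
  qed
  note b = half_line_bounded_integrable[OF continuous_on_corr[OF tr' tr'] corr_nonneg this]
  show "finite_cost (\<lambda>s. \<tau> (t + s))" using tr' b(1) by (simp add: finite_cost_def)
  show "ip (\<lambda>s. \<tau> (t + s)) (\<lambda>s. \<tau> (t + s)) \<le> ip \<tau> \<tau> - integral {0..t} ?q"
    using b(2) by (simp add: ip_def)
qed

lemma ricc_symmetric:
  assumes X: "transpose X = X"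
  shows "y \<bullet> ricc X x = ricc X y \<bullet> x"
proof -
  have Xs: "y \<bullet> (X *v z) = (X *v y) \<bullet> z" for y z using X by (simp add: symmetric_iff_inner)
  have 1: "y \<bullet> (X *v (A0 *v x)) = (transpose A0 *v (X *v y)) \<bullet> x" for x y
    by (metis Xs inner_matrix_vector)
  have 2: "y \<bullet> (Q0 *v x) = (Q0 *v y) \<bullet> x"
    using Q0_pos_semidef by (simp add: pos_semidef_def symmetric_iff_inner)
  have 3: "y \<bullet> (X *v (B *v (N *v (transpose B *v (X *v x))))) = (X *v (B *v (N *v (transpose B *v (X *v y))))) \<bullet> x"
  proof -
    have "y \<bullet> (X *v (B *v (N *v (transpose B *v (X *v x))))) = (transpose B *v (X *v y)) \<bullet> (N *v (transpose B *v (X *v x)))" for x y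
      by (subst Xs) (rule inner_matrix_vector)
    then show ?thesis by (metis N_inner inner_commute)
  qed
  have 4: "y \<bullet> (transpose A0 *v (X *v x)) = (X *v (A0 *v y)) \<bullet> x"
    using 1[of x y] by (metis 1 inner_commute)
  show ?thesis by (simp add: ricc_def inner_add_left inner_add_right inner_diff_left inner_diff_right 1 2 3 4)
qed

text \<open>The form of the optimal cost bounds the cost of tails, so along an optimal trajectory the
  value of the form plus the cost paid so far is largest at time \<open>0\<close>; its derivative there bounds
  the Riccati residual by \<open>0\<close> from above. If the residual were negative somewhere, the feedback
  \<open>gain P\<close> started there would cost less than the optimum.\<close>

lemma riccati_solution_from_optima:
  assumes opt: "\<And>x0. \<exists>\<tau>. optimal \<tau> \<and> fst (\<tau> 0) = x0"
  shows "\<exists>X. pos_semidef X \<and> cgcare A B Q S R X"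
proof -
  obtain P where P: "pos_semidef P" and low: "\<And>\<sigma>. finite_cost \<sigma> \<Longrightarrow> fst (\<sigma> 0) \<bullet> (P *v fst (\<sigma> 0)) \<le> ip \<sigma> \<sigma>"
    and ex: "\<And>x0. \<exists>\<tau>. finite_cost \<tau> \<and> fst (\<tau> 0) = x0 \<and> ip \<tau> \<tau> = x0 \<bullet> (P *v x0)"
    by (rule optimal_cost_matrix[OF opt]) (rule that)
  have Ps: "transpose P = P" and Pp: "0 \<le> x \<bullet> (P *v x)" for x using P by (auto simp: pos_semidef_def)
  have Psym: "x \<bullet> (P *v y) = (P *v x) \<bullet> y" for x y using Ps by (simp add: symmetric_iff_inner)
  have ker: "P *v (B *v u) = 0" if "R *v u = 0" for u by (rule cost_matrix_kernel[OF P low that])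
  have le0: "x0 \<bullet> ricc P x0 \<le> 0" for x0
  proof -
    obtain \<tau> where \<tau>: "finite_cost \<tau>" "fst (\<tau> 0) = x0" "ip \<tau> \<tau> = x0 \<bullet> (P *v x0)" using ex by blast
    have tr: "trajectory A B (\<lambda>t. fst (\<tau> t)) (\<lambda>t. snd (\<tau> t))" using \<tau> by (simp add: finite_cost_def)
    let ?x = "\<lambda>t. fst (\<tau> t)" and ?u0 = "snd (\<tau> 0)" and ?q = "\<lambda>s. corr (\<tau> s) (\<tau> s)"
    define g where "g t = ?x t \<bullet> (P *v ?x t) + integral {0..t} ?q" for t
    have "g t \<le> g 0" if "0 \<le> t" for t
      using low[OF finite_cost_tail(1)[OF \<tau>(1) that]] finite_cost_tail(2)[OF \<tau>(1) that] \<tau> by (simp add: g_def)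
    moreover have "(g has_vector_derivative (?x 0 \<bullet> (P *v (A *v x0 + B *v ?u0)) + (A *v x0 + B *v ?u0) \<bullet> (P *v ?x 0)) + ?q 0) (at 0 within {0..})"
    proof -
      have x: "(?x has_vector_derivative A *v x0 + B *v ?u0) (at 0 within {0..})"
        using tr \<tau>(2) by (auto simp: trajectory_def)
      have "((\<lambda>t. integral {0..t} ?q) has_vector_derivative ?q 0) (at 0 within {0..1})"
        by (intro integral_has_vector_derivative continuous_on_subset[OF continuous_on_corr[OF tr tr]]) auto
      then have "((\<lambda>t. integral {0..t} ?q) has_vector_derivative ?q 0) (at 0 within {0..})"
        by (simp add: has_vector_derivative_def at_within_Icc_at_right at_within_Ici_at_right)
      then show ?thesis unfolding g_def
        by (intro has_vector_derivative_add inner_has_vector_derivative x matrix_has_vector_derivative)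
    qed
    ultimately have "(?x 0 \<bullet> (P *v (A *v x0 + B *v ?u0)) + (A *v x0 + B *v ?u0) \<bullet> (P *v ?x 0)) + ?q 0 \<le> 0"
      using derivative_nonpos_at_max by blast
    moreover have "x0 \<bullet> (P *v w) + w \<bullet> (P *v x0) = 2 * ((P *v x0) \<bullet> w)" for w
      by (metis Psym inner_commute mult_2)
    ultimately have "rate Q S R x0 ?u0 + 2 * ((P *v x0) \<bullet> (A *v x0 + B *v ?u0)) \<le> 0"
      by (simp only: \<tau>(2) corr_rate)
    then show ?thesis
      using dissipation[OF Ps ker, of x0 ?u0] R_nonneg[of "?u0 - gain P *v x0"] by linarith
  qed
  have eq0: "x0 \<bullet> ricc P x0 = 0" for x0
  proof -
    obtain x where tr: "trajectory A B x (\<lambda>t. gain P *v x t)" and x0: "x 0 = x0"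
      using feedback_trajectory_exists[of A B "gain P" x0] by blast
    let ?q = "\<lambda>t. rate Q S R (x t) (gain P *v x t)" and ?e = "\<lambda>t. x t \<bullet> ricc P (x t)"
    have qc: "continuous_on {0..} ?q" by (intro continuous_on_rate trajectory_smooth[OF tr])
    have "continuous_on {0..} (\<lambda>t. ricc P (x t))"
      unfolding ricc_def
      by (intro continuous_intros trajectory_smooth[OF tr])
    then have ec: "continuous_on {0..} ?e" by (intro continuous_intros trajectory_smooth[OF tr])
    have c: "continuous_on {0..T} ?q" "continuous_on {0..T} ?e" for T
      by (rule continuous_on_subset[OF qc], simp) (rule continuous_on_subset[OF ec], simp)
    have J: "integral {0..T} ?q \<le> x0 \<bullet> (P *v x0) + integral {0..T} ?e" if T: "0 \<le> T" for T
    proof -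
      have "integral {0..T} ?q - integral {0..T} ?e = integral {0..T} (\<lambda>t. ?q t - ?e t)"
        by (intro integral_diff[symmetric] integrable_continuous_real c)
      also have "\<dots> = x 0 \<bullet> (P *v x 0) - x T \<bullet> (P *v x T)"
        using integral_unique[OF cost_of_trajectory[OF Ps ker tr T]] by simp
      finally show ?thesis using Pp[of "x T"] by (simp add: x0)
    qed
    have mono: "integral {0..b} ?e \<le> integral {0..a} ?e" if "0 \<le> a" "a \<le> b" for a b
    proof -
      have "(\<lambda>t. - ?e t) integrable_on {a..b}"
        by (intro integrable_neg integrable_continuous_real continuous_on_subset[OF ec]) (use that in auto)
      then have "0 \<le> integral {a..b} (\<lambda>t. - ?e t)"
        by (rule integral_nonneg) (use le0 in simp)
      then have "integral {a..b} ?e \<le> 0" by simp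
      then show ?thesis
        using Henstock_Kurzweil_Integration.integral_combine[of 0 a b ?e] that
        by (simp add: integrable_continuous_real c)
    qed
    (* any fixed positive horizon in place of 1 detects a negative residual at time 0 *)
    have "integral {0..T} ?q \<le> x0 \<bullet> (P *v x0) + integral {0..1} ?e" if T: "0 \<le> T" for T
    proof -
      have "integral {0..T} ?q \<le> integral {0..max T 1} ?q"
        by (rule integral_subset_le) (auto intro: integrable_continuous_real c rate_nonneg)
      also have "\<dots> \<le> x0 \<bullet> (P *v x0) + integral {0..max T 1} ?e" by (rule J) simp
      also have "integral {0..max T 1} ?e \<le> integral {0..1} ?e" by (rule mono) auto
      finally show ?thesis by simp
    qed
    note b = half_line_bounded_integrable[OF qc rate_nonneg this]
    have "finite_cost (\<lambda>t. (x t, gain P *v x t))" using tr b(1) by (simp add: finite_cost_def corr_rate)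
    from low[OF this] have "x0 \<bullet> (P *v x0) \<le> integral {0..} ?q" by (simp add: ip_def corr_rate x0)
    then have "integral {0..1} ?e \<ge> 0" using b(2) by linarith
    moreover have "integral {0..1} ?e \<le> 0" using mono[of 0 1] by simp
    ultimately have "integral {0..1} (\<lambda>t. - ?e t) = 0" by simp
    moreover have "continuous_on {0..1} (\<lambda>t. - ?e t)" by (intro continuous_on_minus c)
    ultimately have "\<forall>t\<in>{0..1}. - ?e t = 0" using integral_eq_0_iff[of 0 1 "\<lambda>t. - ?e t"] le0 by simp
    then show ?thesis by (auto simp: x0 dest: bspec[of _ _ 0])
  qed
  have "ricc P x = 0" for x
  proof -
    define M where "M = P ** A0 + transpose A0 ** P + Q0 - P ** B ** N ** transpose B ** P"
    have M: "M *v y = ricc P y" for y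
      by (simp add: M_def ricc_def matrix_vector_mult_add_rdistrib matrix_vector_mult_diff_rdistrib matrix_vector_mul_assoc matrix_mul_assoc)
    have "pos_semidef M"
      unfolding pos_semidef_def symmetric_iff_inner M by (simp add: eq0) (simp add: ricc_symmetric[OF Ps])
    from pos_semidef_kernel[OF this] show ?thesis using eq0[of x] by (simp add: M)
  qed
  then have "cgcare A B Q S R P" using ker by (simp add: cgcare_iff[OF Ps])
  then show ?thesis using P by blast
qed

end


section \<open>The equivalences\<close>

lemma impulsive_smooth_regular:
  assumes "smooth_fun_on {0..} u"
  shows "impulsive_smooth (regular_distr u)" "no_impulsive_part (regular_distr u)"
proof -
  show "impulsive_smooth (regular_distr u)"
    unfolding impulsive_smooth_def
    by (intro exI[of _ 0] exI[of _ "\<lambda>_. 0"] exI[of _ u]) (use assms in simp)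
  show "no_impulsive_part (regular_distr u)"
    unfolding no_impulsive_part_def using assms by blast
qed

context
  fixes A Q :: "real^'n^'n" and B S :: "real^'m^'n" and R :: "real^'m^'m"
  assumes psd: "pos_semidef (popov_matrix Q S R)"
begin

lemma riccati_if_regular_solutions:
  assumes sol: "\<And>x0. \<exists>u. is_regular_solution A B Q S R x0 u"
  shows "\<exists>X. pos_semidef X \<and> cgcare A B Q S R X"
proof -
  obtain p C D where "factored_system Q S R p C D"
    using exists_factorization[OF psd] by (auto simp: factored_system_def)
  then interpret factored_system A Q B S R p C D .
  have cost: "cost A B Q S R (fst (\<tau> 0)) (regular_distr (\<lambda>t. snd (\<tau> t))) = ennreal (ip \<tau> \<tau>)"
    if \<tau>: "finite_cost \<tau>" for \<tau>
  proof -
    have tr: "trajectory A B (\<lambda>t. fst (\<tau> t)) (\<lambda>t. snd (\<tau> t))" and i: "(\<lambda>t. corr (\<tau> t) (\<tau> t)) integrable_on {0..}"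
      using \<tau> by (simp_all add: finite_cost_def)
    show ?thesis
      using cost_regular[OF psd tr, of "regular_distr (\<lambda>t. snd (\<tau> t))"]
        half_line_nn_integral[OF continuous_on_corr[OF tr tr] corr_nonneg i]
      by (simp add: corr_rate ip_def)
  qed
  have "\<exists>\<tau>. optimal \<tau> \<and> fst (\<tau> 0) = x0" for x0
  proof -
    obtain U where U: "is_solution A B Q S R x0 U" "no_impulsive_part U"
      using sol[of x0] by (auto simp: is_regular_solution_def)
    obtain u where u: "smooth_fun_on {0..} u" "\<And>\<phi>. \<phi> \<in> test_funs \<Longrightarrow> U \<phi> = regular_distr u \<phi>"
      using U(2) by (auto simp: no_impulsive_part_def)
    obtain x where x: "trajectory A B x u" "x 0 = x0" using trajectory_exists[OF u(1)] by blast
    define \<tau> where "\<tau> t = (x t, u t)" for t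
    have tr: "trajectory A B (\<lambda>t. fst (\<tau> t)) (\<lambda>t. snd (\<tau> t))" using x by (simp add: \<tau>_def)
    have cU: "cost A B Q S R x0 U = (\<integral>\<^sup>+t\<in>{0..}. ennreal (corr (\<tau> t) (\<tau> t)) \<partial>lborel)"
      using cost_regular[OF psd x(1) u(2)] x(2) by (simp add: corr_rate \<tau>_def)
    have "(\<integral>\<^sup>+t\<in>{0..}. ennreal (corr (\<tau> t) (\<tau> t)) \<partial>lborel) < \<infinity>"
      using U(1) unfolding cU[symmetric] is_solution_def by blast
    then have i: "(\<lambda>t. corr (\<tau> t) (\<tau> t)) integrable_on {0..}"
      by (rule half_line_finite_nn_integral[OF continuous_on_corr[OF tr tr] corr_nonneg])
    then have f: "finite_cost \<tau>" using tr by (simp add: finite_cost_def)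
    have cU': "cost A B Q S R x0 U = ennreal (ip \<tau> \<tau>)"
      unfolding cU ip_def by (rule half_line_nn_integral[OF continuous_on_corr[OF tr tr] corr_nonneg i])
    have "ip \<tau> \<tau> \<le> ip \<sigma> \<sigma>" if \<sigma>: "finite_cost \<sigma>" "fst (\<sigma> 0) = x0" for \<sigma>
    proof -
      have "smooth_fun_on {0..} (\<lambda>t. snd (\<sigma> t))" using \<sigma>(1) by (simp add: finite_cost_def trajectory_def)
      from impulsive_smooth_regular(1)[OF this] U(1)
      have "cost A B Q S R x0 U \<le> cost A B Q S R x0 (regular_distr (\<lambda>t. snd (\<sigma> t)))"
        by (simp add: is_solution_def)
      also have "\<dots> = ennreal (ip \<sigma> \<sigma>)" using cost[OF \<sigma>(1)] \<sigma>(2) by simp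
      finally show ?thesis by (simp add: cU' ennreal_le_iff ip_nonneg[OF \<sigma>(1)])
    qed
    then show ?thesis using f x(2) by (intro exI[of _ \<tau>]) (auto simp: optimal_def \<tau>_def)
  qed
  then show ?thesis by (rule riccati_solution_from_optima)
qed

lemma feedback_cost:
  assumes X: "pos_semidef X" "cgcare A B Q S R X"
  obtains u where "impulsive_smooth u" "no_impulsive_part u" "cost A B Q S R x0 u \<le> ennreal (x0 \<bullet> (X *v x0))"
proof -
  obtain p C D where "factored_system Q S R p C D"
    using exists_factorization[OF psd] by (auto simp: factored_system_def)
  then interpret factored_system A Q B S R p C D .
  obtain x where tr: "trajectory A B x (\<lambda>t. gain X *v x t)" and x0: "x 0 = x0"
    using feedback_trajectory_exists[of A B "gain X" x0] by blast
  let ?U = "regular_distr (\<lambda>t. gain X *v x t)"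
  have "cost A B Q S R x0 ?U \<le> ennreal (x0 \<bullet> (X *v x0))"
    using cost_le_storage[OF X tr] cost_regular[OF psd tr, of ?U] by (simp add: x0)
  then show thesis
    using that[of ?U] impulsive_smooth_regular[OF trajectory_smooth(1)[OF tr]] by blast
qed

lemma regular_solutions_if_subspaces_coincide:
  assumes eq: "\<And>p C D. factorization Q S R p C D \<Longrightarrow> S_star A B p C D = R_star A B p C D"
    and fin: "\<And>x0. \<exists>u. impulsive_smooth u \<and> cost A B Q S R x0 u < \<infinity>"
  shows "\<exists>u. is_regular_solution A B Q S R x0 u"
proof -
  obtain p C D where f: "factored_system Q S R p C D"
    and cost: "\<And>A B x0 U. cost A B Q S R x0 U = output_energy A B p C D x0 U"
    using cost_eq_output_energy[OF psd] by blast
  interpret factored_system A Q B S R p C D by (rule f)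
  let ?W = "S_star A B p C D"
  note eqW = eq[OF fac]
  have ic: "subspace ?W" "\<And>x u. x \<in> ?W \<Longrightarrow> \<forall>i<p. C i \<bullet> x + D i \<bullet> u = 0 \<Longrightarrow> A *v x + B *v u \<in> ?W"
    using input_containing_S_star[of A B p C D] by (auto simp: input_containing_iff)
  have "B *v u \<in> ?W" if "R *v u = 0" for u
    using ic(2)[OF subspace_0[OF ic(1)], of u] that by (simp add: R_kernel)
  moreover have "\<exists>U. output_energy A B p C D x0 U < \<infinity>" for x0
    using fin[of x0] unfolding cost by blast
  ultimately obtain X where X: "pos_semidef X" "cgcare A B Q S R X"
    and low: "\<And>x0 U. ennreal (x0 \<bullet> (X *v x0)) \<le> cost A B Q S R x0 U"
    using riccati_solution_from_subspace[OF ic(1) _ friend_of_R_star[OF eqW]] unfolding cost by blast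
  obtain u where u: "impulsive_smooth u" "no_impulsive_part u" "cost A B Q S R x0 u \<le> ennreal (x0 \<bullet> (X *v x0))"
    by (rule feedback_cost[OF X]) (rule that)
  have "cost A B Q S R x0 u < \<infinity>" using u(3) by (rule order_le_less_trans) simp
  moreover have "cost A B Q S R x0 u \<le> cost A B Q S R x0 v" for v
    using u(3) low by (rule order_trans)
  ultimately have "is_regular_solution A B Q S R x0 u"
    using u(1,2) by (simp add: is_regular_solution_def is_solution_def)
  then show ?thesis by blast
qed

lemma subspaces_coincide_if_riccati:
  assumes "transpose X = X" "cgcare A B Q S R X" "factorization Q S R p C D"
  shows "S_star A B p C D = R_star A B p C D"
  using factored_system.S_star_eq_R_star[of Q S R p C D X A B] assms by (simp add: factored_system_def)

lemma finite_cost_if_riccati: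
  assumes "pos_semidef X" "cgcare A B Q S R X"
  shows "\<exists>u. impulsive_smooth u \<and> cost A B Q S R x0 u < \<infinity>"
  by (rule feedback_cost[OF assms, of x0]) (auto intro!: exI intro: order_le_less_trans[of _ "ennreal _"])

end

theorem theorem1:
  fixes A Q :: "real^'n^'n" and B S :: "real^'m^'n" and R :: "real^'m^'m"
  assumes "pos_semidef (popov_matrix Q S R)"
  shows
    "((\<forall>x0. \<exists>u. is_regular_solution A B Q S R x0 u) \<longleftrightarrow>
        (\<exists>X. pos_semidef X \<and> cgcare A B Q S R X)) \<and>
     ((\<forall>x0. \<exists>u. is_regular_solution A B Q S R x0 u) \<longleftrightarrow>
        (\<exists>X. transpose X = X \<and> cgcare A B Q S R X) \<and>
        (\<forall>x0. \<exists>u. impulsive_smooth u \<and> cost A B Q S R x0 u < \<infinity>)) \<and>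
     ((\<forall>x0. \<exists>u. is_regular_solution A B Q S R x0 u) \<longleftrightarrow>
        (\<forall>p C D. factorization Q S R p C D \<longrightarrow> S_star A B p C D = R_star A B p C D) \<and>
        (\<forall>x0. \<exists>u. impulsive_smooth u \<and> cost A B Q S R x0 u < \<infinity>))"
    (is "(?a \<longleftrightarrow> ?b) \<and> (?a \<longleftrightarrow> ?c \<and> ?fin) \<and> (?a \<longleftrightarrow> ?d \<and> ?fin)")
proof -
  have "?a \<Longrightarrow> ?b" using riccati_if_regular_solutions[OF assms] by blast
  moreover have "?b \<Longrightarrow> ?c \<and> ?fin"
    using finite_cost_if_riccati[OF assms] by (auto simp: pos_semidef_def)
  moreover have "?c \<and> ?fin \<Longrightarrow> ?d \<and> ?fin"
    using subspaces_coincide_if_riccati[OF assms] by blast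
  moreover have "?d \<and> ?fin \<Longrightarrow> ?a"
    using regular_solutions_if_subspaces_coincide[OF assms] by blast
  ultimately show ?thesis by argo
qed

end
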